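(* Let $\mathcal M$ be a compact complex supermanifold. The set $\mathrm{Aut}_{\bar 0}(\mathcal M)$ is a topological group with composition of automorphisms as multiplication and inversion of automorphisms as the inverse.
   Context: A complex supermanifold $\mathcal M=(M,\mathcal O_{\mathcal M})$ of dimension $(m|n)$ is a complex manifold $M$ with a sheaf $\mathcal O_{\mathcal M}$ of $\mathbb Z_2$-graded algebras which is locally, on small open $U\subset M$, isomorphic to $\mathcal O_U\otimes\bigwedge\mathbb C^n$, with $\mathcal O_U$ the sheaf of holomorphic functions; it is compact if $M$ is compact. A morphism $\varphi$ has underlying map $\tilde\varphi$ and parity-preserving pullback $\varphi^*$. $\mathrm{Aut}_{\bar 0}(\mathcal M)$ is the set of automorphisms (biholomorphic morphisms $\mathcal M\to\mathcal M$), with the topology generated by the following subbase. For $K\subseteq M$ compact contained in a coordinate domain with odd coordinates $\theta_1,\dots,\theta_n$, $U\subseteq M$ open, $f\in\mathcal O_{\mathcal M}(U)$, and $U_\nu\subseteq\mathbb C$ open ($\nu\in(\mathbb Z_2)^n$), the set of all $\varphi$ with $\tilde\varphi(K)\subseteq U$ and $\varphi_{f,\nu}(K)\subseteq U_\nu$ for all $\nu$, where $\varphi^*(f)=\sum_\nu\varphi_{f,\nu}\theta^\nu$ near $K$ with $\varphi_{f,\nu}$ holomorphic. *)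

theory Defs
  imports "HOL-Analysis.Analysis" "HOL-Algebra.Module" "HOL-Library.Z2"
begin

section \<open>Holomorphic functions on complex manifolds\<close>

text \<open>The space of \<open>m\<close> complex coordinates is realised inside \<open>nat \<Rightarrow> complex\<close>, so that \<open>m\<close> is an
  ordinary natural number and may be \<open>0\<close>; the product topology of \<open>nat \<Rightarrow> complex\<close> induces the
  usual topology on it.\<close>

definition cspace :: "nat \<Rightarrow> (nat \<Rightarrow> complex) set" where
  "cspace m = {z. \<forall>i\<ge>m. z i = 0}"

text \<open>Complex Frechet differentiability at every point of \<open>D\<close>, which is meant to be open in
  \<open>cspace m\<close>; the coefficients \<open>a i\<close> are the complex partial derivatives.\<close>

definition holo :: "nat \<Rightarrow> (nat \<Rightarrow> complex) set \<Rightarrow> ((nat \<Rightarrow> complex) \<Rightarrow> complex) \<Rightarrow> bool" where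
  "holo m D f \<longleftrightarrow>
    (\<forall>z\<in>D. \<exists>a :: nat \<Rightarrow> complex.
      ((\<lambda>w. cmod (f w - f z - (\<Sum>i<m. a i * (w i - z i))) / L2_set (\<lambda>i. cmod (w i - z i)) {..<m})
        \<longlongrightarrow> 0) (at z within D))"

definition holo_map ::
  "nat \<Rightarrow> (nat \<Rightarrow> complex) set \<Rightarrow> ((nat \<Rightarrow> complex) \<Rightarrow> nat \<Rightarrow> complex) \<Rightarrow> bool" where
  "holo_map m D h \<longleftrightarrow> (\<forall>i<m. holo m D (\<lambda>z. h z i))"

type_synonym 'p chart = "'p set \<times> ('p \<Rightarrow> nat \<Rightarrow> complex)"

definition holo_compatible :: "nat \<Rightarrow> 'p chart \<Rightarrow> 'p chart \<Rightarrow> bool" where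
  "holo_compatible m = (\<lambda>(U, c) (V, d).
     holo_map m (c ` (U \<inter> V)) (d \<circ> inv_into U c) \<and> holo_map m (d ` (U \<inter> V)) (c \<circ> inv_into V d))"

text \<open>Holomorphic charts for the complex structure given by the atlas \<open>A\<close>; they need not
  belong to \<open>A\<close> itself.\<close>

definition holo_chart :: "nat \<Rightarrow> 'p topology \<Rightarrow> 'p chart set \<Rightarrow> 'p chart \<Rightarrow> bool" where
  "holo_chart m X A = (\<lambda>(U, c).
     openin X U \<and> openin (top_of_set (cspace m)) (c ` U) \<and>
     homeomorphic_map (subtopology X U) (top_of_set (c ` U)) c \<and>
     (\<forall>C\<in>A. holo_compatible m (U, c) C))"

locale complex_manifold =
  fixes m :: nat and X :: "'p topology" and A :: "'p chart set"
  assumes hausdorff: "Hausdorff_space X"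
    and second_countable: "second_countable X"
    and atlas_covers: "(\<Union>C\<in>A. fst C) = topspace X"
    and atlas_charts: "C \<in> A \<Longrightarrow> holo_chart m X A C"

definition holo_functions :: "nat \<Rightarrow> 'p chart set \<Rightarrow> 'p set \<Rightarrow> ('p \<Rightarrow> complex) set" where
  "holo_functions m A V =
    {f \<in> extensional V. \<forall>(U, c)\<in>A. holo m (c ` (U \<inter> V)) (f \<circ> inv_into U c)}"


section \<open>Sheaves of \<open>\<int>\<^sub>2\<close>-graded algebras\<close>

definition complex_field :: "complex ring" where
  "complex_field = \<lparr>carrier = UNIV, mult = (*), one = 1, zero = 0, add = (+)\<rparr>"

locale graded_algebra = Module.module complex_field R + ring R
  for R :: "(complex, 's) module" (structure) +
  fixes P :: "bit \<Rightarrow> 's set"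
  assumes smult_mult_left:
      "\<lbrakk>x \<in> carrier R; y \<in> carrier R\<rbrakk> \<Longrightarrow> (a \<odot> x) \<otimes> y = a \<odot> (x \<otimes> y)"
    and smult_mult_right:
      "\<lbrakk>x \<in> carrier R; y \<in> carrier R\<rbrakk> \<Longrightarrow> x \<otimes> (a \<odot> y) = a \<odot> (x \<otimes> y)"
    and part_submodule: "submodule (P p) complex_field R"
    and part_decomp:
      "x \<in> carrier R \<Longrightarrow> \<exists>!d. fst d \<in> P 0 \<and> snd d \<in> P 1 \<and> x = fst d \<oplus> snd d"
    and part_mult: "\<lbrakk>x \<in> P p; y \<in> P q\<rbrakk> \<Longrightarrow> x \<otimes> y \<in> P (p + q)"

definition graded_hom ::
  "(complex, 's) module \<Rightarrow> (bit \<Rightarrow> 's set) \<Rightarrow> (complex, 't) module \<Rightarrow> (bit \<Rightarrow> 't set)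
    \<Rightarrow> ('s \<Rightarrow> 't) set" where
  "graded_hom R P S Q =
    {h \<in> ring_hom R S.
       (\<forall>a. \<forall>x\<in>carrier R. h (a \<odot>\<^bsub>R\<^esub> x) = a \<odot>\<^bsub>S\<^esub> h x) \<and> (\<forall>p. h ` P p \<subseteq> Q p)}"

text \<open>\<open>restr F U V\<close> is the restriction from \<open>U\<close> to \<open>V \<subseteq> U\<close>. Only the values at open sets are
  meaningful. All sections live in one type, but sections over different open
  sets are never compared.\<close>

record ('p, 's) graded_sheaf =
  sections :: "'p set \<Rightarrow> (complex, 's) module"
  part :: "'p set \<Rightarrow> bit \<Rightarrow> 's set"
  restr :: "'p set \<Rightarrow> 'p set \<Rightarrow> 's \<Rightarrow> 's"

abbreviation sects :: "('p, 's) graded_sheaf \<Rightarrow> 'p set \<Rightarrow> 's set" where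
  "sects F U \<equiv> carrier (sections F U)"

locale sheaf_of_graded_algebras =
  fixes X :: "'p topology" and F :: "('p, 's) graded_sheaf"
  assumes sections_algebra: "openin X U \<Longrightarrow> graded_algebra (sections F U) (part F U)"
    and restr_hom:
      "\<lbrakk>openin X U; openin X V; V \<subseteq> U\<rbrakk> \<Longrightarrow>
         restr F U V \<in> graded_hom (sections F U) (part F U) (sections F V) (part F V)"
    and restr_id: "\<lbrakk>openin X U; s \<in> sects F U\<rbrakk> \<Longrightarrow> restr F U U s = s"
    and restr_trans:
      "\<lbrakk>openin X U; openin X V; openin X W; W \<subseteq> V; V \<subseteq> U; s \<in> sects F U\<rbrakk> \<Longrightarrow>
         restr F V W (restr F U V s) = restr F U W s"
    and gluing:
      "\<lbrakk>\<And>V. V \<in> \<V> \<Longrightarrow> openin X V; \<And>V. V \<in> \<V> \<Longrightarrow> \<sigma> V \<in> sects F V;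
        \<And>V W. \<lbrakk>V \<in> \<V>; W \<in> \<V>\<rbrakk> \<Longrightarrow> restr F V (V \<inter> W) (\<sigma> V) = restr F W (V \<inter> W) (\<sigma> W)\<rbrakk> \<Longrightarrow>
         \<exists>!t. t \<in> sects F (\<Union>\<V>) \<and> (\<forall>V\<in>\<V>. restr F (\<Union>\<V>) V t = \<sigma> V)"


section \<open>Complex supermanifolds\<close>

text \<open>Multi-indices in \<open>(\<int>\<^sub>2)\<^sup>n\<close> are represented by their supports \<open>S \<subseteq> {..<n}\<close>, with \<open>\<theta>\<^sup>S\<close> the product
  of the \<open>\<theta>\<^sub>j\<close>, \<open>j \<in> S\<close>, in increasing order. For disjoint \<open>S\<close>, \<open>T\<close> we have
  \<open>\<theta>\<^sup>S \<theta>\<^sup>T = ext_sign S T \<theta>\<^bsup>S \<union> T\<^esup>\<close>; otherwise the product is \<open>0\<close>.\<close>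

definition ext_sign :: "nat set \<Rightarrow> nat set \<Rightarrow> complex" where
  "ext_sign S T = (-1) ^ card {(i, j). i \<in> S \<and> j \<in> T \<and> j < i}"

text \<open>The sheaf of holomorphic functions tensored with the exterior algebra on \<open>\<theta>\<^sub>0, \<dots>, \<theta>\<^bsub>n-1\<^esub>\<close>:
  the family \<open>F\<close> stands for the sum of all \<open>F S \<theta>\<^sup>S\<close>.\<close>

definition split_sheaf ::
  "nat \<Rightarrow> nat \<Rightarrow> 'p chart set \<Rightarrow> ('p, nat set \<Rightarrow> 'p \<Rightarrow> complex) graded_sheaf" where
  "split_sheaf m n A = \<lparr>
     sections = (\<lambda>V. \<lparr>
       carrier = Pow {..<n} \<rightarrow>\<^sub>E holo_functions m A V,
       mult = (\<lambda>F G. \<lambda>S\<in>Pow {..<n}. \<lambda>x\<in>V. \<Sum>T\<in>Pow S. ext_sign T (S - T) * F T x * G (S - T) x),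
       one = (\<lambda>S\<in>Pow {..<n}. \<lambda>x\<in>V. if S = {} then 1 else 0),
       zero = (\<lambda>S\<in>Pow {..<n}. \<lambda>x\<in>V. 0),
       add = (\<lambda>F G. \<lambda>S\<in>Pow {..<n}. \<lambda>x\<in>V. F S x + G S x),
       smult = (\<lambda>a F. \<lambda>S\<in>Pow {..<n}. \<lambda>x\<in>V. a * F S x)\<rparr>),
     part = (\<lambda>V p. {F \<in> Pow {..<n} \<rightarrow>\<^sub>E holo_functions m A V.
       \<forall>S\<in>Pow {..<n}. of_nat (card S) \<noteq> p \<longrightarrow> F S = (\<lambda>x\<in>V. 0)}),
     restr = (\<lambda>U V F. \<lambda>S\<in>Pow {..<n}. restrict (F S) V)\<rparr>"

record ('p, 's) supermanifold =
  body :: "'p topology"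
  atlas :: "'p chart set"
  str_sheaf :: "('p, 's) graded_sheaf"

text \<open>\<open>\<tau>\<close> is an isomorphism, over the identity of \<open>U\<close>, from the structure sheaf restricted to \<open>U\<close>
  to the split model.\<close>

definition trivialization ::
  "nat \<Rightarrow> nat \<Rightarrow> ('p, 's) supermanifold \<Rightarrow> 'p set \<Rightarrow> ('p set \<Rightarrow> 's \<Rightarrow> nat set \<Rightarrow> 'p \<Rightarrow> complex) \<Rightarrow> bool"
where
  "trivialization m n M U \<tau> \<longleftrightarrow>
    (let F = str_sheaf M; G = split_sheaf m n (atlas M) in
      openin (body M) U \<and>
      (\<forall>V. openin (body M) V \<and> V \<subseteq> U \<longrightarrow>
        \<tau> V \<in> graded_hom (sections F V) (part F V) (sections G V) (part G V) \<and>
        bij_betw (\<tau> V) (sects F V) (sects G V)) \<and>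
      (\<forall>V W. openin (body M) V \<and> openin (body M) W \<and> W \<subseteq> V \<and> V \<subseteq> U \<longrightarrow>
        (\<forall>s\<in>sects F V. \<tau> W (restr F V W s) = restr G V W (\<tau> V s))))"

locale complex_supermanifold =
  complex_manifold m "body M" "atlas M" +
  sheaf_of_graded_algebras "body M" "str_sheaf M"
  for m n :: nat and M :: "('p, 's) supermanifold" +
  assumes locally_split: "x \<in> topspace (body M) \<Longrightarrow> \<exists>U \<tau>. x \<in> U \<and> trivialization m n M U \<tau>"

text \<open>A holomorphic chart \<open>c\<close> on \<open>U\<close> together with a trivialization \<open>\<tau>\<close> is the same thing as a system
  of even and odd coordinates on \<open>U\<close>: the even coordinates are the preimages under \<open>\<tau> U\<close> of the
  components of \<open>c\<close>, the odd coordinates are the preimages of the \<open>\<theta>\<^sub>j\<close>.\<close>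

definition coordinate_system ::
  "nat \<Rightarrow> nat \<Rightarrow> ('p, 's) supermanifold \<Rightarrow> 'p set \<Rightarrow> ('p \<Rightarrow> nat \<Rightarrow> complex)
    \<Rightarrow> ('p set \<Rightarrow> 's \<Rightarrow> nat set \<Rightarrow> 'p \<Rightarrow> complex) \<Rightarrow> bool" where
  "coordinate_system m n M U c \<tau> \<longleftrightarrow>
    holo_chart m (body M) (atlas M) (U, c) \<and> trivialization m n M U \<tau>"


section \<open>Morphisms and automorphisms\<close>

record ('p, 's, 'q, 't) super_map =
  under :: "'p \<Rightarrow> 'q"
  pull :: "'q set \<Rightarrow> 't \<Rightarrow> 's"

definition preim ::
  "('p, 's) supermanifold \<Rightarrow> ('p, 's, 'q, 't) super_map \<Rightarrow> 'q set \<Rightarrow> 'p set" where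
  "preim M \<phi> U = {x \<in> topspace (body M). under \<phi> x \<in> U}"

text \<open>Morphisms of spaces with a sheaf of \<open>\<int>\<^sub>2\<close>-graded complex algebras. The pullback of the value of a
  function is automatically the value of the pullback: if \<open>f - c\<close> is invertible near a point then so
  is its pullback. In particular the underlying map is automatically holomorphic. Both components
  are normalised outside their domains, so that equality of records is equality of morphisms.\<close>

definition morphism ::
  "('p, 's) supermanifold \<Rightarrow> ('q, 't) supermanifold \<Rightarrow> ('p, 's, 'q, 't) super_map \<Rightarrow> bool" where
  "morphism M N \<phi> \<longleftrightarrow>
    (let F = str_sheaf M; G = str_sheaf N in
      under \<phi> \<in> extensional (topspace (body M)) \<and>
      continuous_map (body M) (body N) (under \<phi>) \<and>
      (\<forall>U. openin (body N) U \<longrightarrow>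
        pull \<phi> U \<in> graded_hom (sections G U) (part G U)
                     (sections F (preim M \<phi> U)) (part F (preim M \<phi> U)) \<and>
        pull \<phi> U \<in> extensional (sects G U)) \<and>
      (\<forall>U. \<not> openin (body N) U \<longrightarrow> pull \<phi> U = (\<lambda>_. undefined)) \<and>
      (\<forall>U V. openin (body N) U \<and> openin (body N) V \<and> V \<subseteq> U \<longrightarrow>
        (\<forall>f\<in>sects G U.
          pull \<phi> V (restr G U V f) = restr F (preim M \<phi> U) (preim M \<phi> V) (pull \<phi> U f))))"

definition id_morphism :: "('p, 's) supermanifold \<Rightarrow> ('p, 's, 'p, 's) super_map" where
  "id_morphism M = \<lparr>
     under = (\<lambda>x\<in>topspace (body M). x),
     pull = (\<lambda>U. if openin (body M) U then (\<lambda>f\<in>sects (str_sheaf M) U. f) else (\<lambda>_. undefined))\<rparr>"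

text \<open>\<open>comp_morphism L M N \<phi> \<psi>\<close> is the composite of \<open>\<psi>\<close> from \<open>L\<close> to \<open>M\<close> followed by \<open>\<phi>\<close> from \<open>M\<close>
  to \<open>N\<close>.\<close>

definition comp_morphism ::
  "('o, 'r) supermanifold \<Rightarrow> ('p, 's) supermanifold \<Rightarrow> ('q, 't) supermanifold
    \<Rightarrow> ('p, 's, 'q, 't) super_map \<Rightarrow> ('o, 'r, 'p, 's) super_map \<Rightarrow> ('o, 'r, 'q, 't) super_map" where
  "comp_morphism L M N \<phi> \<psi> = \<lparr>
     under = (\<lambda>x\<in>topspace (body L). under \<phi> (under \<psi> x)),
     pull = (\<lambda>U. if openin (body N) U
               then (\<lambda>f\<in>sects (str_sheaf N) U. pull \<psi> (preim M \<phi> U) (pull \<phi> U f))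
               else (\<lambda>_. undefined))\<rparr>"

definition Aut :: "('p, 's) supermanifold \<Rightarrow> ('p, 's, 'p, 's) super_map set" where
  "Aut M = {\<phi>. morphism M M \<phi> \<and>
     (\<exists>\<psi>. morphism M M \<psi> \<and>
       comp_morphism M M M \<phi> \<psi> = id_morphism M \<and> comp_morphism M M M \<psi> \<phi> = id_morphism M)}"

definition Aut_group :: "('p, 's) supermanifold \<Rightarrow> ('p, 's, 'p, 's) super_map monoid" where
  "Aut_group M = \<lparr>carrier = Aut M, mult = comp_morphism M M M, one = id_morphism M\<rparr>"


section \<open>The topology on the automorphism group\<close>

text \<open>The coefficients \<open>\<phi>\<^sub>f\<^sub>,\<^sub>S\<close> of the pullback of \<open>f\<close>, a section over \<open>U\<close>, with respect to
  coordinates on \<open>V\<close>; they are functions on the largest open subset of \<open>V\<close> on which the pullback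
  is defined.\<close>

definition pull_coeff ::
  "('p, 's) supermanifold \<Rightarrow> 'p set \<Rightarrow> ('p set \<Rightarrow> 's \<Rightarrow> nat set \<Rightarrow> 'p \<Rightarrow> complex)
    \<Rightarrow> ('p, 's, 'p, 's) super_map \<Rightarrow> 'p set \<Rightarrow> 's \<Rightarrow> nat set \<Rightarrow> 'p \<Rightarrow> complex" where
  "pull_coeff M V \<tau> \<phi> U f S =
    \<tau> (V \<inter> preim M \<phi> U) (restr (str_sheaf M) (preim M \<phi> U) (V \<inter> preim M \<phi> U) (pull \<phi> U f)) S"

definition Aut_subbase ::
  "nat \<Rightarrow> nat \<Rightarrow> ('p, 's) supermanifold \<Rightarrow> ('p, 's, 'p, 's) super_map set set" where
  "Aut_subbase m n M =
    {{\<phi> \<in> Aut M. under \<phi> ` K \<subseteq> U \<and> (\<forall>S\<in>Pow {..<n}. pull_coeff M V \<tau> \<phi> U f S ` K \<subseteq> W S)}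
     | V c \<tau> K U f W.
       coordinate_system m n M V c \<tau> \<and> compactin (body M) K \<and> K \<subseteq> V \<and>
       openin (body M) U \<and> f \<in> sects (str_sheaf M) U \<and> (\<forall>S\<in>Pow {..<n}. open (W S))}"

text \<open>The whole space, being the empty intersection of subbasic sets, is added because
  \<^const>\<open>generate_topology_on\<close> does not include it.\<close>

definition Aut_topology ::
  "nat \<Rightarrow> nat \<Rightarrow> ('p, 's) supermanifold \<Rightarrow> ('p, 's, 'p, 's) super_map topology" where
  "Aut_topology m n M = topology_generated_by (insert (Aut M) (Aut_subbase m n M))"

locale topological_group = group G for G :: "'a monoid" (structure) and T :: "'a topology" +
  assumes topspace_eq: "topspace T = carrier G"
    and mult_continuous: "continuous_map (prod_topology T T) T (\<lambda>(x, y). x \<otimes> y)"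
    and inv_continuous: "continuous_map T T (\<lambda>x. inv x)"

end

theory Submission
  imports Defs "HOL-Complex_Analysis.Cauchy_Integral_Formula"
begin

text \<open>Composition and inversion of automorphisms act on sections by substitution, and the topology on
automorphisms is that of uniform convergence, on compact sets, of the coefficients of pulled-back
sections. Everything rests on one estimate: pulling back along \<open>\<psi>\<close> is bounded from the supremum norm on
a polydisc of radius \<open>r\<close> around \<open>\<psi>(p)\<close> to the coefficients at \<open>p\<close>, with a bound that depends on \<open>\<psi>\<close>
only through the sizes of the pulled-back coordinates (\<open>pull_coeff_bound\<close>).

The reason is nilpotency. Pulling back and reading off the coefficients at \<open>p\<close> is a homomorphism of
algebras from the superfunctions on the polydisc to the exterior algebra. It lies over the evaluation
at \<open>q = \<psi>(p)\<close>: an even coordinate minus a value other than \<open>q\<^sub>i\<close> is invertible near \<open>q\<close>, and odd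
coordinates have odd images. By Hadamard's lemma (\<open>hadamard_polydisc\<close>), a holomorphic \<open>g\<close> on the
polydisc is \<open>g(q) + (\<Sum>i. (z\<^sub>i - q\<^sub>i) h\<^sub>i)\<close> with \<open>\<bar>h\<^sub>i\<bar> \<le> (4/r) sup \<bar>g\<bar>\<close>. The images of the factors \<open>z\<^sub>i - q\<^sub>i\<close>
have no constant term, so the coefficients of degree \<open>k + 1\<close> of the image of \<open>g\<close> are controlled by
those of degree at most \<open>k\<close> of the images of the \<open>h\<^sub>i\<close>. Induction on the degree gives the estimate
(\<open>even_step\<close>, \<open>even_bound\<close>, and \<open>fam_bound\<close> for superfunctions that involve the odd coordinates).

Composition is continuous because, for \<open>(\<phi>, \<psi>)\<close> near \<open>(\<phi>\<^sub>0, \<psi>\<^sub>0)\<close>,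
\<open>\<psi>\<^sup>*\<phi>\<^sup>*f - \<psi>\<^sub>0\<^sup>*\<phi>\<^sub>0\<^sup>*f = \<psi>\<^sup>*(\<phi>\<^sup>*f - \<phi>\<^sub>0\<^sup>*f) + (\<psi>\<^sup>* - \<psi>\<^sub>0\<^sup>*)(\<phi>\<^sub>0\<^sup>*f)\<close>:
the estimate makes the first summand small, and the topology makes the second one small
(\<open>comp_local\<close>).

For inversion it suffices, by translation, to work at the identity (\<open>topological_groupI\<close>). If \<open>\<psi>\<close> is
the inverse of \<open>\<phi>\<close>, then \<open>s - \<psi>\<^sup>*s = \<psi>\<^sup>*(\<phi>\<^sup>*s - s)\<close>, and \<open>\<phi>\<^sup>*s - s\<close> is small; so \<open>\<psi>\<^sup>*s\<close> is near \<open>s\<close> once the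
pulled-back coordinates under \<open>\<psi>\<close> are known to be bounded. The same identity for the coordinates
themselves yields this bound by induction on the degree, because the coefficients of the highest
degree enter the estimate only to first order and are multiplied by the small size of \<open>\<phi>\<^sup>*s - s\<close>
(\<open>inverse_local\<close>). The underlying map of \<open>\<psi>\<close> is near the identity by compactness of the body: \<open>\<phi>\<close> maps
the compact complement of a neighbourhood of \<open>p\<close> into the complement of a smaller one.

All these arguments are local on the body; finitely many of the neighbourhoods of \<open>\<phi>\<close> that they
produce suffice for a compact set (\<open>compact_uniform\<close>).\<close>

section \<open>Holomorphic functions of several variables\<close>

text \<open>Caratheodory's form of differentiability: the increment of \<open>f\<close> is a combination of the increments of
the coordinates whose coefficients, the slopes \<open>h i\<close>, are continuous at \<open>z\<close>. In this form the rules
of differentiation are algebraic identities between slopes.\<close>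

lemma holoI_eventually:
  assumes ex: "\<And>z. z \<in> D \<Longrightarrow> \<exists>h. (\<forall>i<m. continuous (at z within D) (h i)) \<and>
      (\<forall>\<^sub>F w in at z within D. f w = f z + (\<Sum>i<m. (w i - z i) * h i w))"
  shows "holo m D f"
  unfolding holo_def
proof
  fix z assume z: "z \<in> D"
  then obtain h where c: "\<And>i. i < m \<Longrightarrow> continuous (at z within D) (h i)"
    and e: "\<forall>\<^sub>F w in at z within D. f w = f z + (\<Sum>i<m. (w i - z i) * h i w)"
    using ex[OF z] by blast
  let ?L = "\<lambda>w. L2_set (\<lambda>i. cmod (w i - z i)) {..<m}"
  have "((\<lambda>w. \<Sum>i<m. cmod (h i w - h i z)) \<longlongrightarrow> 0) (at z within D)"
    using c by (intro tendsto_null_sum tendsto_norm_zero)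
      (auto simp: continuous_within intro: LIM_zero)
  moreover
  have "norm (cmod (f w - f z - (\<Sum>i<m. h i z * (w i - z i))) / ?L w)
      \<le> (\<Sum>i<m. cmod (h i w - h i z))" if "f w = f z + (\<Sum>i<m. (w i - z i) * h i w)" for w
  proof -
    have "f w - f z - (\<Sum>i<m. h i z * (w i - z i)) = (\<Sum>i<m. (w i - z i) * (h i w - h i z))"
      unfolding that by (simp add: right_diff_distrib sum_subtractf mult.commute)
    also have "cmod \<dots> \<le> (\<Sum>i<m. cmod ((w i - z i) * (h i w - h i z)))"
      by (rule norm_sum)
    also have "\<dots> \<le> (\<Sum>i<m. ?L w * cmod (h i w - h i z))"
      by (intro sum_mono) (auto simp: norm_mult intro!: mult_right_mono member_le_L2_set)
    finally show ?thesis
      by (cases "?L w = 0") (auto simp: sum_nonneg L2_set_nonneg divide_le_eq sum_distrib_left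
          mult.commute zero_less_iff_neq_zero order_less_le)
  qed
  then have "\<forall>\<^sub>F w in at z within D. norm (cmod (f w - f z - (\<Sum>i<m. h i z * (w i - z i))) / ?L w)
      \<le> (\<Sum>i<m. cmod (h i w - h i z))"
    using e by (rule eventually_mono[rotated])
  ultimately have "((\<lambda>w. cmod (f w - f z - (\<Sum>i<m. h i z * (w i - z i))) / ?L w) \<longlongrightarrow> 0) (at z within D)"
    by (rule Lim_null_comparison[rotated])
  then show "\<exists>a. ((\<lambda>w. cmod (f w - f z - (\<Sum>i<m. a i * (w i - z i))) / ?L w) \<longlongrightarrow> 0) (at z within D)"
    by (rule exI[where x = "\<lambda>i. h i z"])
qed

lemma holoI:
  assumes ex: "\<And>z. z \<in> D \<Longrightarrow> \<exists>h. (\<forall>i<m. continuous (at z within D) (h i)) \<and>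
      (\<forall>w\<in>D. f w = f z + (\<Sum>i<m. (w i - z i) * h i w))"
  shows "holo m D f"
proof (rule holoI_eventually)
  fix z assume "z \<in> D"
  then obtain h where "\<forall>i<m. continuous (at z within D) (h i)"
    and e: "\<forall>w\<in>D. f w = f z + (\<Sum>i<m. (w i - z i) * h i w)"
    using ex by blast
  moreover have "\<forall>\<^sub>F w in at z within D. f w = f z + (\<Sum>i<m. (w i - z i) * h i w)"
    unfolding eventually_at_filter using e by (intro always_eventually allI impI) blast
  ultimately show "\<exists>h. (\<forall>i<m. continuous (at z within D) (h i)) \<and>
      (\<forall>\<^sub>F w in at z within D. f w = f z + (\<Sum>i<m. (w i - z i) * h i w))" by blast
qed

text \<open>The remainder \<open>R w\<close> of the linear approximation at \<open>z\<close> is distributed over the coordinates by means of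
\<open>\<bar>w - z\<bar>\<^sup>2 = (\<Sum>i. (w\<^sub>i - z\<^sub>i) cnj (w\<^sub>i - z\<^sub>i))\<close>.\<close>

lemma holoE:
  assumes D: "D \<subseteq> cspace m" and f: "holo m D f" and z: "z \<in> D"
  obtains h where "\<And>i. i < m \<Longrightarrow> continuous (at z within D) (h i)"
    and "\<And>w. w \<in> D \<Longrightarrow> f w = f z + (\<Sum>i<m. (w i - z i) * h i w)"
proof -
  let ?L = "\<lambda>w. L2_set (\<lambda>i. cmod (w i - z i)) {..<m}"
  obtain a where
    a: "((\<lambda>w. cmod (f w - f z - (\<Sum>i<m. a i * (w i - z i))) / ?L w) \<longlongrightarrow> 0) (at z within D)"
    using f z unfolding holo_def by blast
  define R where "R = (\<lambda>w. f w - f z - (\<Sum>i<m. a i * (w i - z i)))"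
  define h where "h = (\<lambda>i w. a i + R w * cnj (w i - z i) / of_real ((?L w)^2))"
  have "continuous (at z within D) (h i)" if i: "i < m" for i
  proof -
    have "((\<lambda>w. R w * cnj (w i - z i) / of_real ((?L w)^2)) \<longlongrightarrow> 0) (at z within D)"
    proof (rule Lim_null_comparison[OF _ a])
      have "cmod (R w * cnj (w i - z i) / of_real ((?L w)^2)) \<le> cmod (R w) / ?L w" for w
      proof (cases "?L w = 0")
        case False
        then have "?L w > 0" by (simp add: order_less_le L2_set_nonneg)
        moreover have "cmod (w i - z i) \<le> ?L w"
          using i by (intro member_le_L2_set) auto
        ultimately show ?thesis
          by (simp add: norm_divide norm_mult divide_simps power2_eq_square mult_left_mono
              norm_power del: complex_cnj_diff)
      qed auto
      then show "\<forall>\<^sub>F w in at z within D. cmod (R w * cnj (w i - z i) / of_real ((?L w)^2))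
          \<le> cmod (f w - f z - (\<Sum>i<m. a i * (w i - z i))) / ?L w"
        by (auto simp: R_def)
    qed
    then have "(h i \<longlongrightarrow> a i + 0) (at z within D)"
      unfolding h_def by (intro tendsto_intros)
    then show ?thesis
      by (simp add: continuous_within h_def)
  qed
  moreover have "f w = f z + (\<Sum>i<m. (w i - z i) * h i w)" if w: "w \<in> D" for w
  proof (cases "?L w = 0")
    case True
    then have "w i = z i" if "i < m" for i
      using that by (simp add: L2_set_eq_0_iff)
    moreover have "w i = z i" if "i \<ge> m" for i
      using that subsetD[OF D w] subsetD[OF D z] by (simp add: cspace_def)
    ultimately have "w = z" by (metis ext linorder_not_le)
    then show ?thesis by simp
  next
    case False
    have "(\<Sum>i<m. (w i - z i) * cnj (w i - z i)) = of_real ((?L w)^2)"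
      by (simp add: complex_norm_square [symmetric] L2_set_def sum_nonneg del: complex_cnj_diff)
    then have "(\<Sum>i<m. (w i - z i) * (R w * cnj (w i - z i) / of_real ((?L w)^2))) = R w"
      using False
      by (simp add: sum_distrib_left [symmetric] sum_divide_distrib [symmetric] mult.left_commute
          del: complex_cnj_diff)
    then have "(\<Sum>i<m. (w i - z i) * h i w) = (\<Sum>i<m. (w i - z i) * a i) + R w"
      unfolding h_def by (simp add: distrib_left sum.distrib)
    then show ?thesis by (simp add: R_def algebra_simps)
  qed
  ultimately show ?thesis using that by blast
qed

lemma holo_cong:
  assumes "\<And>z. z \<in> D \<Longrightarrow> f z = g z"
  shows "holo m D f \<longleftrightarrow> holo m D g"
proof -
  have "holo m D g" if f: "holo m D f" and eq: "\<And>z. z \<in> D \<Longrightarrow> f z = g z" for f g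
    unfolding holo_def
  proof
    fix z assume z: "z \<in> D"
    then obtain a where a: "((\<lambda>w. cmod (f w - f z - (\<Sum>i<m. a i * (w i - z i))) /
        L2_set (\<lambda>i. cmod (w i - z i)) {..<m}) \<longlongrightarrow> 0) (at z within D)"
      using f unfolding holo_def by blast
    show "\<exists>a. ((\<lambda>w. cmod (g w - g z - (\<Sum>i<m. a i * (w i - z i))) /
        L2_set (\<lambda>i. cmod (w i - z i)) {..<m}) \<longlongrightarrow> 0) (at z within D)"
      by (rule exI[where x = a], rule Lim_transform_eventually[OF a])
        (use eq z in \<open>auto simp: eventually_at_filter\<close>)
  qed
  then show ?thesis using assms by metis
qed

lemma holo_subset:
  assumes "holo m D f" "E \<subseteq> D"
  shows "holo m E f"
  using assms unfolding holo_def by (meson subsetD tendsto_within_subset)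

lemma holo_local:
  assumes "\<And>z. z \<in> D \<Longrightarrow> \<exists>G. open G \<and> z \<in> G \<and> holo m (D \<inter> G) f"
  shows "holo m D f"
  unfolding holo_def
proof
  fix z assume z: "z \<in> D"
  obtain G where G: "open G" "z \<in> G" "holo m (D \<inter> G) f"
    using assms[OF z] by blast
  have "at z within D = at z within (D \<inter> G)"
    using G by (intro at_within_nhd[where S = G]) auto
  then show "\<exists>a. ((\<lambda>w. cmod (f w - f z - (\<Sum>i<m. a i * (w i - z i))) /
        L2_set (\<lambda>i. cmod (w i - z i)) {..<m}) \<longlongrightarrow> 0) (at z within D)"
    using G z unfolding holo_def by auto
qed

lemma tendsto_coordinate: "((\<lambda>w :: nat \<Rightarrow> complex. w i) \<longlongrightarrow> z i) (at z within D)"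
proof -
  have "isCont (\<lambda>w :: nat \<Rightarrow> complex. w i) z"
    using continuous_on_eq_continuous_at[OF open_UNIV, of "\<lambda>w :: nat \<Rightarrow> complex. w i"] by simp
  then show ?thesis
    unfolding isCont_def by (rule tendsto_within_subset) simp
qed

lemma holo_continuous_on:
  assumes D: "D \<subseteq> cspace m" and f: "holo m D f"
  shows "continuous_on D f"
  unfolding continuous_on_def
proof
  fix z assume z: "z \<in> D"
  obtain h where h: "\<And>i. i < m \<Longrightarrow> continuous (at z within D) (h i)"
    and e: "\<And>w. w \<in> D \<Longrightarrow> f w = f z + (\<Sum>i<m. (w i - z i) * h i w)"
    using holoE[OF D f z] by blast
  have "((\<lambda>w. f z + (\<Sum>i<m. (w i - z i) * h i w)) \<longlongrightarrow> f z + (\<Sum>i<m. (z i - z i) * h i z)) (at z within D)"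
    using h by (intro tendsto_intros) (auto simp: continuous_within intro: tendsto_coordinate)
  then show "(f \<longlongrightarrow> f z) (at z within D)"
    by (intro Lim_transform_eventually[where g = f]) (use e in \<open>auto simp: eventually_at_filter\<close>)
qed

lemma holo_const: "D \<subseteq> cspace m \<Longrightarrow> holo m D (\<lambda>z. a)"
  by (rule holoI) (auto intro!: exI[where x = "\<lambda>_ _. 0"])

lemma holo_coordinate: 
  assumes "D \<subseteq> cspace m" shows "holo m D (\<lambda>z. z i)"
proof (rule holoI)
  fix z assume "z \<in> D"
  have "\<forall>w\<in>D. w i = z i + (\<Sum>j<m. (w j - z j) * (if j = i then 1 else 0))"
  proof
    fix w assume "w \<in> D"
    then have "w i = z i" if "i \<ge> m"
      using that subsetD[OF assms \<open>w \<in> D\<close>] subsetD[OF assms \<open>z \<in> D\<close>] by (simp add: cspace_def)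
    then show "w i = z i + (\<Sum>j<m. (w j - z j) * (if j = i then 1 else 0))"
      by (cases "i < m") (auto simp: if_distrib cong: if_cong)
  qed
  then show "\<exists>h. (\<forall>j<m. continuous (at z within D) (h j)) \<and> 
      (\<forall>w\<in>D. w i = z i + (\<Sum>j<m. (w j - z j) * h j w))"
    by (intro exI[where x = "\<lambda>j _. if j = i then 1 else 0"]) auto
qed

lemma holo_add:
  assumes D: "D \<subseteq> cspace m" and f: "holo m D f" and g: "holo m D g"
  shows "holo m D (\<lambda>z. f z + g z)"
proof (rule holoI)
  fix z assume z: "z \<in> D"
  obtain h where "\<And>i. i < m \<Longrightarrow> continuous (at z within D) (h i)"
    "\<And>w. w \<in> D \<Longrightarrow> f w = f z + (\<Sum>i<m. (w i - z i) * h i w)"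
    using holoE[OF D f z] by blast
  moreover obtain k where "\<And>i. i < m \<Longrightarrow> continuous (at z within D) (k i)"
    "\<And>w. w \<in> D \<Longrightarrow> g w = g z + (\<Sum>i<m. (w i - z i) * k i w)"
    using holoE[OF D g z] by blast
  ultimately show "\<exists>h. (\<forall>i<m. continuous (at z within D) (h i)) \<and>
     (\<forall>w\<in>D. f w + g w = f z + g z + (\<Sum>i<m. (w i - z i) * h i w))"
    by (intro exI[where x = "\<lambda>i w. h i w + k i w"])
      (auto simp: distrib_left sum.distrib intro: continuous_intros)
qed

lemma holo_mult:
  assumes D: "D \<subseteq> cspace m" and f: "holo m D f" and g: "holo m D g"
  shows "holo m D (\<lambda>z. f z * g z)"
proof (rule holoI)
  fix z assume z: "z \<in> D"
  obtain h where h: "\<And>i. i < m \<Longrightarrow> continuous (at z within D) (h i)"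
    "\<And>w. w \<in> D \<Longrightarrow> f w = f z + (\<Sum>i<m. (w i - z i) * h i w)"
    using holoE[OF D f z] by blast
  obtain k where k: "\<And>i. i < m \<Longrightarrow> continuous (at z within D) (k i)"
    "\<And>w. w \<in> D \<Longrightarrow> g w = g z + (\<Sum>i<m. (w i - z i) * k i w)"
    using holoE[OF D g z] by blast
  have c: "continuous (at z within D) g"
    using holo_continuous_on[OF D g] z by (simp add: continuous_on_eq_continuous_within)
  have "f w * g w = f z * g z + (\<Sum>i<m. (w i - z i) * (h i w * g w + f z * k i w))" if "w \<in> D" for w
  proof -
    have "f w * g w = f z * g z + (f w - f z) * g w + f z * (g w - g z)"
      by (simp add: algebra_simps)
    also have "f w - f z = (\<Sum>i<m. (w i - z i) * h i w)" using h(2)[OF that] by simp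
    also have "g w - g z = (\<Sum>i<m. (w i - z i) * k i w)" using k(2)[OF that] by simp
    finally show ?thesis
      by (simp add: distrib_left sum.distrib sum_distrib_left sum_distrib_right mult_ac)
  qed
  then show "\<exists>h. (\<forall>i<m. continuous (at z within D) (h i)) \<and>
     (\<forall>w\<in>D. f w * g w = f z * g z + (\<Sum>i<m. (w i - z i) * h i w))"
    using h k c by (intro exI[where x = "\<lambda>i w. h i w * g w + f z * k i w"])
      (auto intro!: continuous_intros)
qed

lemma holo_inverse:
  assumes D: "D \<subseteq> cspace m" and f: "holo m D f" and nz: "\<And>z. z \<in> D \<Longrightarrow> f z \<noteq> 0"
  shows "holo m D (\<lambda>z. inverse (f z))"
proof (rule holoI)
  fix z assume z: "z \<in> D"
  obtain h where h: "\<And>i. i < m \<Longrightarrow> continuous (at z within D) (h i)"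
    "\<And>w. w \<in> D \<Longrightarrow> f w = f z + (\<Sum>i<m. (w i - z i) * h i w)"
    using holoE[OF D f z] by blast
  have c: "continuous (at z within D) f"
    using holo_continuous_on[OF D f] z by (simp add: continuous_on_eq_continuous_within)
  have "inverse (f w) = inverse (f z) + (\<Sum>i<m. (w i - z i) * (- h i w * inverse (f w) * inverse (f z)))"
    if "w \<in> D" for w
  proof -
    have "inverse (f w) - inverse (f z) = - (f w - f z) * inverse (f w) * inverse (f z)"
      using nz that z by (simp add: divide_simps)
    also have "f w - f z = (\<Sum>i<m. (w i - z i) * h i w)" using h(2)[OF that] by simp
    finally have "inverse (f w) = inverse (f z) + - (\<Sum>i<m. (w i - z i) * h i w) * inverse (f w) * inverse (f z)"
      by (metis add.commute diff_add_cancel)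
    then show ?thesis
      by (simp add: sum_distrib_right sum_negf mult.assoc)
  qed
  moreover have "continuous (at z within D) (\<lambda>w. inverse (f w))"
    using c nz z by (intro continuous_at_within_inverse) auto
  ultimately show "\<exists>h. (\<forall>i<m. continuous (at z within D) (h i)) \<and>
     (\<forall>w\<in>D. inverse (f w) = inverse (f z) + (\<Sum>i<m. (w i - z i) * h i w))"
    using h c by (intro exI[where x = "\<lambda>i w. - h i w * inverse (f w) * inverse (f z)"])
      (auto intro!: continuous_intros)
qed

lemma holo_map_continuous_on:
  assumes D: "D \<subseteq> cspace m" and g: "holo_map m D g" "g ` D \<subseteq> cspace m"
  shows "continuous_on D g"
proof (rule continuous_on_coordinatewise_then_product)
  fix i
  show "continuous_on D (\<lambda>z. g z i)"
  proof (cases "i < m")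
    case True
    then show ?thesis using g holo_continuous_on[OF D] by (auto simp: holo_map_def)
  next
    case False
    then have "g z i = 0" if "z \<in> D" for z using g(2) that by (auto simp: cspace_def)
    then show ?thesis by (simp cong: continuous_on_cong_simp)
  qed
qed

lemma holo_compose:
  assumes D: "D \<subseteq> cspace m" and E: "E \<subseteq> cspace m" and f: "holo m E f"
    and g: "holo_map m D g" and gD: "g ` D \<subseteq> E"
  shows "holo m D (\<lambda>z. f (g z))"
proof (rule holoI)
  fix z assume z: "z \<in> D"
  have cg: "continuous (at z within D) g"
    using holo_map_continuous_on[OF D g] gD E z by (auto simp: continuous_on_eq_continuous_within)
  obtain h where h: "\<And>i. i < m \<Longrightarrow> continuous (at (g z) within E) (h i)"
    "\<And>w. w \<in> E \<Longrightarrow> f w = f (g z) + (\<Sum>i<m. (w i - g z i) * h i w)"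
    using holoE[OF E f] gD z by blast
  have "\<exists>k. (\<forall>j<m. continuous (at z within D) (k j)) \<and>
      (\<forall>w\<in>D. g w i = g z i + (\<Sum>j<m. (w j - z j) * k j w))" if "i < m" for i
  proof -
    have "holo m D (\<lambda>z. g z i)" using g that by (simp add: holo_map_def)
    from holoE[OF D this z] obtain h where "\<And>j. j < m \<Longrightarrow> continuous (at z within D) (h j)"
      "\<And>w. w \<in> D \<Longrightarrow> g w i = g z i + (\<Sum>j<m. (w j - z j) * h j w)" by blast
    then show ?thesis by blast
  qed
  then have "\<forall>i\<in>{..<m}. \<exists>k. (\<forall>j<m. continuous (at z within D) (k j)) \<and>
      (\<forall>w\<in>D. g w i = g z i + (\<Sum>j<m. (w j - z j) * k j w))" by blast
  from bchoice[OF this] obtain k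
    where "\<forall>i\<in>{..<m}. (\<forall>j<m. continuous (at z within D) (k i j)) \<and>
      (\<forall>w\<in>D. g w i = g z i + (\<Sum>j<m. (w j - z j) * k i j w))" by blast
  then have k: "\<And>i j. \<lbrakk>i < m; j < m\<rbrakk> \<Longrightarrow> continuous (at z within D) (k i j)"
      "\<And>i w. \<lbrakk>i < m; w \<in> D\<rbrakk> \<Longrightarrow> g w i = g z i + (\<Sum>j<m. (w j - z j) * k i j w)"
    by blast+
  have ch: "continuous (at z within D) (\<lambda>w. h i (g w))" if "i < m" for i
    by (rule continuous_within_compose2[OF cg continuous_within_subset[OF h(1)[OF that] gD]])
  have "f (g w) = f (g z) + (\<Sum>j<m. (w j - z j) * (\<Sum>i<m. k i j w * h i (g w)))" if w: "w \<in> D" for w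
  proof -
    have "f (g w) = f (g z) + (\<Sum>i<m. (g w i - g z i) * h i (g w))"
      using h(2) gD w by blast
    also have "(\<Sum>i<m. (g w i - g z i) * h i (g w)) = (\<Sum>i<m. (\<Sum>j<m. (w j - z j) * k i j w) * h i (g w))"
      using k(2)[OF _ w] by (intro sum.cong) auto
    also have "\<dots> = (\<Sum>i<m. \<Sum>j<m. (w j - z j) * (k i j w * h i (g w)))"
      by (simp add: sum_distrib_right mult.assoc)
    also have "\<dots> = (\<Sum>j<m. (w j - z j) * (\<Sum>i<m. k i j w * h i (g w)))"
      by (subst sum.swap) (simp add: sum_distrib_left)
    finally show ?thesis .
  qed
  then show "\<exists>h. (\<forall>i<m. continuous (at z within D) (h i)) \<and>
     (\<forall>w\<in>D. f (g w) = f (g z) + (\<Sum>i<m. (w i - z i) * h i w))"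
    using k ch by (intro exI[where x = "\<lambda>j w. \<Sum>i<m. k i j w * h i (g w)"])
      (auto intro!: continuous_intros)
qed

lemma holo_line:
  assumes D: "D \<subseteq> cspace m" and f: "holo m D f" and S: "open S"
    and line: "\<And>s. s \<in> S \<Longrightarrow> z(j := s) \<in> D" and j: "j < m"
  shows "(\<lambda>s. f (z(j := s))) holomorphic_on S"
  unfolding holomorphic_on_open[OF S]
proof
  fix s assume s: "s \<in> S"
  obtain h where h: "\<And>i. i < m \<Longrightarrow> continuous (at (z(j := s)) within D) (h i)"
    "\<And>w. w \<in> D \<Longrightarrow> f w = f (z(j := s)) + (\<Sum>i<m. (w i - (z(j := s)) i) * h i w)"
    using holoE[OF D f line[OF s]] by blast
  have "continuous_on S (\<lambda>u. z(j := u))"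
  proof (rule continuous_on_coordinatewise_then_product)
    show "continuous_on S (\<lambda>u. (z(j := u)) i)" for i by (cases "i = j") auto
  qed
  then have cl: "continuous (at s within S) (\<lambda>u. z(j := u))" 
    using s by (simp add: continuous_on_eq_continuous_within)
  have "continuous (at (z(j := s)) within (\<lambda>u. z(j := u)) ` S) (h j)"
    by (rule continuous_within_subset[OF h(1)[OF j]]) (use line in blast)
  then have "continuous (at s within S) (\<lambda>u. h j (z(j := u)))"
    by (rule continuous_within_compose2[OF cl])
  then have lim: "((\<lambda>u. h j (z(j := u))) \<longlongrightarrow> h j (z(j := s))) (at s)"
    unfolding continuous_within at_within_open[OF s S] .
  have eq: "h j (z(j := u)) = (f (z(j := u)) - f (z(j := s))) / (u - s)" if "u \<in> S" "u \<noteq> s" for u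
  proof -
    have "(\<Sum>i<m. ((z(j := u)) i - (z(j := s)) i) * h i (z(j := u))) =
        (\<Sum>i<m. if i = j then (u - s) * h j (z(j := u)) else 0)"
      by (intro sum.cong) auto
    then show ?thesis using h(2)[OF line[OF that(1)]] j that by simp
  qed
  have "((\<lambda>u. (f (z(j := u)) - f (z(j := s))) / (u - s)) \<longlongrightarrow> h j (z(j := s))) (at s)"
    by (rule Lim_transform_within_open[OF lim S s]) (rule eq)
  then show "\<exists>f'. ((\<lambda>u. f (z(j := u))) has_field_derivative f') (at s)"
    by (auto simp: has_field_derivative_iff)
qed


section \<open>Integrals of holomorphic functions and Hadamard's lemma\<close>

text \<open>The difference of Cauchy's formulas at \<open>s\<close> and at \<open>q\<close>. Parametrising the circle turns the formula into
an ordinary integral whose integrand is continuous in \<open>s\<close> as well; the derivative \<open>C (?c t - q)\<close> of the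
circle, where \<open>C = 2\<pi>\<i>\<close>, cancels the constant of the formula.\<close>

lemma circlepath_difference_quotient:
  assumes f: "f holomorphic_on ball q r" and r: "0 < \<rho>" "\<rho> < r" and s: "cmod (s - q) < \<rho>"
  shows "f s - f q = (s - q) * integral {0..1} (\<lambda>t. f (circlepath q \<rho> t) / (circlepath q \<rho> t - s))"
proof -
  let ?c = "circlepath q \<rho>"
  have hol: "f holomorphic_on cball q \<rho>"
    by (rule holomorphic_on_subset[OF f]) (use r in auto)
  have I: "((\<lambda>t. f (?c t) / (?c t - w) * (?c t - q)) has_integral f w) {0..1}" if "cmod (w - q) < \<rho>" for w
  proof -
    have "((\<lambda>u. f u / (u - w)) has_contour_integral (2 * of_real pi * \<i> * f w)) ?c"
      using Cauchy_integral_circlepath_simple[OF hol that] .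
    then have J: "((\<lambda>t. f (?c t) / (?c t - w) * vector_derivative ?c (at t within {0..1}))
        has_integral (2 * of_real pi * \<i> * f w)) {0..1}"
      by (simp add: has_contour_integral_def)
    obtain C where C: "C = 2 * of_real pi * \<i>" "C \<noteq> 0" by simp
    have "vector_derivative ?c (at t within {0..1}) = C * (?c t - q)" if "t \<in> {0..1}" for t
      unfolding vector_derivative_circlepath01[OF that[simplified, THEN conjunct1] that[simplified, THEN conjunct2]] C(1)
      by (simp add: circlepath)
    then have "((\<lambda>t. f (?c t) / (?c t - w) * (C * (?c t - q))) has_integral (C * f w)) {0..1}"
      using has_integral_eq[OF _ J] unfolding C(1)[symmetric] by simp
    note H = has_integral_mult_right[OF this, of "inverse C"]
    have e: "inverse C * (x * (C * y)) = x * y" "inverse C * (C * x) = x" for x y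
      using C(2) by simp_all
    show ?thesis using H unfolding e .
  qed
  have nz: "?c t \<noteq> s" "?c t \<noteq> q" for t
    using s r by (auto simp: circlepath norm_mult)
  have "((\<lambda>t. f (?c t) / (?c t - s) * (?c t - q) - f (?c t) / (?c t - q) * (?c t - q))
      has_integral f s - f q) {0..1}"
    using I[OF s] I[of q] r by (intro has_integral_diff) auto
  then have "((\<lambda>t. (s - q) * (f (?c t) / (?c t - s))) has_integral f s - f q) {0..1}"
    by (rule has_integral_eq[rotated]) (use nz in \<open>simp add: divide_simps; simp add: algebra_simps\<close>)
  then have "integral {0..1} (\<lambda>t. (s - q) * (f (?c t) / (?c t - s))) = f s - f q"
    by (rule integral_unique)
  then show ?thesis by (simp only: integral_mult_right)
qed

definition polydisc :: "nat \<Rightarrow> (nat \<Rightarrow> complex) \<Rightarrow> real \<Rightarrow> (nat \<Rightarrow> complex) set" where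
  "polydisc m q r = {z \<in> cspace m. \<forall>i<m. cmod (z i - q i) < r}"

lemma open_coordinate_ball: "open {w :: nat \<Rightarrow> complex. cmod (w i - c) < r}"
  by (intro open_Collect_less continuous_intros) auto

lemma polydisc_openin: "openin (top_of_set (cspace m)) (polydisc m q r)"
proof -
  have "polydisc m q r = cspace m \<inter> (\<Inter>i\<in>{..<m}. {w. cmod (w i - q i) < r})"
    by (auto simp: polydisc_def)
  moreover have "open (\<Inter>i\<in>{..<m}. {w :: nat \<Rightarrow> complex. cmod (w i - q i) < r})"
    by (intro open_INT ballI open_coordinate_ball) auto
  ultimately show ?thesis by (auto simp: openin_open)
qed

lemma polydisc_subset_cspace: "polydisc m q r \<subseteq> cspace m"
  by (auto simp: polydisc_def)

lemma openin_contains_polydisc: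
  assumes D: "openin (top_of_set (cspace m)) D" and z: "z \<in> D"
  obtains r where "r > 0" "polydisc m z r \<subseteq> D"
proof -
  obtain U where U: "open U" "D = cspace m \<inter> U" using D by (auto simp: openin_open)
  then have "openin (product_topology (\<lambda>i. euclidean) UNIV) U"
    by (simp add: euclidean_product_topology)
  from product_topology_open_contains_basis[OF this, of z] z U
  obtain X where X: "z \<in> (\<Pi>\<^sub>E i\<in>UNIV. X i)" "\<And>i. open (X i)" "(\<Pi>\<^sub>E i\<in>UNIV. X i) \<subseteq> U"
    "finite {i. X i \<noteq> UNIV}"
    by auto
  define N where "N = {..<m} \<union> {i. X i \<noteq> UNIV}"
  have "\<forall>i. \<exists>e>0. ball (z i) e \<subseteq> X i"
    using X(1,2) by (metis PiE_mem UNIV_I open_contains_ball)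
  then obtain e where e: "\<And>i. e i > 0" "\<And>i. ball (z i) (e i) \<subseteq> X i" by metis
  define r where "r = Min (insert 1 (e ` N))"
  have fin: "finite N" using X by (simp add: N_def)
  have "r > 0" unfolding r_def using e fin by (subst Min_gr_iff) auto
  moreover have "polydisc m z r \<subseteq> D"
  proof
    fix w assume w: "w \<in> polydisc m z r"
    have zc: "z \<in> cspace m" using z U by auto
    have "w i \<in> X i" for i
    proof (cases "i \<in> N")
      case True
      then have "r \<le> e i" unfolding r_def using fin by (intro Min_le) auto
      moreover have "cmod (w i - z i) < r"
        using w zc \<open>r > 0\<close> by (cases "i < m") (auto simp: polydisc_def cspace_def)
      ultimately show ?thesis using e(2)[of i] by (auto simp: dist_norm norm_minus_commute)
    qed (auto simp: N_def)
    then have "w \<in> U" using X(3) by auto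
    then show "w \<in> D" using w U by (auto simp: polydisc_def)
  qed
  ultimately show ?thesis using that by blast
qed

text \<open>The broken line from \<open>z\<close> to \<open>q\<close> replaces the coordinates of \<open>z\<close> by those of \<open>q\<close> one after the other.
Its \<open>i\<close>-th segment consists of the points \<open>slide q i s z\<close>, with \<open>s\<close> running from \<open>z i\<close> to \<open>q i\<close>.\<close>

definition slide :: "(nat \<Rightarrow> complex) \<Rightarrow> nat \<Rightarrow> complex \<Rightarrow> (nat \<Rightarrow> complex) \<Rightarrow> nat \<Rightarrow> complex" where
  "slide q i s z = (\<lambda>l. if l < i then q l else if l = i then s else z l)"

lemma slide_telescope:
  fixes \<Phi> :: "(nat \<Rightarrow> complex) \<Rightarrow> complex"
  assumes "z \<in> cspace m" "q \<in> cspace m"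
  shows "\<Phi> z = \<Phi> q + (\<Sum>i<m. \<Phi> (slide q i (z i) z) - \<Phi> (slide q i (q i) z))"
proof -
  define F where "F = (\<lambda>i. \<Phi> (\<lambda>l. if l < i then q l else z l))"
  have "slide q i (z i) z = (\<lambda>l. if l < i then q l else z l)" for i
    by (auto simp: slide_def)
  moreover have "slide q i (q i) z = (\<lambda>l. if l < Suc i then q l else z l)" for i
    by (auto simp: slide_def less_Suc_eq)
  ultimately have "(\<Sum>i<m. \<Phi> (slide q i (z i) z) - \<Phi> (slide q i (q i) z)) = (\<Sum>i<m. F i - F (Suc i))"
    by (simp add: F_def)
  also have "\<dots> = F 0 - F m" by (rule sum_lessThan_telescope')
  also have "F 0 = \<Phi> z" by (simp add: F_def)
  also have "F m = \<Phi> q"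
  proof -
    have "(\<lambda>l. if l < m then q l else z l) = q" using assms by (auto simp: cspace_def)
    then show ?thesis by (simp add: F_def)
  qed
  finally show ?thesis by simp
qed

lemma slide_in_polydisc:
  assumes "z \<in> polydisc m q r" "q \<in> cspace m" "cmod (s - q i) < r" "i < m"
  shows "slide q i s z \<in> polydisc m q r"
proof -
  have "r > 0" using assms(3) by (meson le_less_trans norm_ge_zero)
  then show ?thesis using assms by (auto simp: polydisc_def slide_def cspace_def)
qed

lemma holo_slide_line:
  assumes "holo m (polydisc m q r) f" "z \<in> polydisc m q r" "q \<in> cspace m" "i < m"
  shows "(\<lambda>s. f (slide q i s z)) holomorphic_on ball (q i) r"
proof -
  have upd: "(slide q i 0 z)(i := s) = slide q i s z" for s by (auto simp: slide_def)
  have "(\<lambda>s. f ((slide q i 0 z)(i := s))) holomorphic_on ball (q i) r"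
    by (rule holo_line[OF polydisc_subset_cspace assms(1) open_ball _ assms(4)])
      (use slide_in_polydisc[OF assms(2,3) _ assms(4)] in
        \<open>simp add: upd dist_norm norm_minus_commute\<close>)
  then show ?thesis by (simp add: upd)
qed

lemma slide_quotient:
  assumes "holo m (polydisc m q r) f" "z \<in> polydisc m q r" "q \<in> cspace m" "i < m"
    "0 < \<rho>" "\<rho> < r" "cmod (z i - q i) < \<rho>"
  shows "f (slide q i (z i) z) - f (slide q i (q i) z) =
     (z i - q i) * integral {0..1} (\<lambda>t. f (slide q i (circlepath (q i) \<rho> t) z) / (circlepath (q i) \<rho> t - z i))"
  using circlepath_difference_quotient[OF holo_slide_line[OF assms(1-4)] assms(5-7)] .

lemma continuous_on_circlepath [continuous_intros]:
  "continuous_on S f \<Longrightarrow> continuous_on S (\<lambda>x. circlepath q \<rho> (f x))"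
  unfolding circlepath by (intro continuous_intros)

lemma continuous_on_slide [continuous_intros]:
  assumes "continuous_on S s" "continuous_on S z"
  shows "continuous_on S (\<lambda>x. slide q i (s x) (z x))"
proof (rule continuous_on_coordinatewise_then_product)
  fix l
  have "continuous_on S (\<lambda>x. z x l)"
    using assms(2) by (rule continuous_on_product_then_coordinatewise)
  then show "continuous_on S (\<lambda>x. slide q i (s x) (z x) l)"
    using assms(1) by (cases "l < i"; cases "l = i") (simp_all add: slide_def)
qed

text \<open>On each segment of the broken line from \<open>u\<close> to \<open>z\<close>, the difference quotient of \<open>K\<close> is a Cauchy integral
over a circle of fixed radius, hence continuous jointly in \<open>u\<close> and \<open>t\<close>. The integrals of these
quotients over \<open>t\<close> are therefore continuous slopes of the integral of \<open>K\<close>.\<close>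

lemma holo_integral:
  fixes K :: "(nat \<Rightarrow> complex) \<Rightarrow> real \<Rightarrow> complex"
  assumes D: "openin (top_of_set (cspace m)) D"
    and cont: "continuous_on (D \<times> {0..1}) (\<lambda>(z, t). K z t)"
    and hol: "\<And>t. t \<in> {0..1} \<Longrightarrow> holo m D (\<lambda>z. K z t)"
  shows "holo m D (\<lambda>z. integral {0..1} (K z))"
proof (rule holoI_eventually)
  fix z assume z: "z \<in> D"
  have Dc: "D \<subseteq> cspace m" using D by (auto simp: openin_open)
  obtain r where r: "r > 0" "polydisc m z r \<subseteq> D"
    using openin_contains_polydisc[OF D z] by blast
  define \<rho> where "\<rho> = r / 2"
  have \<rho>: "0 < \<rho>" "\<rho> < r" using r by (auto simp: \<rho>_def)
  let ?P = "polydisc m z \<rho>"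
  have PP: "?P \<subseteq> polydisc m z r" using \<rho> by (force simp: polydisc_def)
  have zc: "z \<in> cspace m" using z Dc by auto
  have zP: "z \<in> ?P" using zc \<rho> by (auto simp: polydisc_def)
  define k where "k = (\<lambda>i u t. integral {0..1}
     (\<lambda>\<tau>. K (slide z i (circlepath (z i) \<rho> \<tau>) u) t / (circlepath (z i) \<rho> \<tau> - u i)))"
  have ck: "continuous_on (?P \<times> {0..1}) (\<lambda>(u, t). k i u t)" if i: "i < m" for i
  proof -
    have "continuous_on ((?P \<times> {0..1}) \<times> cbox 0 1) (\<lambda>x. K (slide z i (circlepath (z i) \<rho> (snd x)) (fst (fst x))) (snd (fst x)))"
    proof -
      have "continuous_on ((?P \<times> {0..1}) \<times> {0..1}) (\<lambda>x. (slide z i (circlepath (z i) \<rho> (snd x)) (fst (fst x)), snd (fst x)))"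
        by (intro continuous_intros)
      moreover have "(\<lambda>x. (slide z i (circlepath (z i) \<rho> (snd x)) (fst (fst x)), snd (fst x))) ` ((?P \<times> {0..1}) \<times> {0..1}) \<subseteq> D \<times> {0..1}"
        using PP \<rho> i by (auto simp: circlepath norm_mult intro!: subsetD[OF r(2)] slide_in_polydisc[OF _ zc])
      ultimately show ?thesis
        using continuous_on_compose2[OF cont] by fastforce
    qed
    moreover have "circlepath (z i) \<rho> t \<noteq> u i" if "u \<in> ?P" for t u
    proof
      assume "circlepath (z i) \<rho> t = u i"
      moreover have "cmod (circlepath (z i) \<rho> t - z i) = \<rho>"
        using \<rho> by (simp add: circlepath norm_mult)
      ultimately show False using that i by (auto simp: polydisc_def)
    qed
    moreover have "continuous_on ((?P \<times> {0..1::real}) \<times> cbox 0 (1::real)) (\<lambda>x. fst (fst x) i)"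
      by (rule continuous_on_product_then_coordinatewise) (intro continuous_on_fst continuous_on_id)
    moreover have "continuous_on ((?P \<times> {0..1::real}) \<times> cbox 0 (1::real)) (\<lambda>x. circlepath (z i) \<rho> (snd x))"
      by (intro continuous_on_circlepath continuous_on_snd continuous_on_id)
    ultimately have "continuous_on ((?P \<times> {0..1}) \<times> cbox 0 1)
       (\<lambda>(x, \<tau>). K (slide z i (circlepath (z i) \<rho> \<tau>) (fst x)) (snd x) / (circlepath (z i) \<rho> \<tau> - fst x i))"
      unfolding case_prod_unfold
      by (intro continuous_on_divide continuous_on_diff) auto
    from integral_continuous_on_param[OF this]
    show ?thesis unfolding k_def by (simp add: case_prod_unfold)
  qed
  have ck': "continuous_on ?P (\<lambda>u. integral {0..1} (k i u))" if "i < m" for i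
    using integral_continuous_on_param[of ?P 0 1 "k i"] ck[OF that] by simp
  have eq: "K u t = K z t + (\<Sum>i<m. (u i - z i) * k i u t)" if "u \<in> ?P" "t \<in> {0..1}" for u t
  proof -
    have uc: "u \<in> cspace m" using that by (auto simp: polydisc_def)
    have "K (slide z i (u i) u) t - K (slide z i (z i) u) t = (u i - z i) * k i u t" if "i < m" for i
      unfolding k_def
      by (rule slide_quotient[OF holo_subset[OF hol[OF \<open>t \<in> {0..1}\<close>] r(2)] _ zc that])
        (use \<rho> PP \<open>u \<in> ?P\<close> that in \<open>auto simp: polydisc_def\<close>)
    then show ?thesis
      by (subst slide_telescope[OF uc zc, of "\<lambda>u. K u t"]) simp
  qed
  have int: "K u integrable_on {0..1}" if "u \<in> ?P" for u
  proof (rule integrable_continuous_interval)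
    show "continuous_on {0..1} (K u)"
      by (rule continuous_on_compose2[OF cont, where f = "\<lambda>t. (u, t)", simplified])
        (use that PP r in \<open>auto intro!: continuous_intros\<close>)
  qed
  have intk: "k i u integrable_on {0..1}" if "u \<in> ?P" "i < m" for u i
  proof (rule integrable_continuous_interval)
    show "continuous_on {0..1} (k i u)"
      by (rule continuous_on_compose2[OF ck[OF that(2)], where f = "\<lambda>t. (u, t)", simplified])
        (use that in \<open>auto intro!: continuous_intros\<close>)
  qed
  have ieq: "integral {0..1} (K u) = integral {0..1} (K z) + (\<Sum>i<m. (u i - z i) * integral {0..1} (k i u))"
    if u: "u \<in> ?P" for u
  proof -
    have "integral {0..1} (K u) = integral {0..1} (\<lambda>t. K z t + (\<Sum>i<m. (u i - z i) * k i u t))"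
      by (rule integral_cong) (use eq[OF u] in auto)
    also have "\<dots> = integral {0..1} (K z) + integral {0..1} (\<lambda>t. \<Sum>i<m. (u i - z i) * k i u t)"
      using int[OF zP] intk[OF u] by (intro integral_add integrable_sum integrable_on_mult_right) auto
    also have "integral {0..1} (\<lambda>t. \<Sum>i<m. (u i - z i) * k i u t) = (\<Sum>i<m. integral {0..1} (\<lambda>t. (u i - z i) * k i u t))"
      using intk[OF u] by (intro integral_sum integrable_on_mult_right) auto
    finally show ?thesis by simp
  qed
  obtain G where G: "open G" "?P = cspace m \<inter> G"
    using polydisc_openin[of m z \<rho>] by (auto simp: openin_open)
  have DG: "D \<inter> G = ?P" using G Dc r PP by auto
  have zG: "z \<in> G" using zP G by auto
  have at: "at z within D = at z within ?P"
    using G zG DG by (intro at_within_nhd[where S = G]) auto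
  show "\<exists>h. (\<forall>i<m. continuous (at z within D) (h i)) \<and>
      (\<forall>\<^sub>F w in at z within D. integral {0..1} (K w) = integral {0..1} (K z) + (\<Sum>i<m. (w i - z i) * h i w))"
    unfolding at
  proof (rule exI[where x = "\<lambda>i u. integral {0..1} (k i u)"], intro conjI allI impI)
    show "continuous (at z within ?P) (\<lambda>u. integral {0..1} (k i u))" if "i < m" for i
      using ck'[OF that] zP by (simp add: continuous_on_eq_continuous_within)
    show "\<forall>\<^sub>F w in at z within ?P. integral {0..1} (K w) =
        integral {0..1} (K z) + (\<Sum>i<m. (w i - z i) * integral {0..1} (k i w))"
      unfolding eventually_at_filter by (intro always_eventually allI impI) (rule ieq)
  qed
qed

lemma holo_slide:
  assumes D: "D \<subseteq> cspace m" and f: "holo m E f" and E: "E \<subseteq> cspace m"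
    and sub: "\<And>z. z \<in> D \<Longrightarrow> slide q i (s z) z \<in> E" and s: "holo m D s"
  shows "holo m D (\<lambda>z. f (slide q i (s z) z))"
proof (rule holo_compose[OF D E f])
  show "holo_map m D (\<lambda>z. slide q i (s z) z)"
    unfolding holo_map_def slide_def
  proof (intro allI impI)
    fix l
    show "holo m D (\<lambda>z. if l < i then q l else if l = i then s z else z l)"
      using holo_const[OF D, of "q l"] s holo_coordinate[OF D, of l]
      by (cases "l < i"; cases "l = i") simp_all
  qed
qed (use sub in auto)

text \<open>Each \<open>h i\<close> is the difference quotient of \<open>f\<close> on the \<open>i\<close>-th segment of the broken line from \<open>z\<close> to \<open>q\<close>.
Near the hyperplane \<open>z i = q i\<close>, where the quotient is undefined, it is given by the Cauchy integral
over a circle of radius \<open>3 r / 4\<close>. The bound holds on the whole polydisc, so that the lemma can be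
iterated without shrinking the polydisc: for \<open>\<bar>z i - q i\<bar> \<ge> r / 2\<close> the quotient is at most \<open>2 B / (r / 2)\<close>,
and otherwise the denominator of the Cauchy integral is at least \<open>r / 4\<close>.\<close>

lemma hadamard_polydisc:
  assumes f: "holo m (polydisc m q r) f" and q: "q \<in> cspace m" and r: "r > 0"
    and B: "\<And>z. z \<in> polydisc m q r \<Longrightarrow> cmod (f z) \<le> B"
  obtains h where "\<And>i. i < m \<Longrightarrow> holo m (polydisc m q r) (h i)"
    and "\<And>i z. \<lbrakk>i < m; z \<in> polydisc m q r\<rbrakk> \<Longrightarrow> cmod (h i z) \<le> 4 / r * B"
    and "\<And>z. z \<in> polydisc m q r \<Longrightarrow> f z = f q + (\<Sum>i<m. (z i - q i) * h i z)"
proof -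
  let ?P = "polydisc m q r"
  have Pc: "?P \<subseteq> cspace m" by (rule polydisc_subset_cspace)
  define \<rho> where "\<rho> = 3 * r / 4"
  have \<rho>: "0 < \<rho>" "\<rho> < r" using r by (auto simp: \<rho>_def)
  define c where "c = (\<lambda>i. circlepath (q i) \<rho>)"
  define I where "I = (\<lambda>i z. integral {0..1} (\<lambda>t. f (slide q i (c i t) z) / (c i t - z i)))"
  define Q where "Q = (\<lambda>i z. (f (slide q i (z i) z) - f (slide q i (q i) z)) * inverse (z i - q i))"
  define h where "h = (\<lambda>i z. if cmod (z i - q i) < \<rho> then I i z else Q i z)"
  have cq: "cmod (c i t - q i) = \<rho>" for i t
    using \<rho> by (simp add: c_def circlepath norm_mult)
  have QI: "f (slide q i (z i) z) - f (slide q i (q i) z) = (z i - q i) * I i z"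
    if "i < m" "z \<in> ?P" "cmod (z i - q i) < \<rho>" for i z
    unfolding I_def c_def using slide_quotient[OF f that(2) q that(1) \<rho> that(3)] .
  have hQ: "h i z = Q i z" if "i < m" "z \<in> ?P" "z i \<noteq> q i" for i z
    using QI[OF that(1,2)] that by (auto simp: h_def Q_def)
  have slP: "slide q i (z i) z \<in> ?P" "slide q i (q i) z \<in> ?P" "slide q i (c i t) z \<in> ?P"
    if "i < m" "z \<in> ?P" for i z t
  proof -
    have "cmod (z i - q i) < r" using that by (simp add: polydisc_def)
    then show "slide q i (z i) z \<in> ?P" "slide q i (q i) z \<in> ?P" "slide q i (c i t) z \<in> ?P"
      using slide_in_polydisc[OF that(2) q _ that(1)] cq[of i t] \<rho> r by auto
  qed
  have "holo m ?P (h i)" if i: "i < m" for i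
  proof (rule holo_local)
    fix z assume z: "z \<in> ?P"
    show "\<exists>G. open G \<and> z \<in> G \<and> holo m (?P \<inter> G) (h i)"
    proof (cases "z i = q i")
      case True
      define G where "G = {w :: nat \<Rightarrow> complex. cmod (w i - q i) < \<rho>}"
      have G: "open G" "z \<in> G"
        using open_coordinate_ball True \<rho> by (auto simp: G_def)
      have PG: "?P \<inter> G \<subseteq> cspace m" using Pc by auto
      have opn: "openin (top_of_set (cspace m)) (?P \<inter> G)"
        using polydisc_openin G(1) by (rule openin_Int_open)
      have nz: "c i t - w i \<noteq> 0" if "w \<in> ?P \<inter> G" for t w
        using that cq[of i t] by (auto simp: G_def)
      have "holo m (?P \<inter> G) (I i)"
        unfolding I_def divide_inverse
      proof (rule holo_integral[OF opn])
        have "continuous_on ((?P \<inter> G) \<times> {0..1}) (\<lambda>x. f (slide q i (c i (snd x)) (fst x)))"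
          by (rule continuous_on_compose2[OF holo_continuous_on[OF Pc f]])
            (use slP i in \<open>auto simp: c_def intro!: continuous_on_slide continuous_on_circlepath continuous_on_fst continuous_on_snd continuous_on_id\<close>)
        moreover have "continuous_on ((?P \<inter> G) \<times> {0..1::real}) (\<lambda>x. fst x i)"
          by (rule continuous_on_product_then_coordinatewise) (intro continuous_on_fst continuous_on_id)
        moreover have "continuous_on ((?P \<inter> G) \<times> {0..1}) (\<lambda>x. c i (snd x))"
          unfolding c_def by (intro continuous_on_circlepath continuous_on_snd continuous_on_id)
        ultimately show "continuous_on ((?P \<inter> G) \<times> {0..1}) (\<lambda>(z, t). f (slide q i (c i t) z) * inverse (c i t - z i))"
          unfolding case_prod_unfold using nz
          by (intro continuous_on_mult continuous_on_inverse continuous_on_diff) auto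
      next
        fix t
        have "holo m (?P \<inter> G) (\<lambda>z. f (slide q i (c i t) z))"
          by (rule holo_slide[OF PG f Pc _ holo_const[OF PG]]) (use slP i in auto)
        moreover have "holo m (?P \<inter> G) (\<lambda>z. c i t + (-1) * z i)"
          by (intro holo_add holo_mult PG holo_const holo_coordinate)
        then have "holo m (?P \<inter> G) (\<lambda>z. inverse (c i t + (-1) * z i))"
          using nz by (intro holo_inverse PG) auto
        ultimately show "holo m (?P \<inter> G) (\<lambda>z. f (slide q i (c i t) z) * inverse (c i t - z i))"
          using holo_mult[OF PG] by fastforce
      qed
      then have "holo m (?P \<inter> G) (h i)"
        by (subst holo_cong[where g = "I i"]) (auto simp: h_def G_def)
      then show ?thesis using G by blast
    next
      case False
      define G where "G = {w :: nat \<Rightarrow> complex. w i \<noteq> q i}"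
      have G: "open G" "z \<in> G"
        using False by (auto simp: G_def intro!: open_Collect_neq continuous_intros)
      have PG: "?P \<inter> G \<subseteq> cspace m" using Pc by auto
      have "holo m (?P \<inter> G) (\<lambda>z. f (slide q i (z i) z) + (-1) * f (slide q i (q i) z))"
        using slP i
        by (intro holo_add holo_mult PG holo_slide[OF PG f Pc] holo_const holo_coordinate) auto
      moreover have "holo m (?P \<inter> G) (\<lambda>z. inverse (z i + (- q i)))"
        by (intro holo_inverse holo_add PG holo_const holo_coordinate) (auto simp: G_def)
      ultimately have "holo m (?P \<inter> G) (Q i)"
        unfolding Q_def using holo_mult[OF PG] by fastforce
      then have "holo m (?P \<inter> G) (h i)"
        by (subst holo_cong[where g = "Q i"]) (use hQ i in \<open>auto simp: G_def\<close>)
      then show ?thesis using G by blast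
    qed
  qed
  moreover have "cmod (h i z) \<le> 4 / r * B" if i: "i < m" and z: "z \<in> ?P" for i z
  proof -
    have B0: "B \<ge> 0" using B[OF z] norm_ge_zero order_trans by blast
    show ?thesis
    proof (cases "cmod (z i - q i) < r / 2")
      case True
      have "norm (integral {0..1} (\<lambda>t. f (slide q i (c i t) z) / (c i t - z i))) \<le> 4 / r * B * (1 - 0)"
      proof (rule integral_bound)
        show "continuous_on {0..1} (\<lambda>t. f (slide q i (c i t) z) / (c i t - z i))"
        proof (intro continuous_intros)
          show "continuous_on {0..1} (\<lambda>t. f (slide q i (c i t) z))"
            by (rule continuous_on_compose2[OF holo_continuous_on[OF Pc f]])
              (use slP i z in \<open>auto simp: c_def intro!: continuous_on_slide continuous_on_circlepath continuous_on_id continuous_on_const\<close>)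
          show "continuous_on {0..1} (c i)" by (auto simp: c_def intro!: continuous_intros)
          show "\<forall>t\<in>{0..1}. c i t - z i \<noteq> 0"
          proof
            fix t
            show "c i t - z i \<noteq> 0" using True cq[of i t] r by (auto simp: \<rho>_def)
          qed
        qed
        fix t
        have "cmod (c i t - q i) \<le> cmod (c i t - z i) + cmod (z i - q i)"
          using norm_triangle_ineq[of "c i t - z i" "z i - q i"] by simp
        then have "r / 4 \<le> cmod (c i t - z i)" using cq[of i t] True by (simp add: \<rho>_def)
        then have "cmod (f (slide q i (c i t) z)) / cmod (c i t - z i) \<le> B / (r / 4)"
          using B slP[OF i z] r B0 by (intro frac_le) auto
        then show "norm (f (slide q i (c i t) z) / (c i t - z i)) \<le> 4 / r * B"
          by (simp add: norm_divide mult.commute)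
      qed auto
      moreover have "h i z = I i z" using True r by (simp add: h_def \<rho>_def)
      ultimately show ?thesis by (simp add: I_def)
    next
      case False
      then have "z i \<noteq> q i" using r by auto
      then have "cmod (h i z) = cmod (f (slide q i (z i) z) - f (slide q i (q i) z)) / cmod (z i - q i)"
        using hQ[OF i z] by (simp add: Q_def norm_mult norm_inverse divide_inverse)
      also have "\<dots> \<le> (B + B) / (r / 2)"
        using False r B slP[OF i z] B0 by (intro frac_le order_trans[OF norm_triangle_ineq4] add_mono) auto
      finally show ?thesis by (simp add: mult.commute)
    qed
  qed
  moreover have "f z = f q + (\<Sum>i<m. (z i - q i) * h i z)" if z: "z \<in> ?P" for z
  proof -
    have zc: "z \<in> cspace m" using z Pc by auto
    have "f (slide q i (z i) z) - f (slide q i (q i) z) = (z i - q i) * h i z" if i: "i < m" for i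
    proof (cases "z i = q i")
      case False
      then show ?thesis using hQ[OF i z] by (simp add: Q_def)
    qed simp
    then show ?thesis by (subst slide_telescope[OF zc q, of f]) simp
  qed
  ultimately show ?thesis using that by blast
qed

section \<open>The exterior algebra\<close>

definition ext_mult :: "(nat set \<Rightarrow> complex) \<Rightarrow> (nat set \<Rightarrow> complex) \<Rightarrow> nat set \<Rightarrow> complex" where
  "ext_mult a b S = (\<Sum>T\<in>Pow S. ext_sign T (S - T) * a T * b (S - T))"

text \<open>A bound on an element of the exterior algebra modulo the terms of degree greater than \<open>k\<close>. Inductions on
\<open>k\<close> take the place of arguments with nilpotent elements.\<close>

definition bounded_upto :: "nat \<Rightarrow> nat \<Rightarrow> (nat set \<Rightarrow> complex) \<Rightarrow> real \<Rightarrow> bool" where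
  "bounded_upto n k a A \<longleftrightarrow> (\<forall>S\<subseteq>{..<n}. card S \<le> k \<longrightarrow> cmod (a S) \<le> A)"

lemma bounded_uptoD: "\<lbrakk>bounded_upto n k a A; S \<subseteq> {..<n}; card S \<le> k\<rbrakk> \<Longrightarrow> cmod (a S) \<le> A"
  by (simp add: bounded_upto_def)

lemma bounded_upto_mono: "\<lbrakk>bounded_upto n l a A; k \<le> l; A \<le> B\<rbrakk> \<Longrightarrow> bounded_upto n k a B"
  unfolding bounded_upto_def by (meson order_trans)

lemma bounded_upto_nonneg: "bounded_upto n k a A \<Longrightarrow> 0 \<le> A"
  using bounded_uptoD[of n k a A "{}"] norm_ge_zero order_trans by (metis card.empty empty_subsetI zero_le)

lemma cmod_ext_sign: "cmod (ext_sign S T) = 1"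
  by (simp add: ext_sign_def norm_power)

lemma ext_sign_empty: "ext_sign {} T = 1" "ext_sign S {} = 1"
  by (simp_all add: ext_sign_def)

lemma ext_mult_empty: "ext_mult a b {} = a {} * b {}"
  by (simp add: ext_mult_def ext_sign_empty)

lemma cmod_ext_mult_le:
  assumes S: "S \<subseteq> {..<n}" and C: "C \<ge> 0"
    and le: "\<And>T. T \<subseteq> S \<Longrightarrow> cmod (a T) * cmod (b (S - T)) \<le> C"
  shows "cmod (ext_mult a b S) \<le> 2 ^ n * C"
proof -
  have fin: "finite S" using S finite_subset by blast
  have "cmod (ext_mult a b S) \<le> (\<Sum>T\<in>Pow S. cmod (ext_sign T (S - T) * a T * b (S - T)))"
    unfolding ext_mult_def by (rule norm_sum)
  also have "\<dots> \<le> (\<Sum>T\<in>Pow S. C)"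
    by (intro sum_mono) (use le in \<open>auto simp: norm_mult cmod_ext_sign\<close>)
  also have "\<dots> = 2 ^ card S * C" using fin by (simp add: card_Pow)
  also have "\<dots> \<le> 2 ^ n * C"
    using card_mono[OF _ S] C by (intro mult_right_mono power_increasing) auto
  finally show ?thesis .
qed

lemma bounded_upto_mult:
  assumes a: "bounded_upto n k a A" and b: "bounded_upto n k b B"
  shows "bounded_upto n k (ext_mult a b) (2 ^ n * (A * B))"
  unfolding bounded_upto_def
proof (intro allI impI)
  fix S assume S: "S \<subseteq> {..<n}" "card S \<le> k"
  have A: "A \<ge> 0" and B: "B \<ge> 0" using a b bounded_upto_nonneg by blast+
  have fin: "finite S" using S finite_subset by blast
  show "cmod (ext_mult a b S) \<le> 2 ^ n * (A * B)"
  proof (rule cmod_ext_mult_le[OF S(1)])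
    fix T assume T: "T \<subseteq> S"
    then have "card T \<le> k" "card (S - T) \<le> k"
      using S fin card_mono[of S T] card_mono[of S "S - T"] by auto
    then show "cmod (a T) * cmod (b (S - T)) \<le> A * B"
      using T S A by (intro mult_mono bounded_uptoD[OF a] bounded_uptoD[OF b]) auto
  qed (use A B in auto)
qed

text \<open>A factor without constant term raises the degree, so that only coefficients of smaller degree of the
other factor enter.\<close>

lemma bounded_upto_mult_nilpotent:
  assumes nil: "a {} = 0" and a: "bounded_upto n (Suc k) a A" and b: "bounded_upto n k b B"
  shows "bounded_upto n (Suc k) (ext_mult a b) (2 ^ n * (A * B))"
  unfolding bounded_upto_def
proof (intro allI impI)
  fix S assume S: "S \<subseteq> {..<n}" "card S \<le> Suc k"
  have A: "A \<ge> 0" and B: "B \<ge> 0" using a b bounded_upto_nonneg by blast+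
  have fin: "finite S" using S finite_subset by blast
  show "cmod (ext_mult a b S) \<le> 2 ^ n * (A * B)"
  proof (rule cmod_ext_mult_le[OF S(1)])
    fix T assume T: "T \<subseteq> S"
    show "cmod (a T) * cmod (b (S - T)) \<le> A * B"
    proof (cases "T = {}")
      case True
      then show ?thesis using nil A B by simp
    next
      case False
      then have "card (S - T) < card S" using T fin by (intro psubset_card_mono) auto
      moreover have "card T \<le> Suc k" using T S fin card_mono[of S T] by auto
      ultimately show ?thesis
        using T S A by (intro mult_mono bounded_uptoD[OF a] bounded_uptoD[OF b]) auto
    qed
  qed (use A B in auto)
qed

section \<open>Homomorphisms from superfunctions on a polydisc to the exterior algebra\<close>

text \<open>The embedding of functions into superfunctions; \<open>odd_fam j\<close> is the odd coordinate \<open>\<theta>\<^sub>j\<close>.\<close>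

definition even_fam :: "('z \<Rightarrow> complex) \<Rightarrow> nat set \<Rightarrow> 'z \<Rightarrow> complex" where
  "even_fam g = (\<lambda>S z. if S = {} then g z else 0)"

definition odd_fam :: "nat \<Rightarrow> nat set \<Rightarrow> 'z \<Rightarrow> complex" where
  "odd_fam j = (\<lambda>S z. if S = {j} then 1 else 0)"

definition fam_mult :: "(nat set \<Rightarrow> 'z \<Rightarrow> complex) \<Rightarrow> (nat set \<Rightarrow> 'z \<Rightarrow> complex) \<Rightarrow> nat set \<Rightarrow> 'z \<Rightarrow> complex" where
  "fam_mult F G = (\<lambda>S z. \<Sum>T\<in>Pow S. ext_sign T (S - T) * F T z * G (S - T) z)"

definition holo_fam :: "nat \<Rightarrow> nat \<Rightarrow> (nat \<Rightarrow> complex) set \<Rightarrow> (nat set \<Rightarrow> (nat \<Rightarrow> complex) \<Rightarrow> complex) \<Rightarrow> bool" where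
  "holo_fam m n D F \<longleftrightarrow> (\<forall>S\<subseteq>{..<n}. holo m D (F S))"

lemma fam_mult_even:
  assumes "finite S"
  shows "fam_mult (even_fam a) (even_fam b) S z = even_fam (\<lambda>z. a z * b z) S z"
proof -
  have "fam_mult (even_fam a) (even_fam b) S z =
      (\<Sum>T\<in>Pow S. if T = {} then even_fam (\<lambda>z. a z * b z) S z else 0)"
    unfolding fam_mult_def by (intro sum.cong) (auto simp: even_fam_def ext_sign_empty)
  then show ?thesis using assms by simp
qed

lemma fam_mult_odd:
  assumes "finite S"
  shows "fam_mult (odd_fam j) G S z = (if j \<in> S then ext_sign {j} (S - {j}) * G (S - {j}) z else 0)"
proof -
  have "fam_mult (odd_fam j) G S z =
      (\<Sum>T\<in>Pow S. if T = {j} then ext_sign {j} (S - {j}) * G (S - {j}) z else 0)"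
    unfolding fam_mult_def by (intro sum.cong) (auto simp: odd_fam_def)
  then show ?thesis using assms by simp
qed

text \<open>Splitting off the odd coordinate with the smallest index from a monomial costs no sign.\<close>

lemma ext_sign_least: "(\<And>t. t \<in> T \<Longrightarrow> j \<le> t) \<Longrightarrow> ext_sign {j} T = 1"
proof -
  assume le: "\<And>t. t \<in> T \<Longrightarrow> j \<le> t"
  have none: "{(i, l). i \<in> {j} \<and> l \<in> T \<and> l < i} = {}" using le by fastforce
  show "ext_sign {j} T = 1" unfolding ext_sign_def none by simp
qed

text \<open>A homomorphism from the superfunctions on a polydisc around \<open>q\<close> to the exterior algebra, over the
evaluation at \<open>q\<close>. Families are total functions, of which \<open>E\<close> depends only on the values on the polydisc
and on the indices \<open>S \<subseteq> {..<n}\<close>.\<close>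

locale ext_evaluation =
  fixes m n :: nat and q :: "nat \<Rightarrow> complex" and r :: real
    and E :: "(nat set \<Rightarrow> (nat \<Rightarrow> complex) \<Rightarrow> complex) \<Rightarrow> nat set \<Rightarrow> complex"
  assumes q: "q \<in> cspace m" and r: "r > 0"
    and E_cong: "(\<And>S z. \<lbrakk>S \<subseteq> {..<n}; z \<in> polydisc m q r\<rbrakk> \<Longrightarrow> F S z = G S z) \<Longrightarrow> E F = E G"
    and E_add: "\<lbrakk>holo_fam m n (polydisc m q r) F; holo_fam m n (polydisc m q r) G; S \<subseteq> {..<n}\<rbrakk>
        \<Longrightarrow> E (\<lambda>S z. F S z + G S z) S = E F S + E G S"
    and E_mult: "\<lbrakk>holo_fam m n (polydisc m q r) F; holo_fam m n (polydisc m q r) G; S \<subseteq> {..<n}\<rbrakk>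
        \<Longrightarrow> E (fam_mult F G) S = ext_mult (E F) (E G) S"
    and E_const: "S \<subseteq> {..<n} \<Longrightarrow> E (even_fam (\<lambda>z. a)) S = (if S = {} then a else 0)"
    and E_coordinate: "i < m \<Longrightarrow> E (even_fam (\<lambda>z. z i)) {} = q i"
    and E_odd: "j < n \<Longrightarrow> E (odd_fam j) {} = 0"
begin

abbreviation "P \<equiv> polydisc m q r"

lemma E_cong_at: "(\<And>S z. \<lbrakk>S \<subseteq> {..<n}; z \<in> P\<rbrakk> \<Longrightarrow> F S z = G S z) \<Longrightarrow> E F S = E G S"
  using E_cong[of F G] by simp

definition nil_coord :: "nat \<Rightarrow> nat set \<Rightarrow> complex" where
  "nil_coord i S = E (even_fam (\<lambda>z. z i)) S - (if S = {} then q i else 0)"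

lemma holo_fam_even: "holo m P g \<Longrightarrow> holo_fam m n P (even_fam g)"
  unfolding holo_fam_def even_fam_def
proof (intro allI impI)
  fix S :: "nat set"
  assume "holo m P g"
  then show "holo m P (\<lambda>z. if S = {} then g z else 0)"
    using holo_const[OF polydisc_subset_cspace, of m q r 0] by (cases "S = {}") simp_all
qed

lemma holo_fam_odd: "holo_fam m n P (odd_fam j)"
  using holo_const[OF polydisc_subset_cspace, of m q r] by (auto simp: holo_fam_def odd_fam_def)

lemma holo_diff_const: "holo m P (\<lambda>z. z i + - q i)"
  by (intro holo_add polydisc_subset_cspace holo_coordinate holo_const)

lemma E_sub_const:
  assumes "S \<subseteq> {..<n}"
  shows "E (even_fam (\<lambda>z. z i + - q i)) S = nil_coord i S"
proof -
  have "E (even_fam (\<lambda>z. z i + - q i)) S = E (\<lambda>S z. even_fam (\<lambda>z. z i) S z + even_fam (\<lambda>z. - q i) S z) S"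
    by (rule E_cong_at) (auto simp: even_fam_def)
  also have "\<dots> = nil_coord i S"
    using assms by (subst E_add) (auto simp: nil_coord_def E_const
        intro!: holo_fam_even holo_coordinate holo_const polydisc_subset_cspace)
  finally show ?thesis .
qed

lemma holo_sum:
  assumes "\<And>i. i < (l::nat) \<Longrightarrow> holo m P (F i)"
  shows "holo m P (\<lambda>z. \<Sum>i<l. F i z)"
  using assms by (induction l) (auto intro!: holo_add holo_const polydisc_subset_cspace)

lemma E_sum:
  assumes "\<And>i. i < (l::nat) \<Longrightarrow> holo_fam m n P (F i)" and "S \<subseteq> {..<n}"
  shows "E (\<lambda>S z. \<Sum>i<l. F i S z) S = (\<Sum>i<l. E (F i) S)"
  using assms(1)
proof (induction l)
  case 0
  have "E (\<lambda>S z. \<Sum>i<0. F i S z) S = E (even_fam (\<lambda>z. 0)) S"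
    by (rule E_cong_at) (auto simp: even_fam_def)
  then show ?case using assms by (simp add: E_const)
next
  case (Suc l)
  have "holo_fam m n P (\<lambda>S z. \<Sum>i<l. F i S z)"
    using Suc.prems by (auto simp: holo_fam_def intro: holo_sum)
  then show ?case using Suc assms(2) by (simp add: E_add)
qed

lemma E_even_expansion:
  assumes g: "holo m P g" and B: "\<And>z. z \<in> P \<Longrightarrow> cmod (g z) \<le> B"
  obtains h where "\<And>i. i < m \<Longrightarrow> holo m P (h i)"
    and "\<And>i z. \<lbrakk>i < m; z \<in> P\<rbrakk> \<Longrightarrow> cmod (h i z) \<le> 4 / r * B"
    and "\<And>S. S \<subseteq> {..<n} \<Longrightarrow> E (even_fam g) S =
      (if S = {} then g q else 0) + (\<Sum>i<m. ext_mult (nil_coord i) (E (even_fam (h i))) S)"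
proof -
  obtain h where h: "\<And>i. i < m \<Longrightarrow> holo m P (h i)"
    and hB: "\<And>i z. \<lbrakk>i < m; z \<in> P\<rbrakk> \<Longrightarrow> cmod (h i z) \<le> 4 / r * B"
    and eq: "\<And>z. z \<in> P \<Longrightarrow> g z = g q + (\<Sum>i<m. (z i - q i) * h i z)"
    using hadamard_polydisc[OF g q r B] by blast
  have "E (even_fam g) S = (if S = {} then g q else 0) + (\<Sum>i<m. ext_mult (nil_coord i) (E (even_fam (h i))) S)"
    if S: "S \<subseteq> {..<n}" for S
  proof -
    let ?F = "\<lambda>i. fam_mult (even_fam (\<lambda>z. z i + - q i)) (even_fam (h i))"
    have F: "?F i T z = even_fam (\<lambda>z. (z i + - q i) * h i z) T z" if "T \<subseteq> {..<n}" for i T z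
      using that by (intro fam_mult_even) (auto intro: finite_subset)
    have hF: "holo_fam m n P (?F i)" if "i < m" for i
    proof -
      have "holo_fam m n P (even_fam (\<lambda>z. (z i + - q i) * h i z))"
        by (intro holo_fam_even holo_mult polydisc_subset_cspace holo_diff_const h that)
      then show ?thesis unfolding holo_fam_def using F holo_cong by (metis (no_types, lifting))
    qed
    have "E (even_fam g) S = E (\<lambda>S z. even_fam (\<lambda>z. g q) S z + (\<Sum>i<m. ?F i S z)) S"
      by (intro E_cong_at) (simp only: F, simp add: eq even_fam_def)
    also have "\<dots> = E (even_fam (\<lambda>z. g q)) S + E (\<lambda>S z. \<Sum>i<m. ?F i S z) S"
    proof (rule E_add[OF _ _ S])
      show "holo_fam m n P (even_fam (\<lambda>z. g q))"
        by (intro holo_fam_even holo_const polydisc_subset_cspace)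
      show "holo_fam m n P (\<lambda>S z. \<Sum>i<m. ?F i S z)"
        using hF unfolding holo_fam_def by (auto intro: holo_sum)
    qed
    also have "E (\<lambda>S z. \<Sum>i<m. ?F i S z) S = (\<Sum>i<m. E (?F i) S)"
      using hF S by (intro E_sum)
    also have "\<dots> = (\<Sum>i<m. ext_mult (nil_coord i) (E (even_fam (h i))) S)"
    proof (intro sum.cong refl)
      fix i assume "i \<in> {..<m}"
      then have "E (?F i) S = ext_mult (E (even_fam (\<lambda>z. z i + - q i))) (E (even_fam (h i))) S"
        using S by (intro E_mult holo_fam_even holo_diff_const h) auto
      also have "\<dots> = ext_mult (nil_coord i) (E (even_fam (h i))) S"
        unfolding ext_mult_def
      proof (intro sum.cong refl)
        fix T assume "T \<in> Pow S"
        then have "T \<subseteq> {..<n}" using S by auto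
        then show "ext_sign T (S - T) * E (even_fam (\<lambda>z. z i + - q i)) T * E (even_fam (h i)) (S - T) =
            ext_sign T (S - T) * nil_coord i T * E (even_fam (h i)) (S - T)"
          by (simp only: E_sub_const)
      qed
      finally show "E (?F i) S = ext_mult (nil_coord i) (E (even_fam (h i))) S" .
    qed
    finally show ?thesis using S by (simp add: E_const)
  qed
  with h hB show ?thesis using that by blast
qed

lemma nil_coord_empty: "i < m \<Longrightarrow> nil_coord i {} = 0"
  by (simp add: nil_coord_def E_coordinate)

text \<open>The cost of one Hadamard step: \<open>m\<close> products of at most \<open>2 ^ n\<close> terms each, and the factor \<open>4 / r\<close> for the
difference quotients.\<close>

definition growth :: real where
  "growth = of_nat m * 2 ^ n * 4 / r"

lemma growth_nonneg: "growth \<ge> 0"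
  using r by (simp add: growth_def)

text \<open>In Hadamard's expansion each quotient \<open>h\<close> is multiplied by a nilpotent element, so a bound on the
images of the quotients up to degree \<open>k\<close> gives one on the image of \<open>g\<close> up to degree \<open>k + 1\<close>. The size \<open>D\<close>
of the nilpotent elements up to degree \<open>k + 1\<close> enters to first order only.\<close>

lemma even_step:
  assumes IH: "\<And>h B. \<lbrakk>holo m P h; \<And>z. z \<in> P \<Longrightarrow> cmod (h z) \<le> B\<rbrakk>
      \<Longrightarrow> bounded_upto n k (E (even_fam h)) (c * B)"
    and N: "\<And>i. i < m \<Longrightarrow> bounded_upto n (Suc k) (nil_coord i) D"
    and g: "holo m P g" and B: "\<And>z. z \<in> P \<Longrightarrow> cmod (g z) \<le> B"
  shows "bounded_upto n (Suc k) (E (even_fam g)) (B + growth * D * c * B)"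
  unfolding bounded_upto_def
proof (intro allI impI)
  fix S assume S: "S \<subseteq> {..<n}" "card S \<le> Suc k"
  obtain h where h: "\<And>i. i < m \<Longrightarrow> holo m P (h i)"
    and hB: "\<And>i z. \<lbrakk>i < m; z \<in> P\<rbrakk> \<Longrightarrow> cmod (h i z) \<le> 4 / r * B"
    and eq: "\<And>S. S \<subseteq> {..<n} \<Longrightarrow> E (even_fam g) S =
      (if S = {} then g q else 0) + (\<Sum>i<m. ext_mult (nil_coord i) (E (even_fam (h i))) S)"
    using E_even_expansion[OF g B] by blast
  have "q \<in> P" using q r by (simp add: polydisc_def)
  then have gq: "cmod (g q) \<le> B" "0 \<le> B" using B norm_ge_zero order_trans by blast+
  have "cmod (ext_mult (nil_coord i) (E (even_fam (h i))) S) \<le> 2 ^ n * (D * (c * (4 / r * B)))" if "i < m" for i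
    using bounded_uptoD[OF bounded_upto_mult_nilpotent[OF nil_coord_empty[OF that] N[OF that] IH[OF h[OF that] hB[OF that]]] S] .
  then have "(\<Sum>i<m. cmod (ext_mult (nil_coord i) (E (even_fam (h i))) S))
      \<le> of_nat (card {..<m}) * (2 ^ n * (D * (c * (4 / r * B))))"
    by (intro sum_bounded_above) blast
  then have "cmod (\<Sum>i<m. ext_mult (nil_coord i) (E (even_fam (h i))) S)
      \<le> of_nat m * (2 ^ n * (D * (c * (4 / r * B))))"
    using order_trans[OF norm_sum] by simp
  moreover have "cmod (if S = {} then g q else 0) \<le> B" using gq by auto
  ultimately have "cmod (E (even_fam g) S) \<le> B + of_nat m * (2 ^ n * (D * (c * (4 / r * B))))"
    unfolding eq[OF S(1)] by (meson add_mono norm_triangle_le)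
  then show "cmod (E (even_fam g) S) \<le> B + growth * D * c * B"
    by (simp add: growth_def mult_ac)
qed

lemma even_bound:
  assumes N: "\<And>i. i < m \<Longrightarrow> bounded_upto n k (nil_coord i) D" and D: "D \<ge> 0"
    and g: "holo m P g" and B: "\<And>z. z \<in> P \<Longrightarrow> cmod (g z) \<le> B"
  shows "bounded_upto n k (E (even_fam g)) ((1 + growth * D) ^ k * B)"
  using N g B
proof (induction k arbitrary: g B)
  case 0
  have "q \<in> P" using q r by (simp add: polydisc_def)
  obtain h where "\<And>i. i < m \<Longrightarrow> holo m P (h i)"
    and "\<And>i z. \<lbrakk>i < m; z \<in> P\<rbrakk> \<Longrightarrow> cmod (h i z) \<le> 4 / r * B"
    and eq: "\<And>S. S \<subseteq> {..<n} \<Longrightarrow> E (even_fam g) S =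
      (if S = {} then g q else 0) + (\<Sum>i<m. ext_mult (nil_coord i) (E (even_fam (h i))) S)"
    by (rule E_even_expansion[OF 0(2,3)]) (assumption | rule that)+
  from eq[of "{}"] have "E (even_fam g) {} = g q + (\<Sum>i<m. ext_mult (nil_coord i) (E (even_fam (h i))) {})"
    by simp
  then have "E (even_fam g) {} = g q" by (simp add: ext_mult_empty nil_coord_empty)
  moreover have "S = {}" if "S \<subseteq> {..<n}" "card S \<le> 0" for S :: "nat set"
    using that finite_subset by (metis card_eq_0_iff finite_lessThan le_zero_eq)
  ultimately have "cmod (E (even_fam g) S) \<le> B" if "S \<subseteq> {..<n}" "card S \<le> 0" for S
    using 0(3)[OF \<open>q \<in> P\<close>] that by metis
  then show ?case by (simp only: bounded_upto_def) simp
next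
  case (Suc k)
  let ?c = "(1 + growth * D) ^ k"
  have "q \<in> P" using q r by (simp add: polydisc_def)
  then have B: "0 \<le> B" using Suc.prems(3) norm_ge_zero order_trans by blast
  have N: "bounded_upto n k (nil_coord i) D" if "i < m" for i
    using Suc.prems(1)[OF that] by (rule bounded_upto_mono) auto
  have "bounded_upto n (Suc k) (E (even_fam g)) (B + growth * D * ?c * B)"
    by (rule even_step[OF Suc.IH Suc.prems]) (use N in auto)
  moreover have "1 \<le> ?c" using growth_nonneg D by (intro one_le_power) simp
  then have "B + growth * D * ?c * B \<le> ?c * B + growth * D * ?c * B"
    using B mult_right_mono[of 1 ?c B] by simp
  then have "B + growth * D * ?c * B \<le> (1 + growth * D) ^ Suc k * B"
    by (simp add: algebra_simps)
  ultimately show ?case by (rule bounded_upto_mono[OF _ le_refl])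
qed

text \<open>A superfunction in the odd coordinates \<open>\<theta>\<^sub>j, \<dots>, \<theta>\<^bsub>n-1\<^esub>\<close> is \<open>F0 + \<theta>\<^sub>j F1\<close> with \<open>F0\<close> and \<open>F1\<close> free of \<open>\<theta>\<^sub>j\<close>;
the induction is on the number \<open>l\<close> of odd coordinates involved. The second bound is of first order in the
size \<open>D'\<close> of the coordinates up to degree \<open>k + 1\<close>, with a factor that depends only on their size \<open>D\<close> up
to degree \<open>k\<close>. This form allows \<open>D'\<close> to be estimated in terms of itself when automorphisms are inverted.\<close>

lemma fam_bound:
  assumes N: "\<And>i. i < m \<Longrightarrow> bounded_upto n k (nil_coord i) D"
    and N': "\<And>i. i < m \<Longrightarrow> bounded_upto n (Suc k) (nil_coord i) D'"
    and O: "\<And>j. j < n \<Longrightarrow> bounded_upto n k (E (odd_fam j)) D"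
    and O': "\<And>j. j < n \<Longrightarrow> bounded_upto n (Suc k) (E (odd_fam j)) D'"
    and D: "D \<ge> 1" "D' \<ge> 0"
    and F: "holo_fam m n P F" and B: "\<And>S z. \<lbrakk>S \<subseteq> {..<n}; z \<in> P\<rbrakk> \<Longrightarrow> cmod (F S z) \<le> B"
    and l: "l \<le> n"
    and supp: "\<And>S z. \<lbrakk>S \<subseteq> {..<n}; z \<in> P; \<not> S \<subseteq> {n - l..<n}\<rbrakk> \<Longrightarrow> F S z = 0"
  shows "bounded_upto n k (E F) ((1 + growth * D) ^ k * (1 + 2 ^ n * D) ^ l * B) \<and>
    bounded_upto n (Suc k) (E F) ((1 + growth * D) ^ Suc k * (1 + D') * (1 + 2 ^ n * D) ^ l * B)"
  using F B l supp
proof (induction l arbitrary: F)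
  case 0
  let ?c = "(1 + growth * D) ^ k"
  have "q \<in> P" using q r by (simp add: polydisc_def)
  then have B: "0 \<le> B" using "0.prems"(2)[of "{}"] norm_ge_zero order_trans by blast
  have EF: "E F = E (even_fam (F {}))"
    by (rule E_cong) (use "0.prems"(4) in \<open>auto simp: even_fam_def\<close>)
  have h: "holo m P (F {})" using "0.prems"(1) by (simp add: holo_fam_def)
  have FB: "cmod (F {} z) \<le> B" if "z \<in> P" for z using "0.prems"(2)[of "{}"] that by simp
  have e: "bounded_upto n k (E (even_fam g)) (?c * B)"
    if "holo m P g" "\<And>z. z \<in> P \<Longrightarrow> cmod (g z) \<le> B" for g B
    using even_bound[OF N _ that] D by simp
  have "1 \<le> ?c" using growth_nonneg D by (intro one_le_power) simp
  have "1 + growth * D' * ?c \<le> ?c + growth * D' * ?c" using \<open>1 \<le> ?c\<close> by simp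
  also have "\<dots> = (1 + growth * 1 * D') * ?c" by (simp add: algebra_simps)
  also have "\<dots> \<le> ((1 + growth * D) * (1 + D')) * ?c"
  proof (intro mult_right_mono)
    have "growth * 1 * D' \<le> growth * D * D'"
      using growth_nonneg D by (intro mult_right_mono mult_left_mono) auto
    moreover have "0 \<le> growth * D" using growth_nonneg D by simp
    ultimately show "1 + growth * 1 * D' \<le> (1 + growth * D) * (1 + D')"
      using D(2) by (simp add: algebra_simps)
  qed (use \<open>1 \<le> ?c\<close> in auto)
  finally have "1 + growth * D' * ?c \<le> (1 + growth * D) ^ Suc k * (1 + D')" by (simp add: mult_ac)
  from mult_right_mono[OF this B]
  have le: "B + growth * D' * ?c * B \<le> (1 + growth * D) ^ Suc k * (1 + D') * B"
    by (simp add: algebra_simps)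
  have "bounded_upto n (Suc k) (E (even_fam (F {}))) (B + growth * D' * ?c * B)"
    by (rule even_step[OF e N' h FB])
  from bounded_upto_mono[OF this le_refl le] e[OF h FB]
  show ?case unfolding EF by simp
next
  case (Suc l)
  define j where "j = n - Suc l"
  have j: "j < n" "n - l = Suc j" using Suc.prems(3) by (auto simp: j_def)
  let ?X = "(1 + 2 ^ n * D) ^ l * B"
  have "q \<in> P" using q r by (simp add: polydisc_def)
  then have B: "0 \<le> B" using Suc.prems(2)[of "{}"] norm_ge_zero order_trans by blast
  then have X: "0 \<le> ?X" using D by simp
  define F0 where "F0 = (\<lambda>S z. if j \<in> S then 0 else F S z)"
  define F1 where "F1 = (\<lambda>S z. if j \<in> S then 0 else F (insert j S) z)"
  have hz: "holo m P (\<lambda>z. 0)" by (intro holo_const polydisc_subset_cspace)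
  have h0: "holo_fam m n P F0" 
    unfolding holo_fam_def
  proof (intro allI impI)
    fix S assume "S \<subseteq> {..<n}"
    then show "holo m P (F0 S)"
      using Suc.prems(1) hz by (cases "j \<in> S") (simp_all add: F0_def holo_fam_def)
  qed
  have h1: "holo_fam m n P F1"
    unfolding holo_fam_def
  proof (intro allI impI)
    fix S assume "S \<subseteq> {..<n}"
    then show "holo m P (F1 S)"
      using Suc.prems(1) hz j by (cases "j \<in> S") (simp_all add: F1_def holo_fam_def)
  qed
  have supp: "F S z = 0" if "S \<subseteq> {..<n}" "z \<in> P" "\<not> S \<subseteq> {j..<n}" for S z
    using Suc.prems(4)[of S z] that by (simp add: j_def)
  have atl: "S \<subseteq> {Suc j..<n} \<longleftrightarrow> S \<subseteq> {j..<n} \<and> j \<notin> S" for S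
  proof -
    have "{Suc j..<n} = {j..<n} - {j}" by auto
    then show ?thesis by auto
  qed
  have b0: "bounded_upto n k (E F0) ((1 + growth * D) ^ k * (1 + 2 ^ n * D) ^ l * B)"
    "bounded_upto n (Suc k) (E F0) ((1 + growth * D) ^ Suc k * (1 + D') * (1 + 2 ^ n * D) ^ l * B)"
  proof -
    have "F0 S z = 0" if "S \<subseteq> {..<n}" "z \<in> P" "\<not> S \<subseteq> {n - l..<n}" for S z
      using that supp[of S z] by (auto simp: F0_def j(2) atl)
    moreover have "cmod (F0 S z) \<le> B" if "S \<subseteq> {..<n}" "z \<in> P" for S z
      using Suc.prems(2)[OF that] B by (simp add: F0_def)
    ultimately show "bounded_upto n k (E F0) ((1 + growth * D) ^ k * (1 + 2 ^ n * D) ^ l * B)"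
    "bounded_upto n (Suc k) (E F0) ((1 + growth * D) ^ Suc k * (1 + D') * (1 + 2 ^ n * D) ^ l * B)"
      using Suc.IH[OF h0] Suc.prems(3) by auto
  qed
  have b1: "bounded_upto n k (E F1) ((1 + growth * D) ^ k * (1 + 2 ^ n * D) ^ l * B)"
  proof -
    have "F1 S z = 0" if "S \<subseteq> {..<n}" "z \<in> P" "\<not> S \<subseteq> {n - l..<n}" for S z
      using that supp[of "insert j S" z] j(1) by (auto simp: F1_def j(2) atl)
    moreover have "cmod (F1 S z) \<le> B" if "S \<subseteq> {..<n}" "z \<in> P" for S z
      using Suc.prems(2)[of "insert j S" z] that j(1) B by (simp add: F1_def)
    ultimately show ?thesis
      using Suc.IH[OF h1] Suc.prems(3) by auto
  qed
  have split: "F S z = F0 S z + fam_mult (odd_fam j) F1 S z" if "S \<subseteq> {..<n}" "z \<in> P" for S z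
  proof -
    have fin: "finite S" using that finite_subset by blast
    show ?thesis
    proof (cases "j \<in> S")
      case True
      then have ins: "insert j (S - {j}) = S" by auto
      show ?thesis
      proof (cases "S \<subseteq> {j..<n}")
        case sub: True
        then have "ext_sign {j} (S - {j}) = 1" by (intro ext_sign_least) auto
        then show ?thesis using True ins by (simp add: fam_mult_odd[OF fin] F0_def F1_def)
      next
        case False
        then show ?thesis using supp[OF that] True ins
          by (simp add: fam_mult_odd[OF fin] F0_def F1_def)
      qed
    qed (simp add: fam_mult_odd[OF fin] F0_def)
  qed
  have hm: "holo_fam m n P (fam_mult (odd_fam j) F1)"
    unfolding holo_fam_def
  proof (intro allI impI)
    fix S assume S: "S \<subseteq> {..<n}"
    then have fin: "finite S" using finite_subset by blast
    show "holo m P (fam_mult (odd_fam j) F1 S)"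
    proof (cases "j \<in> S")
      case True
      have "S - {j} \<subseteq> {..<n}" using S by auto
      then have "holo m P (F1 (S - {j}))" using h1 unfolding holo_fam_def by blast
      then have "holo m P (\<lambda>z. ext_sign {j} (S - {j}) * F1 (S - {j}) z)"
        by (intro holo_mult holo_const polydisc_subset_cspace)
      moreover have "fam_mult (odd_fam j) F1 S = (\<lambda>z. ext_sign {j} (S - {j}) * F1 (S - {j}) z)"
        using True by (intro ext) (simp add: fam_mult_odd[OF fin])
      ultimately show ?thesis by simp
    next
      case False
      then have "fam_mult (odd_fam j) F1 S = (\<lambda>z. 0)"
        by (intro ext) (simp add: fam_mult_odd[OF fin])
      then show ?thesis using hz by simp
    qed
  qed
  have EF: "E F S = E F0 S + ext_mult (E (odd_fam j)) (E F1) S" if "S \<subseteq> {..<n}" for S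
  proof -
    have "E F = E (\<lambda>S z. F0 S z + fam_mult (odd_fam j) F1 S z)"
      by (rule E_cong) (rule split)
    then show ?thesis using that h0 h1 hm by (simp add: E_add E_mult holo_fam_odd)
  qed
  let ?c = "(1 + growth * D) ^ k"
  have c: "1 \<le> ?c" using growth_nonneg D by (intro one_le_power) simp
  have gD: "0 \<le> growth * D" using growth_nonneg D by simp
  have bnd_sum: "bounded_upto n k' (E F) (A + C)"
    if "bounded_upto n k' (E F0) A" "bounded_upto n k' (ext_mult (E (odd_fam j)) (E F1)) C" for k' A C
    unfolding bounded_upto_def
  proof (intro allI impI)
    fix S assume S: "S \<subseteq> {..<n}" "card S \<le> k'"
    show "cmod (E F S) \<le> A + C"
      unfolding EF[OF S(1)]
      by (intro norm_triangle_le add_mono bounded_uptoD[OF that(1) S] bounded_uptoD[OF that(2) S])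
  qed
  have "bounded_upto n k (ext_mult (E (odd_fam j)) (E F1)) (2 ^ n * (D * (?c * (1 + 2 ^ n * D) ^ l * B)))"
    by (rule bounded_upto_mult[OF O[OF j(1)] b1])
  from bnd_sum[OF b0(1) this] have 1: "bounded_upto n k (E F) (?c * (1 + 2 ^ n * D) ^ Suc l * B)"
    by (simp add: algebra_simps)
  have "bounded_upto n (Suc k) (ext_mult (E (odd_fam j)) (E F1)) (2 ^ n * (D' * (?c * (1 + 2 ^ n * D) ^ l * B)))"
    by (rule bounded_upto_mult_nilpotent[OF E_odd[OF j(1)] O'[OF j(1)] b1])
  moreover have "2 ^ n * (D' * (?c * (1 + 2 ^ n * D) ^ l * B)) \<le>
      2 ^ n * D * ((1 + growth * D) ^ Suc k * (1 + D') * (1 + 2 ^ n * D) ^ l * B)"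
  proof -
    have "D' * ?c \<le> (1 + D') * ((1 + growth * D) * ?c)"
    proof (intro mult_mono)
      show "?c \<le> (1 + growth * D) * ?c" using mult_right_mono[of 1 "1 + growth * D" ?c] c gD by simp
    qed (use c D in auto)
    also have "\<dots> = 1 * ((1 + D') * ((1 + growth * D) * ?c))" by simp
    also have "\<dots> \<le> D * ((1 + D') * ((1 + growth * D) * ?c))"
      using c D gD by (intro mult_right_mono) auto
    finally have "2 ^ n * (D' * ?c) * ?X \<le> 2 ^ n * (D * ((1 + D') * ((1 + growth * D) * ?c))) * ?X"
      using X by (intro mult_right_mono mult_left_mono) auto
    then show ?thesis by (simp add: mult_ac)
  qed
  ultimately have "bounded_upto n (Suc k) (ext_mult (E (odd_fam j)) (E F1))
      (2 ^ n * D * ((1 + growth * D) ^ Suc k * (1 + D') * (1 + 2 ^ n * D) ^ l * B))"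
    by (rule bounded_upto_mono[OF _ le_refl])
  then have 2: "bounded_upto n (Suc k) (E F) 
     ((1 + growth * D) ^ Suc k * (1 + D') * (1 + 2 ^ n * D) ^ l * B +
      2 ^ n * D * ((1 + growth * D) ^ Suc k * (1 + D') * (1 + 2 ^ n * D) ^ l * B))"
    by (rule bnd_sum[OF b0(2)])
  have "(1 + growth * D) ^ Suc k * (1 + D') * (1 + 2 ^ n * D) ^ l * B +
      2 ^ n * D * ((1 + growth * D) ^ Suc k * (1 + D') * (1 + 2 ^ n * D) ^ l * B) =
     (1 + growth * D) ^ Suc k * (1 + D') * (1 + 2 ^ n * D) ^ Suc l * B"
    by (simp add: algebra_simps)
  with 1 2 show ?case by simp
qed

end

section \<open>The group of automorphisms\<close>

lemma graded_homD:
  assumes "h \<in> graded_hom R P S Q"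
  shows "x \<in> carrier R \<Longrightarrow> h x \<in> carrier S"
    and "\<lbrakk>x \<in> carrier R; y \<in> carrier R\<rbrakk> \<Longrightarrow> h (x \<otimes>\<^bsub>R\<^esub> y) = h x \<otimes>\<^bsub>S\<^esub> h y"
    and "\<lbrakk>x \<in> carrier R; y \<in> carrier R\<rbrakk> \<Longrightarrow> h (x \<oplus>\<^bsub>R\<^esub> y) = h x \<oplus>\<^bsub>S\<^esub> h y"
    and "h \<one>\<^bsub>R\<^esub> = \<one>\<^bsub>S\<^esub>"
    and "x \<in> carrier R \<Longrightarrow> h (a \<odot>\<^bsub>R\<^esub> x) = a \<odot>\<^bsub>S\<^esub> h x"
    and "x \<in> P p \<Longrightarrow> h x \<in> Q p"
  using assms unfolding graded_hom_def ring_hom_def by blast+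

lemma graded_algebra_part_subset: "graded_algebra R P \<Longrightarrow> P p \<subseteq> carrier R"
proof -
  assume "graded_algebra R P"
  then interpret graded_algebra R P .
  show "P p \<subseteq> carrier R"
    using subgroup.subset[OF submodule.axioms(1)[OF part_submodule]] by simp
qed

lemma graded_algebra_closed:
  assumes "graded_algebra R P"
  shows "\<lbrakk>x \<in> carrier R; y \<in> carrier R\<rbrakk> \<Longrightarrow> x \<otimes>\<^bsub>R\<^esub> y \<in> carrier R"
    and "\<lbrakk>x \<in> carrier R; y \<in> carrier R\<rbrakk> \<Longrightarrow> x \<oplus>\<^bsub>R\<^esub> y \<in> carrier R"
    and "\<one>\<^bsub>R\<^esub> \<in> carrier R"
    and "x \<in> carrier R \<Longrightarrow> a \<odot>\<^bsub>R\<^esub> x \<in> carrier R"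
proof -
  interpret graded_algebra R P by fact
  show "\<lbrakk>x \<in> carrier R; y \<in> carrier R\<rbrakk> \<Longrightarrow> x \<otimes>\<^bsub>R\<^esub> y \<in> carrier R"
    and "\<lbrakk>x \<in> carrier R; y \<in> carrier R\<rbrakk> \<Longrightarrow> x \<oplus>\<^bsub>R\<^esub> y \<in> carrier R"
    and "\<one>\<^bsub>R\<^esub> \<in> carrier R"
    by simp_all
  show "x \<in> carrier R \<Longrightarrow> a \<odot>\<^bsub>R\<^esub> x \<in> carrier R"
    using smult_closed[of a x] by (simp add: complex_field_def)
qed

lemma graded_hom_compose:
  assumes h: "h \<in> graded_hom R P S Q" and k: "k \<in> graded_hom S Q T W" and R: "graded_algebra R P"
  shows "(\<lambda>x\<in>carrier R. k (h x)) \<in> graded_hom R P T W"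
  using graded_homD[OF h] graded_homD[OF k] graded_algebra_closed[OF R]
    graded_algebra_part_subset[OF R]
  by (fastforce simp: graded_hom_def ring_hom_def)

lemma graded_hom_id:
  assumes R: "graded_algebra R P"
  shows "(\<lambda>x\<in>carrier R. x) \<in> graded_hom R P R P"
  using graded_algebra_closed[OF R] graded_algebra_part_subset[OF R]
  by (fastforce simp: graded_hom_def ring_hom_def)

lemma morphismD:
  assumes "morphism M N \<phi>"
  shows "under \<phi> \<in> extensional (topspace (body M))"
    and "continuous_map (body M) (body N) (under \<phi>)"
    and "openin (body N) U \<Longrightarrow> pull \<phi> U \<in> graded_hom (sections (str_sheaf N) U) (part (str_sheaf N) U)
                     (sections (str_sheaf M) (preim M \<phi> U)) (part (str_sheaf M) (preim M \<phi> U))"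
    and "openin (body N) U \<Longrightarrow> pull \<phi> U \<in> extensional (sects (str_sheaf N) U)"
    and "\<not> openin (body N) U \<Longrightarrow> pull \<phi> U = (\<lambda>_. undefined)"
    and "\<lbrakk>openin (body N) U; openin (body N) V; V \<subseteq> U; f \<in> sects (str_sheaf N) U\<rbrakk> \<Longrightarrow>
       pull \<phi> V (restr (str_sheaf N) U V f) = restr (str_sheaf M) (preim M \<phi> U) (preim M \<phi> V) (pull \<phi> U f)"
  using assms unfolding morphism_def Let_def by blast+

lemma openin_preim:
  assumes "morphism M N \<phi>" "openin (body N) U"
  shows "openin (body M) (preim M \<phi> U)"
  using openin_continuous_map_preimage[OF morphismD(2)[OF assms(1)] assms(2)]
  by (simp add: preim_def)

lemma under_in_topspace: "\<lbrakk>morphism M N \<phi>; x \<in> topspace (body M)\<rbrakk> \<Longrightarrow> under \<phi> x \<in> topspace (body N)"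
  using morphismD(2) continuous_map_image_subset_topspace by blast

lemma preim_mono: "U \<subseteq> V \<Longrightarrow> preim M \<phi> U \<subseteq> preim M \<phi> V"
  by (auto simp: preim_def)

lemma preim_comp:
  assumes "morphism L M \<psi>"
  shows "preim L (comp_morphism L M N \<phi> \<psi>) U = preim L \<psi> (preim M \<phi> U)"
  using under_in_topspace[OF assms] by (auto simp: preim_def comp_morphism_def)

lemma super_map_eqI:
  fixes \<phi> \<psi> :: "('p, 's, 'q, 't) super_map"
  shows "\<lbrakk>under \<phi> = under \<psi>; pull \<phi> = pull \<psi>\<rbrakk> \<Longrightarrow> \<phi> = \<psi>"
  by (cases \<phi>; cases \<psi>) simp

lemma morphism_comp:
  assumes \<phi>: "morphism M N \<phi>" and \<psi>: "morphism L M \<psi>"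
    and N: "sheaf_of_graded_algebras (body N) (str_sheaf N)"
  shows "morphism L N (comp_morphism L M N \<phi> \<psi>)"
  unfolding morphism_def Let_def
proof (intro conjI allI impI ballI)
  let ?c = "comp_morphism L M N \<phi> \<psi>"
  show "under ?c \<in> extensional (topspace (body L))" by (simp add: comp_morphism_def)
  have "continuous_map (body L) (body N) (under \<phi> \<circ> under \<psi>)"
    by (rule continuous_map_compose[OF morphismD(2)[OF \<psi>] morphismD(2)[OF \<phi>]])
  then show "continuous_map (body L) (body N) (under ?c)"
    by (rule continuous_map_eq) (simp add: comp_morphism_def)
  fix U
  show "pull ?c U = (\<lambda>_. undefined)" if "\<not> openin (body N) U"
    using that by (simp add: comp_morphism_def)
  assume U: "openin (body N) U"
  show "pull ?c U \<in> extensional (sects (str_sheaf N) U)"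
    using U by (simp add: comp_morphism_def)
  show "pull ?c U \<in> graded_hom (sections (str_sheaf N) U) (part (str_sheaf N) U)
     (sections (str_sheaf L) (preim L ?c U)) (part (str_sheaf L) (preim L ?c U))"
    using graded_hom_compose[OF morphismD(3)[OF \<phi> U] morphismD(3)[OF \<psi> openin_preim[OF \<phi> U]]]
      sheaf_of_graded_algebras.sections_algebra[OF N U] U
    by (simp add: preim_comp[OF \<psi>]) (simp add: comp_morphism_def)
next
  let ?c = "comp_morphism L M N \<phi> \<psi>"
  fix U V f assume *: "openin (body N) U \<and> openin (body N) V \<and> V \<subseteq> U" and f: "f \<in> sects (str_sheaf N) U"
  then have U: "openin (body N) U" and V: "openin (body N) V" and VU: "V \<subseteq> U" by auto
  have "restr (str_sheaf N) U V f \<in> sects (str_sheaf N) V"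
    using graded_homD(1)[OF sheaf_of_graded_algebras.restr_hom[OF N U V VU] f] .
  moreover have "pull \<psi> (preim M \<phi> V) (restr (str_sheaf M) (preim M \<phi> U) (preim M \<phi> V) (pull \<phi> U f)) =
      restr (str_sheaf L) (preim L \<psi> (preim M \<phi> U)) (preim L \<psi> (preim M \<phi> V)) (pull \<psi> (preim M \<phi> U) (pull \<phi> U f))"
    by (rule morphismD(6)[OF \<psi> openin_preim[OF \<phi> U] openin_preim[OF \<phi> V] preim_mono[OF VU]
        graded_homD(1)[OF morphismD(3)[OF \<phi> U] f]])
  ultimately show "pull ?c V (restr (str_sheaf N) U V f) =
      restr (str_sheaf L) (preim L ?c U) (preim L ?c V) (pull ?c U f)"
    using U V f morphismD(6)[OF \<phi> U V VU f]
    unfolding preim_comp[OF \<psi>] by (simp add: comp_morphism_def)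
qed

lemma preim_id: "U \<subseteq> topspace (body M) \<Longrightarrow> preim M (id_morphism M) U = U"
  by (auto simp: preim_def id_morphism_def)

lemma morphism_id:
  assumes M: "sheaf_of_graded_algebras (body M) (str_sheaf M)"
  shows "morphism M M (id_morphism M)"
  unfolding morphism_def Let_def
proof (intro conjI allI impI ballI)
  show "under (id_morphism M) \<in> extensional (topspace (body M))" by (simp add: id_morphism_def)
  show "continuous_map (body M) (body M) (under (id_morphism M))"
    by (rule continuous_map_eq[OF continuous_map_id]) (simp add: id_morphism_def)
  fix U
  show "pull (id_morphism M) U = (\<lambda>_. undefined)" if "\<not> openin (body M) U"
    using that by (simp add: id_morphism_def)
  assume U: "openin (body M) U"
  show "pull (id_morphism M) U \<in> extensional (sects (str_sheaf M) U)"
    using U by (simp add: id_morphism_def)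
  show "pull (id_morphism M) U \<in> graded_hom (sections (str_sheaf M) U) (part (str_sheaf M) U)
     (sections (str_sheaf M) (preim M (id_morphism M) U)) (part (str_sheaf M) (preim M (id_morphism M) U))"
    unfolding preim_id[OF openin_subset[OF U]]
    using graded_hom_id[OF sheaf_of_graded_algebras.sections_algebra[OF M U]] U
    by (simp add: id_morphism_def)
next
  fix U V f assume "openin (body M) U \<and> openin (body M) V \<and> V \<subseteq> U" and f: "f \<in> sects (str_sheaf M) U"
  then have U: "openin (body M) U" and V: "openin (body M) V" and VU: "V \<subseteq> U" by auto
  have "restr (str_sheaf M) U V f \<in> sects (str_sheaf M) V"
    using graded_homD(1)[OF sheaf_of_graded_algebras.restr_hom[OF M U V VU] f] .
  then show "pull (id_morphism M) V (restr (str_sheaf M) U V f) =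
      restr (str_sheaf M) (preim M (id_morphism M) U) (preim M (id_morphism M) V) (pull (id_morphism M) U f)"
    unfolding preim_id[OF openin_subset[OF U]] preim_id[OF openin_subset[OF V]]
    using U V f by (simp add: id_morphism_def)
qed

lemma comp_id_left:
  assumes \<phi>: "morphism L M \<phi>"
  shows "comp_morphism L M M (id_morphism M) \<phi> = \<phi>"
proof (rule super_map_eqI)
  show "under (comp_morphism L M M (id_morphism M) \<phi>) = under \<phi>"
    using morphismD(1)[OF \<phi>] under_in_topspace[OF \<phi>]
    by (intro ext) (auto simp: comp_morphism_def id_morphism_def extensional_def restrict_def)
  show "pull (comp_morphism L M M (id_morphism M) \<phi>) = pull \<phi>"
  proof
    fix U
    show "pull (comp_morphism L M M (id_morphism M) \<phi>) U = pull \<phi> U"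
    proof (cases "openin (body M) U")
      case True
      then have "pull \<phi> U f = undefined" if "f \<notin> sects (str_sheaf M) U" for f
        using morphismD(4)[OF \<phi> True] that by (simp add: extensional_def)
      then show ?thesis
        using True preim_id[OF openin_subset[OF True]]
        by (intro ext) (simp add: comp_morphism_def id_morphism_def restrict_def)
    qed (simp add: comp_morphism_def morphismD(5)[OF \<phi>])
  qed
qed

lemma comp_id_right:
  assumes \<phi>: "morphism L M \<phi>"
  shows "comp_morphism L L M \<phi> (id_morphism L) = \<phi>"
proof (rule super_map_eqI)
  show "under (comp_morphism L L M \<phi> (id_morphism L)) = under \<phi>"
    using morphismD(1)[OF \<phi>]
    by (intro ext) (auto simp: comp_morphism_def id_morphism_def extensional_def restrict_def)
  show "pull (comp_morphism L L M \<phi> (id_morphism L)) = pull \<phi>"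
  proof
    fix U
    show "pull (comp_morphism L L M \<phi> (id_morphism L)) U = pull \<phi> U"
    proof (cases "openin (body M) U")
      case True
      then have "pull \<phi> U f = undefined" if "f \<notin> sects (str_sheaf M) U" for f
        using morphismD(4)[OF \<phi> True] that by (simp add: extensional_def)
      then show ?thesis
        using True openin_preim[OF \<phi> True] graded_homD(1)[OF morphismD(3)[OF \<phi> True]]
        by (intro ext) (simp add: comp_morphism_def id_morphism_def restrict_def)
    qed (simp add: comp_morphism_def morphismD(5)[OF \<phi>])
  qed
qed

lemma comp_assoc:
  assumes \<xi>: "morphism N K \<xi>" and \<phi>: "morphism M N \<phi>" and \<psi>: "morphism L M \<psi>"
  shows "comp_morphism L N K \<xi> (comp_morphism L M N \<phi> \<psi>) =
    comp_morphism L M K (comp_morphism M N K \<xi> \<phi>) \<psi>"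
proof (rule super_map_eqI)
  show "under (comp_morphism L N K \<xi> (comp_morphism L M N \<phi> \<psi>)) =
      under (comp_morphism L M K (comp_morphism M N K \<xi> \<phi>) \<psi>)"
    using under_in_topspace[OF \<psi>] by (intro ext) (simp add: comp_morphism_def restrict_def)
  show "pull (comp_morphism L N K \<xi> (comp_morphism L M N \<phi> \<psi>)) =
      pull (comp_morphism L M K (comp_morphism M N K \<xi> \<phi>) \<psi>)"
  proof
    fix U
    show "pull (comp_morphism L N K \<xi> (comp_morphism L M N \<phi> \<psi>)) U =
      pull (comp_morphism L M K (comp_morphism M N K \<xi> \<phi>) \<psi>) U"
    proof (cases "openin (body K) U")
      case U: True
      have "pull (comp_morphism L M K (comp_morphism M N K \<xi> \<phi>) \<psi>) U =
          (\<lambda>f\<in>sects (str_sheaf K) U. pull \<psi> (preim M \<phi> (preim N \<xi> U)) (pull (comp_morphism M N K \<xi> \<phi>) U f))"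
        using U preim_comp[OF \<phi>, of K \<xi> U] by (simp add: comp_morphism_def)
      also have "\<dots> = (\<lambda>f\<in>sects (str_sheaf K) U. pull \<psi> (preim M \<phi> (preim N \<xi> U))
          (pull \<phi> (preim N \<xi> U) (pull \<xi> U f)))"
        using U by (auto simp: comp_morphism_def)
      also have "\<dots> = pull (comp_morphism L N K \<xi> (comp_morphism L M N \<phi> \<psi>)) U"
        using U openin_preim[OF \<xi> U] graded_homD(1)[OF morphismD(3)[OF \<xi> U]]
        by (auto simp: comp_morphism_def)
      finally show ?thesis by simp
    qed (simp add: comp_morphism_def)
  qed
qed

context sheaf_of_graded_algebras
begin

lemma restr_closed: "\<lbrakk>openin X U; openin X V; V \<subseteq> U; s \<in> sects F U\<rbrakk> \<Longrightarrow> restr F U V s \<in> sects F V"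
  using graded_homD(1)[OF restr_hom] .

end

lemma Aut_group_group:
  assumes M: "sheaf_of_graded_algebras (body M) (str_sheaf M)"
  shows "group (Aut_group M)"
proof (rule groupI)
  note [simp] = Aut_group_def
  fix \<phi> \<psi> \<xi> assume \<phi>: "\<phi> \<in> carrier (Aut_group M)" and \<psi>: "\<psi> \<in> carrier (Aut_group M)"
  obtain \<phi>' where \<phi>': "morphism M M \<phi>" "morphism M M \<phi>'" 
      "comp_morphism M M M \<phi> \<phi>' = id_morphism M" "comp_morphism M M M \<phi>' \<phi> = id_morphism M"
    using \<phi> by (auto simp: Aut_def)
  obtain \<psi>' where \<psi>': "morphism M M \<psi>" "morphism M M \<psi>'" 
      "comp_morphism M M M \<psi> \<psi>' = id_morphism M" "comp_morphism M M M \<psi>' \<psi> = id_morphism M"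
    using \<psi> by (auto simp: Aut_def)
  have "comp_morphism M M M (comp_morphism M M M \<phi> \<psi>) (comp_morphism M M M \<psi>' \<phi>') = id_morphism M"
    if "morphism M M \<phi>" "morphism M M \<psi>" "morphism M M \<psi>'" "morphism M M \<phi>'"
      "comp_morphism M M M \<psi> \<psi>' = id_morphism M" "comp_morphism M M M \<phi> \<phi>' = id_morphism M" for \<phi> \<psi> \<phi>' \<psi>'
    using that comp_assoc[OF morphism_comp[OF that(1,2) M] that(3,4)] comp_assoc[OF that(1,2,3)]
      comp_id_right[OF that(1)] by metis
  from this[OF \<phi>'(1) \<psi>'(1,2) \<phi>'(2) \<psi>'(3) \<phi>'(3)] this[OF \<psi>'(2) \<phi>'(2) \<phi>'(1) \<psi>'(1) \<phi>'(4) \<psi>'(4)]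
  show "\<phi> \<otimes>\<^bsub>Aut_group M\<^esub> \<psi> \<in> carrier (Aut_group M)"
    using morphism_comp[OF \<phi>'(1) \<psi>'(1) M] morphism_comp[OF \<psi>'(2) \<phi>'(2) M] by (auto simp: Aut_def)
  show "\<one>\<^bsub>Aut_group M\<^esub> \<otimes>\<^bsub>Aut_group M\<^esub> \<phi> = \<phi>"
    using comp_id_left[OF \<phi>'(1)] by simp
  show "\<exists>\<eta>\<in>carrier (Aut_group M). \<eta> \<otimes>\<^bsub>Aut_group M\<^esub> \<phi> = \<one>\<^bsub>Aut_group M\<^esub>"
    using \<phi>' by (intro bexI[of _ \<phi>']) (auto simp: Aut_def)
  assume "\<xi> \<in> carrier (Aut_group M)"
  then show "\<phi> \<otimes>\<^bsub>Aut_group M\<^esub> \<psi> \<otimes>\<^bsub>Aut_group M\<^esub> \<xi> = \<phi> \<otimes>\<^bsub>Aut_group M\<^esub> (\<psi> \<otimes>\<^bsub>Aut_group M\<^esub> \<xi>)"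
    using comp_assoc[OF \<phi>'(1) \<psi>'(1), of M \<xi>] by (simp add: Aut_def)
next
  show "\<one>\<^bsub>Aut_group M\<^esub> \<in> carrier (Aut_group M)"
    using morphism_id[OF M] comp_id_left[OF morphism_id[OF M]] by (auto simp: Aut_group_def Aut_def)
qed

section \<open>Coefficients of sections\<close>

text \<open>The coefficients of a section over \<open>U\<close> with respect to odd coordinates on \<open>V\<close>, as functions on \<open>V \<inter> U\<close>.
With this notion the coefficients of a pullback, and their dependence on the germ alone, are
statements about sections.\<close>

definition local_coeff ::
  "('p, 's) supermanifold \<Rightarrow> 'p set \<Rightarrow> ('p set \<Rightarrow> 's \<Rightarrow> nat set \<Rightarrow> 'p \<Rightarrow> complex)
    \<Rightarrow> 'p set \<Rightarrow> 's \<Rightarrow> nat set \<Rightarrow> 'p \<Rightarrow> complex" where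
  "local_coeff M V \<tau> U f S = \<tau> (V \<inter> U) (restr (str_sheaf M) U (V \<inter> U) f) S"

lemma pull_coeff_eq_local_coeff:
  "pull_coeff M V \<tau> \<phi> U f S = local_coeff M V \<tau> (preim M \<phi> U) (pull \<phi> U f) S"
  by (simp add: pull_coeff_def local_coeff_def)

lemma pull_coeff_comp:
  assumes "morphism M M \<psi>" "openin (body M) U" "f \<in> sects (str_sheaf M) U"
  shows "pull_coeff M V \<tau> (comp_morphism M M M \<phi> \<psi>) U f S =
    pull_coeff M V \<tau> \<psi> (preim M \<phi> U) (pull \<phi> U f) S"
  unfolding pull_coeff_def preim_comp[OF assms(1)] using assms by (simp add: comp_morphism_def)

lemma trivializationD:
  assumes "trivialization m n M U \<tau>"
  shows "openin (body M) U"
    and "\<lbrakk>openin (body M) V; V \<subseteq> U\<rbrakk> \<Longrightarrow> \<tau> V \<in> graded_hom (sections (str_sheaf M) V) (part (str_sheaf M) V)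
       (sections (split_sheaf m n (atlas M)) V) (part (split_sheaf m n (atlas M)) V)"
    and "\<lbrakk>openin (body M) V; V \<subseteq> U\<rbrakk> \<Longrightarrow> bij_betw (\<tau> V) (sects (str_sheaf M) V) (sects (split_sheaf m n (atlas M)) V)"
    and "\<lbrakk>openin (body M) V; openin (body M) W; W \<subseteq> V; V \<subseteq> U; s \<in> sects (str_sheaf M) V\<rbrakk> \<Longrightarrow>
       \<tau> W (restr (str_sheaf M) V W s) = restr (split_sheaf m n (atlas M)) V W (\<tau> V s)"
  using assms unfolding trivialization_def Let_def by blast+

context complex_supermanifold
begin

abbreviation "X \<equiv> body M"
abbreviation "\<O> \<equiv> str_sheaf M"

context
  fixes V \<tau> U x
  assumes triv: "trivialization m n M V \<tau>" and U: "openin X U" and x: "x \<in> V \<inter> U"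
begin

lemma openin_VU: "openin X (V \<inter> U)"
  using trivializationD(1)[OF triv] U by blast

lemma VU_hom: "\<tau> (V \<inter> U) \<in> graded_hom (sections \<O> (V \<inter> U)) (part \<O> (V \<inter> U))
       (sections (split_sheaf m n (atlas M)) (V \<inter> U)) (part (split_sheaf m n (atlas M)) (V \<inter> U))"
  using trivializationD(2)[OF triv openin_VU] by blast

lemma VU_restr: "restr \<O> U (V \<inter> U) \<in> graded_hom (sections \<O> U) (part \<O> U) (sections \<O> (V \<inter> U)) (part \<O> (V \<inter> U))"
  by (rule restr_hom[OF U openin_VU]) auto

lemma local_coeff_add:
  assumes "f \<in> sects \<O> U" "g \<in> sects \<O> U" "S \<subseteq> {..<n}"
  shows "local_coeff M V \<tau> U (f \<oplus>\<^bsub>sections \<O> U\<^esub> g) S x = local_coeff M V \<tau> U f S x + local_coeff M V \<tau> U g S x"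
  using assms x graded_homD(1,3)[OF VU_restr] graded_homD(3)[OF VU_hom]
  by (simp add: local_coeff_def) (simp add: split_sheaf_def)

lemma local_coeff_mult:
  assumes "f \<in> sects \<O> U" "g \<in> sects \<O> U" "S \<subseteq> {..<n}"
  shows "local_coeff M V \<tau> U (f \<otimes>\<^bsub>sections \<O> U\<^esub> g) S x =
     ext_mult (\<lambda>S. local_coeff M V \<tau> U f S x) (\<lambda>S. local_coeff M V \<tau> U g S x) S"
  using assms x graded_homD(1,2)[OF VU_restr] graded_homD(2)[OF VU_hom]
  by (simp add: local_coeff_def ext_mult_def) (simp add: split_sheaf_def)

lemma local_coeff_smult_one:
  assumes "S \<subseteq> {..<n}"
  shows "local_coeff M V \<tau> U (a \<odot>\<^bsub>sections \<O> U\<^esub> \<one>\<^bsub>sections \<O> U\<^esub>) S x = (if S = {} then a else 0)"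
  using assms x graded_homD(1,4,5)[OF VU_restr] graded_homD(4,5)[OF VU_hom]
    graded_algebra_closed(3)[OF sections_algebra[OF U]] graded_algebra_closed(3)[OF sections_algebra[OF openin_VU]]
  by (simp add: local_coeff_def) (simp add: split_sheaf_def)

lemma local_coeff_odd:
  assumes "f \<in> part \<O> U 1"
  shows "local_coeff M V \<tau> U f {} x = 0"
  using graded_homD(6)[OF VU_hom graded_homD(6)[OF VU_restr assms]] x
  by (auto simp: local_coeff_def split_sheaf_def)

lemma local_coeff_restr:
  assumes W: "openin X W" "W \<subseteq> U" "x \<in> W" and f: "f \<in> sects \<O> U" and S: "S \<subseteq> {..<n}"
  shows "local_coeff M V \<tau> W (restr \<O> U W f) S x = local_coeff M V \<tau> U f S x"
proof -
  have VW: "openin X (V \<inter> W)" using trivializationD(1)[OF triv] W by blast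
  have f': "restr \<O> U (V \<inter> U) f \<in> sects \<O> (V \<inter> U)" by (rule graded_homD(1)[OF VU_restr f])
  have "restr \<O> W (V \<inter> W) (restr \<O> U W f) = restr \<O> U (V \<inter> W) f"
    by (rule restr_trans[OF U W(1) VW _ W(2) f]) auto
  also have "\<dots> = restr \<O> (V \<inter> U) (V \<inter> W) (restr \<O> U (V \<inter> U) f)"
    by (rule restr_trans[OF U openin_VU VW _ _ f, symmetric]) (use W in auto)
  finally have "\<tau> (V \<inter> W) (restr \<O> W (V \<inter> W) (restr \<O> U W f)) =
      restr (split_sheaf m n (atlas M)) (V \<inter> U) (V \<inter> W) (\<tau> (V \<inter> U) (restr \<O> U (V \<inter> U) f))"
    using trivializationD(4)[OF triv openin_VU VW _ _ f'] W by auto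
  then show ?thesis
    using S W x by (simp add: local_coeff_def) (simp add: split_sheaf_def)
qed

end

end

section \<open>Holomorphic functions in charts\<close>

lemma holo_chartD:
  assumes "holo_chart m X A (U, c)"
  shows "openin X U" and "openin (top_of_set (cspace m)) (c ` U)"
    and "homeomorphic_map (subtopology X U) (top_of_set (c ` U)) c"
    and "(U', d) \<in> A \<Longrightarrow> holo_map m (c ` (U \<inter> U')) (d \<circ> inv_into U c)"
    and "(U', d) \<in> A \<Longrightarrow> holo_map m (d ` (U \<inter> U')) (c \<circ> inv_into U' d)"
  using assms by (auto simp: holo_chart_def holo_compatible_def)

lemma holo_chart_inj:
  assumes "holo_chart m X A (U, c)"
  shows "inj_on c U"
  using homeomorphic_imp_injective_map[OF holo_chartD(3)[OF assms]] openin_subset[OF holo_chartD(1)[OF assms]]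
  by (simp add: inf_absorb2)

lemma holo_chart_continuous:
  assumes "holo_chart m X A (U, c)"
  shows "continuous_map (subtopology X U) (top_of_set (c ` U)) c"
  using homeomorphic_imp_continuous_map[OF holo_chartD(3)[OF assms]] .

lemma holo_chart_image_cspace:
  assumes "holo_chart m X A (U, c)" "V \<subseteq> U"
  shows "c ` V \<subseteq> cspace m"
  using openin_subset[OF holo_chartD(2)[OF assms(1)]] assms(2) by auto

lemma holo_chart_openin_image:
  assumes c: "holo_chart m X A (U, c)" and V: "openin X V" "V \<subseteq> U"
  shows "openin (top_of_set (cspace m)) (c ` V)"
proof -
  have "openin (subtopology X U) V"
    using V holo_chartD(1)[OF c] by (simp add: openin_open_subtopology)
  then have "openin (top_of_set (c ` U)) (c ` V)"
    using homeomorphic_imp_open_map[OF holo_chartD(3)[OF c]] by (simp add: open_map_def)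
  then have "openin (subtopology (top_of_set (cspace m)) (c ` U)) (c ` V)"
    using holo_chart_image_cspace[OF c order_refl] by (simp add: subtopology_subtopology inf_absorb2)
  then show ?thesis using holo_chartD(2)[OF c] by (simp add: openin_open_subtopology)
qed

lemma holo_chart_openin_preimage:
  assumes c: "holo_chart m X A (U, c)" and D: "openin (top_of_set (cspace m)) D"
  shows "openin X {x \<in> U. c x \<in> D}"
proof -
  obtain G where G: "open G" "D = cspace m \<inter> G" using D by (auto simp: openin_open)
  have "openin (top_of_set (c ` U)) (c ` U \<inter> G)" using G by (auto simp: openin_open)
  from openin_continuous_map_preimage[OF holo_chart_continuous[OF c] this]
  have "openin (subtopology X U) {x \<in> topspace (subtopology X U). c x \<in> c ` U \<inter> G}" .
  moreover have "{x \<in> topspace (subtopology X U). c x \<in> c ` U \<inter> G} = {x \<in> U. c x \<in> D}"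
    using openin_subset[OF holo_chartD(1)[OF c]] holo_chart_image_cspace[OF c order_refl] G by auto
  ultimately show ?thesis using holo_chartD(1)[OF c] by (simp add: openin_open_subtopology)
qed

lemma holo_chart_restrict:
  assumes c: "holo_chart m X A (U, c)" and V: "openin X V" "V \<subseteq> U"
  shows "holo_chart m X A (V, c)"
proof -
  have inj: "inj_on c U" by (rule holo_chart_inj[OF c])
  have injV: "inj_on c V" using inj V by (meson inj_on_subset)
  have "homeomorphic_map (subtopology (subtopology X U) V) (subtopology (top_of_set (c ` U)) (c ` V)) c"
    by (rule homeomorphic_map_subtopologies_alt[OF holo_chartD(3)[OF c]])
       (use V inj openin_subset[OF V(1)] in \<open>auto simp: inj_on_def\<close>)
  moreover have "subtopology (subtopology X U) V = subtopology X V"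
    "subtopology (top_of_set (c ` U)) (c ` V) = top_of_set (c ` V)"
    using V by (auto simp: subtopology_subtopology inf_absorb2 image_mono)
  moreover have "holo_compatible m (V, c) (U', d)" if "(U', d) \<in> A" for U' d
  proof -
    have "holo m (c ` (V \<inter> U')) (\<lambda>z. (d \<circ> inv_into V c) z i)" if "i < m" for i
    proof -
      have "holo m (c ` (V \<inter> U')) (\<lambda>z. (d \<circ> inv_into U c) z i)"
      proof (rule holo_subset)
        show "holo m (c ` (U \<inter> U')) (\<lambda>z. (d \<circ> inv_into U c) z i)"
          using holo_chartD(4)[OF c \<open>(U', d) \<in> A\<close>] that by (simp add: holo_map_def)
      qed (use V in auto)
      moreover have "inv_into V c z = inv_into U c z" if "z \<in> c ` (V \<inter> U')" for z
        using that V inj injV by auto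
      ultimately show ?thesis by (subst holo_cong) auto
    qed
    moreover have "holo m (d ` (V \<inter> U')) (\<lambda>z. (c \<circ> inv_into U' d) z i)" if "i < m" for i
    proof (rule holo_subset)
      show "holo m (d ` (U \<inter> U')) (\<lambda>z. (c \<circ> inv_into U' d) z i)"
        using holo_chartD(5)[OF c \<open>(U', d) \<in> A\<close>] that by (simp add: holo_map_def)
    qed (use V in auto)
    ultimately show ?thesis by (auto simp: holo_compatible_def holo_map_def)
  qed
  ultimately show ?thesis
    using V holo_chart_openin_image[OF c V] by (auto simp: holo_chart_def)
qed

context complex_manifold
begin

text \<open>Holomorphy is defined by means of the charts of the atlas; near each point, composition with a
transition map carries it over to the chart \<open>c\<close>.\<close>

lemma holo_function_in_chart:
  assumes c: "holo_chart m X A (U, c)" and V: "openin X V" "V \<subseteq> U"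
    and f: "f \<in> holo_functions m A V"
  shows "holo m (c ` V) (f \<circ> inv_into U c)"
proof (rule holo_local)
  have inj: "inj_on c U" by (rule holo_chart_inj[OF c])
  fix z assume "z \<in> c ` V"
  then obtain x where x: "x \<in> V" "z = c x" by auto
  then have "x \<in> topspace X" using openin_subset[OF V(1)] by auto
  then obtain C where "C \<in> A" "x \<in> fst C" using atlas_covers by blast
  then obtain U' d where d: "(U', d) \<in> A" "x \<in> U'" by (cases C) auto
  have dc: "holo_chart m X A (U', d)" by (rule atlas_charts[OF d(1)])
  have "openin X (V \<inter> U')" using V holo_chartD(1)[OF dc] by blast
  from holo_chart_openin_image[OF c this] V
  obtain G where G: "open G" "c ` (V \<inter> U') = cspace m \<inter> G" by (auto simp: openin_open)
  have VG: "c ` V \<inter> G = c ` (V \<inter> U')"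
    using G(2) holo_chart_image_cspace[OF c V(2)] by blast
  have inv: "inv_into U c (c y) = y" if "y \<in> V" for y using that V inj by auto
  have invd: "inv_into U' d (d y) = y" if "y \<in> U'" for y using that holo_chart_inj[OF dc] by auto
  have "holo m (c ` (V \<inter> U')) (\<lambda>z. (f \<circ> inv_into U' d) ((d \<circ> inv_into U c) z))"
  proof (rule holo_compose[where E = "d ` (U' \<inter> V)" and f = "f \<circ> inv_into U' d" and g = "d \<circ> inv_into U c"])
    show "c ` (V \<inter> U') \<subseteq> cspace m" using G by auto
    show "d ` (U' \<inter> V) \<subseteq> cspace m" by (rule holo_chart_image_cspace[OF dc]) auto
    show "holo m (d ` (U' \<inter> V)) (f \<circ> inv_into U' d)"
      using f d(1) by (auto simp: holo_functions_def)
    show "holo_map m (c ` (V \<inter> U')) (d \<circ> inv_into U c)"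
      using holo_chartD(4)[OF c d(1)] V unfolding holo_map_def
      by (meson holo_subset image_mono inf_mono order_refl)
    show "(d \<circ> inv_into U c) ` c ` (V \<inter> U') \<subseteq> d ` (U' \<inter> V)"
      using inv by auto
  qed
  moreover have "(f \<circ> inv_into U' d) ((d \<circ> inv_into U c) z) = (f \<circ> inv_into U c) z"
    if "z \<in> c ` (V \<inter> U')" for z
    using that inv invd by auto
  ultimately have "holo m (c ` V \<inter> G) (f \<circ> inv_into U c)"
    unfolding VG by (subst holo_cong[symmetric]) auto
  then show "\<exists>G. open G \<and> z \<in> G \<and> holo m (c ` V \<inter> G) (f \<circ> inv_into U c)"
    using G x VG d(2) by blast
qed

lemma holo_function_of_chart:
  assumes c: "holo_chart m X A (U, c)" and V: "V \<subseteq> U" and g: "holo m (c ` V) g"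
  shows "(\<lambda>x\<in>V. g (c x)) \<in> holo_functions m A V"
proof -
  have "holo m (d ` (U' \<inter> V)) ((\<lambda>x\<in>V. g (c x)) \<circ> inv_into U' d)" if d: "(U', d) \<in> A" for U' d
  proof -
    have dc: "holo_chart m X A (U', d)" by (rule atlas_charts[OF d])
    have invd: "inv_into U' d (d y) = y" if "y \<in> U'" for y using that holo_chart_inj[OF dc] by auto
    have "holo m (d ` (U' \<inter> V)) (\<lambda>z. g ((c \<circ> inv_into U' d) z))"
    proof (rule holo_compose[OF _ _ g])
      show "d ` (U' \<inter> V) \<subseteq> cspace m" by (rule holo_chart_image_cspace[OF dc]) auto
      show "c ` V \<subseteq> cspace m" by (rule holo_chart_image_cspace[OF c V])
      have "d ` (U' \<inter> V) \<subseteq> d ` (U \<inter> U')" using V by auto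
      then show "holo_map m (d ` (U' \<inter> V)) (c \<circ> inv_into U' d)"
        using holo_chartD(5)[OF c d] unfolding holo_map_def by (meson holo_subset)
      show "(c \<circ> inv_into U' d) ` d ` (U' \<inter> V) \<subseteq> c ` V" using invd by auto
    qed
    then show ?thesis by (subst holo_cong) (use invd in auto)
  qed
  then show ?thesis by (auto simp: holo_functions_def)
qed

lemma holo_function_continuous:
  assumes c: "holo_chart m X A (U, c)" and V: "openin X V" "V \<subseteq> U"
    and f: "f \<in> holo_functions m A V"
  shows "continuous_map (subtopology X V) euclidean f"
proof -
  have "continuous_map (top_of_set (c ` V)) euclidean (f \<circ> inv_into U c)"
    using holo_continuous_on[OF holo_chart_image_cspace[OF c V(2)] holo_function_in_chart[OF c V f]] by simp
  moreover have "continuous_map (subtopology X V) (top_of_set (c ` V)) c"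
    by (rule holo_chart_continuous[OF holo_chart_restrict[OF c V]])
  ultimately have "continuous_map (subtopology X V) euclidean ((f \<circ> inv_into U c) \<circ> c)"
    by (rule continuous_map_compose[rotated])
  then show ?thesis
    by (rule continuous_map_eq) (use holo_chart_inj[OF c] V in \<open>auto simp: inv_into_f_f subset_iff\<close>)
qed

end

section \<open>Sections with prescribed coefficients\<close>

text \<open>The section \<open>\<Sum>S. G S(z) \<theta>\<^sup>S\<close> in the coordinates \<open>z = c\<close> and \<open>\<theta>\<close>.\<close>

definition family_section ::
  "('p, 's) supermanifold \<Rightarrow> nat \<Rightarrow> ('p \<Rightarrow> nat \<Rightarrow> complex) \<Rightarrow> ('p set \<Rightarrow> 's \<Rightarrow> nat set \<Rightarrow> 'p \<Rightarrow> complex)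
    \<Rightarrow> 'p set \<Rightarrow> (nat set \<Rightarrow> (nat \<Rightarrow> complex) \<Rightarrow> complex) \<Rightarrow> 's" where
  "family_section M n c \<tau> U G =
     inv_into (sects (str_sheaf M) U) (\<tau> U) (\<lambda>S\<in>Pow {..<n}. \<lambda>x\<in>U. G S (c x))"

context complex_supermanifold
begin

lemma coordinates_exist:
  assumes x: "x \<in> topspace X"
  obtains V c \<tau> where "coordinate_system m n M V c \<tau>" "x \<in> V"
proof -
  obtain U \<tau> where U: "x \<in> U" "trivialization m n M U \<tau>" using locally_split[OF x] by blast
  obtain C where "C \<in> atlas M" "x \<in> fst C" using atlas_covers x by blast
  then obtain W c where W: "(W, c) \<in> atlas M" "x \<in> W" by (cases C) auto
  have c: "holo_chart m X (atlas M) (W, c)" by (rule atlas_charts[OF W(1)])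
  have opn: "openin X (U \<inter> W)" using trivializationD(1)[OF U(2)] holo_chartD(1)[OF c] by blast
  have "holo_chart m X (atlas M) (U \<inter> W, c)" by (rule holo_chart_restrict[OF c opn]) auto
  moreover have "trivialization m n M (U \<inter> W) \<tau>"
    unfolding trivialization_def Let_def
  proof (intro conjI allI impI ballI)
    show "openin X (U \<inter> W)" by (rule opn)
    fix V' assume "openin X V' \<and> V' \<subseteq> U \<inter> W"
    then have V': "openin X V'" "V' \<subseteq> U" by auto
    from trivializationD(2,3)[OF U(2) V']
    show "\<tau> V' \<in> graded_hom (sections \<O> V') (part \<O> V')
       (sections (split_sheaf m n (atlas M)) V') (part (split_sheaf m n (atlas M)) V')"
      and "bij_betw (\<tau> V') (sects \<O> V') (sects (split_sheaf m n (atlas M)) V')" .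
  next
    fix V' W' s assume "openin X V' \<and> openin X W' \<and> W' \<subseteq> V' \<and> V' \<subseteq> U \<inter> W" "s \<in> sects \<O> V'"
    then show "\<tau> W' (restr \<O> V' W' s) = restr (split_sheaf m n (atlas M)) V' W' (\<tau> V' s)"
      using trivializationD(4)[OF U(2)] by simp
  qed
  ultimately show ?thesis using that U W by (auto simp: coordinate_system_def)
qed

context
  fixes V c \<tau>
  assumes cs: "coordinate_system m n M V c \<tau>"
begin

lemma chart: "holo_chart m X (atlas M) (V, c)"
  and triv: "trivialization m n M V \<tau>"
  using cs by (auto simp: coordinate_system_def)

abbreviation "sec U G \<equiv> family_section M n c \<tau> U G"

context
  fixes U assumes U: "openin X U" "U \<subseteq> V"
begin

lemma family_in_split:
  assumes G: "holo_fam m n (c ` U) G"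
  shows "(\<lambda>S\<in>Pow {..<n}. \<lambda>x\<in>U. G S (c x)) \<in> sects (split_sheaf m n (atlas M)) U"
  using holo_function_of_chart[OF chart U(2)] G
  by (auto simp: split_sheaf_def holo_fam_def PiE_def Pi_def)

lemma family_section:
  assumes G: "holo_fam m n (c ` U) G"
  shows "sec U G \<in> sects \<O> U" and "\<tau> U (sec U G) = (\<lambda>S\<in>Pow {..<n}. \<lambda>x\<in>U. G S (c x))"
  using family_in_split[OF G] trivializationD(3)[OF triv U]
  by (auto simp: family_section_def bij_betw_def inv_into_into f_inv_into_f)

lemma family_sectionI:
  assumes s: "s \<in> sects \<O> U" and eq: "\<And>S x. \<lbrakk>S \<subseteq> {..<n}; x \<in> U\<rbrakk> \<Longrightarrow> \<tau> U s S x = G S (c x)"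
  shows "s = sec U G"
proof -
  have "\<tau> U s \<in> sects (split_sheaf m n (atlas M)) U"
    using trivializationD(3)[OF triv U] s by (auto simp: bij_betw_def)
  then have "\<tau> U s = (\<lambda>S\<in>Pow {..<n}. \<lambda>x\<in>U. G S (c x))"
    using eq by (fastforce simp: split_sheaf_def holo_functions_def PiE_def extensional_def)
  then have "sec U G = inv_into (sects \<O> U) (\<tau> U) (\<tau> U s)"
    by (simp only: family_section_def)
  also have "\<dots> = s"
    by (rule inv_into_f_f[OF bij_betw_imp_inj_on[OF trivializationD(3)[OF triv U]] s])
  finally show ?thesis by (rule sym)
qed

lemma family_section_add:
  assumes "holo_fam m n (c ` U) G" "holo_fam m n (c ` U) H"
  shows "sec U (\<lambda>S z. G S z + H S z) = sec U G \<oplus>\<^bsub>sections \<O> U\<^esub> sec U H"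
proof (rule family_sectionI[symmetric])
  show "sec U G \<oplus>\<^bsub>sections \<O> U\<^esub> sec U H \<in> sects \<O> U"
    using graded_algebra_closed(2)[OF sections_algebra[OF U(1)]] family_section(1) assms by blast
  show "\<tau> U (sec U G \<oplus>\<^bsub>sections \<O> U\<^esub> sec U H) S x = G S (c x) + H S (c x)"
    if "S \<subseteq> {..<n}" "x \<in> U" for S x
    using that graded_homD(3)[OF trivializationD(2)[OF triv U] family_section(1)[OF assms(1)] family_section(1)[OF assms(2)]]
      family_section(2)[OF assms(1)] family_section(2)[OF assms(2)]
    by (simp add: split_sheaf_def)
qed

lemma family_section_mult:
  assumes "holo_fam m n (c ` U) G" "holo_fam m n (c ` U) H"
  shows "sec U (fam_mult G H) = sec U G \<otimes>\<^bsub>sections \<O> U\<^esub> sec U H"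
proof (rule family_sectionI[symmetric])
  show "sec U G \<otimes>\<^bsub>sections \<O> U\<^esub> sec U H \<in> sects \<O> U"
    using graded_algebra_closed(1)[OF sections_algebra[OF U(1)]] family_section(1) assms by blast
  show "\<tau> U (sec U G \<otimes>\<^bsub>sections \<O> U\<^esub> sec U H) S x = fam_mult G H S (c x)"
    if "S \<subseteq> {..<n}" "x \<in> U" for S x
  proof -
    have "\<tau> U (sec U G \<otimes>\<^bsub>sections \<O> U\<^esub> sec U H) S x =
      (\<Sum>T\<in>Pow S. ext_sign T (S - T) * \<tau> U (sec U G) T x * \<tau> U (sec U H) (S - T) x)"
      using that graded_homD(2)[OF trivializationD(2)[OF triv U] family_section(1)[OF assms(1)] family_section(1)[OF assms(2)]]
      by (simp add: split_sheaf_def)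
    also have "\<dots> = fam_mult G H S (c x)"
      unfolding fam_mult_def family_section(2)[OF assms(1)] family_section(2)[OF assms(2)]
      using that by (intro sum.cong) auto
    finally show ?thesis .
  qed
qed

lemma family_section_const: "sec U (even_fam (\<lambda>z. a)) = a \<odot>\<^bsub>sections \<O> U\<^esub> \<one>\<^bsub>sections \<O> U\<^esub>"
proof (rule family_sectionI[symmetric])
  note alg = graded_algebra_closed[OF sections_algebra[OF U(1)]]
  show "a \<odot>\<^bsub>sections \<O> U\<^esub> \<one>\<^bsub>sections \<O> U\<^esub> \<in> sects \<O> U" by (intro alg)
  show "\<tau> U (a \<odot>\<^bsub>sections \<O> U\<^esub> \<one>\<^bsub>sections \<O> U\<^esub>) S x = even_fam (\<lambda>z. a) S (c x)"
    if "S \<subseteq> {..<n}" "x \<in> U" for S x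
    using that graded_homD(4,5)[OF trivializationD(2)[OF triv U]] alg(3)
    by (simp add: split_sheaf_def even_fam_def)
qed

lemma family_section_restr:
  assumes G: "holo_fam m n (c ` U) G" and W: "openin X W" "W \<subseteq> U"
  shows "restr \<O> U W (sec U G) \<in> sects \<O> W"
    and "S \<subseteq> {..<n} \<Longrightarrow> x \<in> W \<Longrightarrow> \<tau> W (restr \<O> U W (sec U G)) S x = G S (c x)"
  using trivializationD(4)[OF triv U(1) W U(2) family_section(1)[OF G]] W
    restr_closed[OF U(1) W family_section(1)[OF G]] family_section(2)[OF G]
  by (auto simp: split_sheaf_def)

lemma holo_fam_even_coordinate: "holo_fam m n (c ` U) (even_fam (\<lambda>z. z i))"
  unfolding holo_fam_def even_fam_def
proof (intro allI impI)
  fix S :: "nat set"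
  show "holo m (c ` U) (\<lambda>z. if S = {} then z i else 0)"
    using holo_coordinate[OF holo_chart_image_cspace[OF chart U(2)], of i]
      holo_const[OF holo_chart_image_cspace[OF chart U(2)], of 0]
    by (cases "S = {}") simp_all
qed

lemma holo_fam_odd_coordinate: "holo_fam m n (c ` U) (odd_fam j)"
  using holo_const[OF holo_chart_image_cspace[OF chart U(2)]]
  by (auto simp: holo_fam_def odd_fam_def)

text \<open>The trivialization respects the decomposition of \<open>\<theta>\<^sub>j\<close> into an even and an odd part. The coefficients of
the even part vanish in odd degrees by parity, and in even degrees because those of \<open>\<theta>\<^sub>j\<close> and of the odd
part do.\<close>

lemma family_section_odd: "sec U (odd_fam j) \<in> part \<O> U 1"
proof -
  interpret alg: graded_algebra "sections \<O> U" "part \<O> U" by (rule sections_algebra[OF U(1)])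
  let ?s = "sec U (odd_fam j)"
  note hom = trivializationD(2)[OF triv U]
  obtain d where d: "fst d \<in> part \<O> U 0" "snd d \<in> part \<O> U 1" "?s = fst d \<oplus>\<^bsub>sections \<O> U\<^esub> snd d"
    using alg.part_decomp[OF family_section(1)[OF holo_fam_odd_coordinate]] by blast
  have dc: "fst d \<in> sects \<O> U" "snd d \<in> sects \<O> U"
    using d graded_algebra_part_subset[OF sections_algebra[OF U(1)]] by auto
  have "\<tau> U (snd d) S x = odd_fam j S (c x)" if S: "S \<subseteq> {..<n}" and x: "x \<in> U" for S x
  proof -
    have "\<tau> U ?s S x = \<tau> U (fst d) S x + \<tau> U (snd d) S x"
      unfolding d(3) using graded_homD(3)[OF hom dc] S x by (simp add: split_sheaf_def)
    then have sum: "odd_fam j S (c x) = \<tau> U (fst d) S x + \<tau> U (snd d) S x"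
      using family_section(2)[OF holo_fam_odd_coordinate] S x by simp
    have ev: "\<tau> U (fst d) S x = 0" if "of_nat (card S) \<noteq> (0 :: bit)"
      using graded_homD(6)[OF hom d(1)] that S x by (simp add: split_sheaf_def)
    have od: "\<tau> U (snd d) S x = 0" if "of_nat (card S) \<noteq> (1 :: bit)"
      using graded_homD(6)[OF hom d(2)] that S x by (simp add: split_sheaf_def)
    show ?thesis
    proof (cases "of_nat (card S) = (0 :: bit)")
      case True
      then have "odd_fam j S (c x) = 0" by (auto simp: odd_fam_def)
      moreover have "of_nat (card S) \<noteq> (1 :: bit)" using True by simp
      ultimately show ?thesis using od by simp
    next
      case False
      then show ?thesis using ev sum by simp
    qed
  qed
  then have "snd d = ?s" by (intro family_sectionI dc)
  then show ?thesis using d(2) by simp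
qed

end

end

end

section \<open>Pullbacks near a point\<close>

definition coordinate_sections ::
  "nat \<Rightarrow> nat \<Rightarrow> ('p, 's) supermanifold \<Rightarrow> 'p set \<Rightarrow> ('p \<Rightarrow> nat \<Rightarrow> complex)
    \<Rightarrow> ('p set \<Rightarrow> 's \<Rightarrow> nat set \<Rightarrow> 'p \<Rightarrow> complex) \<Rightarrow> 's set" where
  "coordinate_sections m n M V c \<tau> =
     (\<lambda>i. family_section M n c \<tau> V (even_fam (\<lambda>z. z i))) ` {..<m} \<union>
     (\<lambda>j. family_section M n c \<tau> V (odd_fam j)) ` {..<n}"

lemma finite_coordinate_sections: "finite (coordinate_sections m n M V c \<tau>)"
  by (simp add: coordinate_sections_def)

context complex_supermanifold
begin

abbreviation "pcoeff \<equiv> pull_coeff M"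

lemma family_section_cong:
  assumes "\<And>S x. \<lbrakk>S \<subseteq> {..<n}; x \<in> U\<rbrakk> \<Longrightarrow> G S (c x) = H S (c x)"
  shows "family_section M n c \<tau> U G = family_section M n c \<tau> U H"
proof -
  have "(\<lambda>S\<in>Pow {..<n}. \<lambda>x\<in>U. G S (c x)) = (\<lambda>S\<in>Pow {..<n}. \<lambda>x\<in>U. H S (c x))"
    using assms by (intro restrict_ext) auto
  then show ?thesis by (simp add: family_section_def)
qed

lemma family_section_restrict:
  assumes cs: "coordinate_system m n M V c \<tau>" and U: "openin X U" "U \<subseteq> V"
    and G: "holo_fam m n (c ` U) G" and W: "openin X W" "W \<subseteq> U"
  shows "restr \<O> U W (family_section M n c \<tau> U G) = family_section M n c \<tau> W G"
  by (rule family_sectionI[OF cs W(1) order_trans[OF W(2) U(2)]])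
    (use family_section_restr[OF cs U G W] in auto)

context
  fixes V \<tau> p \<psi> U
  assumes triv: "trivialization m n M V \<tau>" and p: "p \<in> V"
    and \<psi>: "morphism M M \<psi>" and U: "openin X U" "under \<psi> p \<in> U"
begin

lemma point_in_preim: "p \<in> V \<inter> preim M \<psi> U"
  using U p openin_subset[OF trivializationD(1)[OF triv]] by (auto simp: preim_def)

lemma pull_coeff_add:
  assumes "f \<in> sects \<O> U" "g \<in> sects \<O> U" "S \<subseteq> {..<n}"
  shows "pcoeff V \<tau> \<psi> U (f \<oplus>\<^bsub>sections \<O> U\<^esub> g) S p = pcoeff V \<tau> \<psi> U f S p + pcoeff V \<tau> \<psi> U g S p"
  using graded_homD(1,3)[OF morphismD(3)[OF \<psi> U(1)]] assms
    local_coeff_add[OF triv openin_preim[OF \<psi> U(1)] point_in_preim]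
  by (simp add: pull_coeff_eq_local_coeff)

lemma pull_coeff_mult:
  assumes "f \<in> sects \<O> U" "g \<in> sects \<O> U" "S \<subseteq> {..<n}"
  shows "pcoeff V \<tau> \<psi> U (f \<otimes>\<^bsub>sections \<O> U\<^esub> g) S p =
    ext_mult (\<lambda>S. pcoeff V \<tau> \<psi> U f S p) (\<lambda>S. pcoeff V \<tau> \<psi> U g S p) S"
  using graded_homD(1,2)[OF morphismD(3)[OF \<psi> U(1)]] assms
    local_coeff_mult[OF triv openin_preim[OF \<psi> U(1)] point_in_preim]
  by (simp add: pull_coeff_eq_local_coeff)

lemma pull_coeff_smult_one:
  assumes "S \<subseteq> {..<n}"
  shows "pcoeff V \<tau> \<psi> U (a \<odot>\<^bsub>sections \<O> U\<^esub> \<one>\<^bsub>sections \<O> U\<^esub>) S p = (if S = {} then a else 0)"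
  using graded_homD(4,5)[OF morphismD(3)[OF \<psi> U(1)]] assms
    local_coeff_smult_one[OF triv openin_preim[OF \<psi> U(1)] point_in_preim]
    graded_algebra_closed(3)[OF sections_algebra[OF U(1)]]
  by (simp add: pull_coeff_eq_local_coeff)

lemma pull_coeff_odd: "f \<in> part \<O> U 1 \<Longrightarrow> pcoeff V \<tau> \<psi> U f {} p = 0"
  using graded_homD(6)[OF morphismD(3)[OF \<psi> U(1)]]
    local_coeff_odd[OF triv openin_preim[OF \<psi> U(1)] point_in_preim]
  by (simp add: pull_coeff_eq_local_coeff)

lemma pull_coeff_restr:
  assumes W: "openin X W" "W \<subseteq> U" "under \<psi> p \<in> W" and f: "f \<in> sects \<O> U" and S: "S \<subseteq> {..<n}"
  shows "pcoeff V \<tau> \<psi> W (restr \<O> U W f) S p = pcoeff V \<tau> \<psi> U f S p"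
proof -
  have "p \<in> preim M \<psi> W" using W point_in_preim by (auto simp: preim_def)
  from local_coeff_restr[OF triv openin_preim[OF \<psi> U(1)] point_in_preim openin_preim[OF \<psi> W(1)]
    preim_mono[OF W(2)] this graded_homD(1)[OF morphismD(3)[OF \<psi> U(1)] f] S]
  show ?thesis
    unfolding pull_coeff_eq_local_coeff morphismD(6)[OF \<psi> U(1) W(1,2) f] .
qed

end

text \<open>If the constant term \<open>a\<close> of the pullback of \<open>z\<^sub>i\<close> at \<open>p\<close> were different from the value of \<open>z\<^sub>i\<close> at the
image of \<open>p\<close>, then \<open>z\<^sub>i - a\<close> would be invertible near that image, and so would its pullback, whose constant
term at \<open>p\<close> is \<open>0\<close>.\<close>

lemma pull_coeff_coordinate_empty:
  assumes triv: "trivialization m n M V \<tau>" and p: "p \<in> V" and \<psi>: "morphism M M \<psi>"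
    and cs: "coordinate_system m n M V' c \<tau>'" and \<psi>p: "under \<psi> p \<in> V'" and i: "i < m"
  shows "pcoeff V \<tau> \<psi> V' (family_section M n c \<tau>' V' (even_fam (\<lambda>z. z i))) {} p = c (under \<psi> p) i"
proof (rule ccontr)
  let ?sec = "family_section M n c \<tau>'"
  let ?z = "even_fam (\<lambda>z. z i)"
  note ch = chart[OF cs]
  define a where "a = pcoeff V \<tau> \<psi> V' (?sec V' ?z) {} p"
  assume "pcoeff V \<tau> \<psi> V' (?sec V' ?z) {} p \<noteq> c (under \<psi> p) i"
  then have a: "c (under \<psi> p) i \<noteq> a" by (simp add: a_def)
  define U where "U = {x \<in> V'. c x \<in> cspace m \<inter> {z. z i \<noteq> a}}"
  have "open {z :: nat \<Rightarrow> complex. z i \<noteq> a}"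
    by (intro open_Collect_neq continuous_intros) auto
  then have "openin (top_of_set (cspace m)) (cspace m \<inter> {z. z i \<noteq> a})" by (auto simp: openin_open)
  from holo_chart_openin_preimage[OF ch this] have U: "openin X U" by (simp add: U_def)
  have V': "openin X V'" by (rule holo_chartD(1)[OF ch])
  have UV: "U \<subseteq> V'" by (auto simp: U_def)
  have pU: "under \<psi> p \<in> U"
    using \<psi>p a holo_chart_image_cspace[OF ch order_refl] by (auto simp: U_def)
  have cU: "c ` U \<subseteq> cspace m" by (rule holo_chart_image_cspace[OF ch UV])
  have hz: "holo m (c ` U) (\<lambda>z. 0)" by (rule holo_const[OF cU])
  have hE: "holo_fam m n (c ` U) (even_fam g)" if "holo m (c ` U) g" for g
    unfolding holo_fam_def even_fam_def
  proof (intro allI impI)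
    fix S :: "nat set"
    show "holo m (c ` U) (\<lambda>z. if S = {} then g z else 0)" using that hz by (cases "S = {}") simp_all
  qed
  let ?g = "\<lambda>z :: nat \<Rightarrow> complex. z i + - a"
  have hg: "holo m (c ` U) ?g" by (intro holo_add cU holo_coordinate holo_const)
  have hi: "holo m (c ` U) (\<lambda>z. inverse (?g z))"
    by (rule holo_inverse[OF cU hg]) (auto simp: U_def)
  note sec = family_section(1)[OF cs U UV]
  note pc = triv p \<psi> U pU
  have "?sec U (fam_mult (even_fam ?g) (even_fam (\<lambda>z. inverse (?g z)))) = ?sec U (even_fam (\<lambda>z. 1))"
  proof (rule family_section_cong)
    fix S x assume S: "S \<subseteq> {..<n}" and x: "x \<in> U"
    have "fam_mult (even_fam ?g) (even_fam (\<lambda>z. inverse (?g z))) S (c x) =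
        even_fam (\<lambda>z. ?g z * inverse (?g z)) S (c x)"
      by (rule fam_mult_even) (use S finite_subset in blast)
    then show "fam_mult (even_fam ?g) (even_fam (\<lambda>z. inverse (?g z))) S (c x) = even_fam (\<lambda>z. 1) S (c x)"
      using x by (simp add: even_fam_def U_def)
  qed
  then have "?sec U (even_fam ?g) \<otimes>\<^bsub>sections \<O> U\<^esub> ?sec U (even_fam (\<lambda>z. inverse (?g z))) =
      1 \<odot>\<^bsub>sections \<O> U\<^esub> \<one>\<^bsub>sections \<O> U\<^esub>"
    using family_section_mult[OF cs U UV hE[OF hg] hE[OF hi]] family_section_const[OF cs U UV] by simp
  then have "ext_mult (\<lambda>S. pcoeff V \<tau> \<psi> U (?sec U (even_fam ?g)) S p)
      (\<lambda>S. pcoeff V \<tau> \<psi> U (?sec U (even_fam (\<lambda>z. inverse (?g z)))) S p) {} = 1"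
    using pull_coeff_mult[OF pc sec[OF hE[OF hg]] sec[OF hE[OF hi]], of "{}"]
      pull_coeff_smult_one[OF pc, of "{}" 1] by simp
  then have "pcoeff V \<tau> \<psi> U (?sec U (even_fam ?g)) {} p \<noteq> 0"
    by (auto simp: ext_mult_empty)
  moreover have "pcoeff V \<tau> \<psi> U (?sec U (even_fam ?g)) {} p = 0"
  proof -
    have "?sec U (even_fam ?g) = ?sec U (\<lambda>S z. ?z S z + even_fam (\<lambda>z. - a) S z)"
      by (rule family_section_cong) (simp add: even_fam_def)
    also have "\<dots> = ?sec U ?z \<oplus>\<^bsub>sections \<O> U\<^esub> ?sec U (even_fam (\<lambda>z. - a))"
      by (rule family_section_add[OF cs U UV]) (intro hE holo_coordinate holo_const cU)+
    finally have "pcoeff V \<tau> \<psi> U (?sec U (even_fam ?g)) {} p =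
        pcoeff V \<tau> \<psi> U (?sec U ?z) {} p + pcoeff V \<tau> \<psi> U (?sec U (even_fam (\<lambda>z. - a))) {} p"
      by (simp add: pull_coeff_add[OF pc] sec hE holo_coordinate holo_const cU)
    also have "pcoeff V \<tau> \<psi> U (?sec U (even_fam (\<lambda>z. - a))) {} p = - a"
      unfolding family_section_const[OF cs U UV] using pull_coeff_smult_one[OF pc, of "{}"] by simp
    also have "pcoeff V \<tau> \<psi> U (?sec U ?z) {} p = a"
    proof -
      note G = holo_fam_even_coordinate[OF cs V' order_refl, of i]
      have "restr \<O> V' U (?sec V' ?z) = ?sec U ?z"
        by (rule family_section_restrict[OF cs V' order_refl G U UV])
      then show ?thesis
        using pull_coeff_restr[OF triv p \<psi> V' \<psi>p U UV pU family_section(1)[OF cs V' order_refl G], of "{}"]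
        by (simp add: a_def)
    qed
    finally show ?thesis by simp
  qed
  ultimately show False by contradiction
qed

text \<open>The constant of \<open>fam_bound\<close> for superfunctions that involve all \<open>n\<close> odd coordinates.\<close>

definition pull_const :: "real \<Rightarrow> real \<Rightarrow> nat \<Rightarrow> real" where
  "pull_const R D k = (1 + of_nat m * 2 ^ n * 4 / R * D) ^ Suc k * (1 + 2 ^ n * D) ^ n"

definition chart_polydisc :: "'p set \<Rightarrow> ('p \<Rightarrow> nat \<Rightarrow> complex) \<Rightarrow> 'p \<Rightarrow> real \<Rightarrow> 'p set" where
  "chart_polydisc V c x r = {y \<in> V. c y \<in> polydisc m (c x) r}"

context
  fixes V' c \<tau>' x r
  assumes cs: "coordinate_system m n M V' c \<tau>'" and x: "x \<in> V'"
    and r: "r > 0" and sub: "polydisc m (c x) r \<subseteq> c ` V'"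
begin

lemma chart_polydisc_open: "openin X (chart_polydisc V' c x r)"
  unfolding chart_polydisc_def by (rule holo_chart_openin_preimage[OF chart[OF cs] polydisc_openin])

lemma chart_polydisc_subset: "chart_polydisc V' c x r \<subseteq> V'"
  by (auto simp: chart_polydisc_def)

lemma chart_polydisc_image: "c ` chart_polydisc V' c x r = polydisc m (c x) r"
  using sub by (auto simp: chart_polydisc_def)

lemma chart_center_cspace: "c x \<in> cspace m"
  using holo_chart_image_cspace[OF chart[OF cs] order_refl] x by auto

lemma chart_polydisc_center: "x \<in> chart_polydisc V' c x r"
  using x r chart_center_cspace by (simp add: chart_polydisc_def polydisc_def)

lemma pullback_ext_evaluation:
  assumes triv: "trivialization m n M V \<tau>" and p: "p \<in> V" and \<psi>: "morphism M M \<psi>"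
    and \<psi>p: "under \<psi> p = x"
  shows "ext_evaluation m n (c x) r
    (\<lambda>G S. pcoeff V \<tau> \<psi> (chart_polydisc V' c x r) (family_section M n c \<tau>' (chart_polydisc V' c x r) G) S p)"
proof -
  let ?U = "chart_polydisc V' c x r"
  let ?sec = "family_section M n c \<tau>' ?U"
  note UV = chart_polydisc_open chart_polydisc_subset
  have V': "openin X V'" by (rule holo_chartD(1)[OF chart[OF cs]])
  have pU: "under \<psi> p \<in> ?U" "under \<psi> p \<in> V'" using \<psi>p chart_polydisc_center x by simp_all
  note pc = triv p \<psi> UV(1) pU(1)
  note fam = holo_fam_even_coordinate[OF cs V' order_refl] holo_fam_odd_coordinate[OF cs V' order_refl]
  have restr: "pcoeff V \<tau> \<psi> ?U (?sec G) S p = pcoeff V \<tau> \<psi> V' (family_section M n c \<tau>' V' G) S p"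
    if "holo_fam m n (c ` V') G" "S \<subseteq> {..<n}" for G S
    using pull_coeff_restr[OF triv p \<psi> V' pU(2) UV pU(1) family_section(1)[OF cs V' order_refl that(1)] that(2)]
      family_section_restrict[OF cs V' order_refl that(1) UV] by simp
  show ?thesis
  proof
    show "c x \<in> cspace m" by (rule chart_center_cspace)
    show "r > 0" by (rule r)
    show "(\<lambda>S. pcoeff V \<tau> \<psi> ?U (?sec F) S p) = (\<lambda>S. pcoeff V \<tau> \<psi> ?U (?sec G) S p)"
      if "\<And>S z. \<lbrakk>S \<subseteq> {..<n}; z \<in> polydisc m (c x) r\<rbrakk> \<Longrightarrow> F S z = G S z" for F G
      using family_section_cong[of ?U F c G \<tau>'] that by (simp add: chart_polydisc_def)
    fix F G S
    assume *: "holo_fam m n (polydisc m (c x) r) F" "holo_fam m n (polydisc m (c x) r) G" and S: "S \<subseteq> {..<n}"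
    note FG = *[folded chart_polydisc_image]
    show "pcoeff V \<tau> \<psi> ?U (?sec (\<lambda>S z. F S z + G S z)) S p =
        pcoeff V \<tau> \<psi> ?U (?sec F) S p + pcoeff V \<tau> \<psi> ?U (?sec G) S p"
      unfolding family_section_add[OF cs UV FG]
      by (rule pull_coeff_add[OF pc family_section(1)[OF cs UV FG(1)] family_section(1)[OF cs UV FG(2)] S])
    show "pcoeff V \<tau> \<psi> ?U (?sec (fam_mult F G)) S p =
        ext_mult (\<lambda>S. pcoeff V \<tau> \<psi> ?U (?sec F) S p) (\<lambda>S. pcoeff V \<tau> \<psi> ?U (?sec G) S p) S"
      unfolding family_section_mult[OF cs UV FG]
      by (rule pull_coeff_mult[OF pc family_section(1)[OF cs UV FG(1)] family_section(1)[OF cs UV FG(2)] S])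
  next
    fix S a assume S: "S \<subseteq> {..<n}"
    show "pcoeff V \<tau> \<psi> ?U (?sec (even_fam (\<lambda>z. a))) S p = (if S = {} then a else 0)"
      unfolding family_section_const[OF cs UV] by (rule pull_coeff_smult_one[OF pc S])
  next
    fix i assume "i < m"
    then show "pcoeff V \<tau> \<psi> ?U (?sec (even_fam (\<lambda>z. z i))) {} p = c x i"
      using restr[OF fam(1)] pull_coeff_coordinate_empty[OF triv p \<psi> cs pU(2)] \<psi>p by simp
  next
    fix j assume "j < n"
    show "pcoeff V \<tau> \<psi> ?U (?sec (odd_fam j)) {} p = 0"
      by (rule pull_coeff_odd[OF pc family_section_odd[OF cs UV]])
  qed
qed

text \<open>The morphism \<open>\<psi>\<close> enters only through the bounds \<open>D\<close> and \<open>D'\<close> on the pullbacks of the coordinates; this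
makes the estimate uniform for all morphisms that satisfy them. The condition \<open>S \<noteq> {}\<close> in these
bounds leaves out the constant terms, which are the coordinates of the image point for the even
coordinates and vanish for the odd ones.\<close>

lemma pull_coeff_bound:
  assumes triv: "trivialization m n M V \<tau>" and p: "p \<in> V" and \<psi>: "morphism M M \<psi>"
    and \<psi>p: "under \<psi> p = x"
    and D: "D \<ge> 1" "D' \<ge> 0"
    and lower: "\<And>s S. \<lbrakk>s \<in> coordinate_sections m n M V' c \<tau>'; S \<subseteq> {..<n}; S \<noteq> {}; card S \<le> k\<rbrakk> \<Longrightarrow>
      cmod (pcoeff V \<tau> \<psi> V' s S p) \<le> D"
    and upper: "\<And>s S. \<lbrakk>s \<in> coordinate_sections m n M V' c \<tau>'; S \<subseteq> {..<n}; S \<noteq> {}; card S \<le> Suc k\<rbrakk> \<Longrightarrow>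
      cmod (pcoeff V \<tau> \<psi> V' s S p) \<le> D'"
    and U: "openin X U" "chart_polydisc V' c x r \<subseteq> U" and f: "f \<in> sects \<O> U"
    and B: "\<And>S y. \<lbrakk>S \<subseteq> {..<n}; y \<in> chart_polydisc V' c x r\<rbrakk> \<Longrightarrow> cmod (local_coeff M V' \<tau>' U f S y) \<le> B"
    and S: "S \<subseteq> {..<n}" "card S \<le> Suc k"
  shows "cmod (pcoeff V \<tau> \<psi> U f S p) \<le> pull_const r D k * (1 + D') * B"
proof -
  let ?P = "chart_polydisc V' c x r"
  let ?E = "\<lambda>G S. pcoeff V \<tau> \<psi> ?P (family_section M n c \<tau>' ?P G) S p"
  interpret ev: ext_evaluation m n "c x" r ?E
    by (rule pullback_ext_evaluation[OF triv p \<psi> \<psi>p])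
  note P = chart_polydisc_open chart_polydisc_subset
  note ch = chart[OF cs]
  have tr: "trivialization m n M V' \<tau>'" using cs by (simp add: coordinate_system_def)
  have V': "openin X V'" by (rule holo_chartD(1)[OF ch])
  have pU: "under \<psi> p \<in> ?P" "under \<psi> p \<in> V'" "under \<psi> p \<in> U"
    using \<psi>p chart_polydisc_center x U by auto
  note fam = holo_fam_even_coordinate[OF cs V' order_refl] holo_fam_odd_coordinate[OF cs V' order_refl]
  have restr: "?E G S = pcoeff V \<tau> \<psi> V' (family_section M n c \<tau>' V' G) S p"
    if "holo_fam m n (c ` V') G" "S \<subseteq> {..<n}" for G S
    using pull_coeff_restr[OF assms(1) p \<psi> V' pU(2) P pU(1) family_section(1)[OF cs V' order_refl that(1)] that(2)]
      family_section_restrict[OF cs V' order_refl that(1) P] by simp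
  have nil: "bounded_upto n l (ev.nil_coord i) C"
    if "i < m" "0 \<le> C" "\<And>S. \<lbrakk>S \<subseteq> {..<n}; S \<noteq> {}; card S \<le> l\<rbrakk> \<Longrightarrow>
      cmod (pcoeff V \<tau> \<psi> V' (family_section M n c \<tau>' V' (even_fam (\<lambda>z. z i))) S p) \<le> C" for i l C
    unfolding bounded_upto_def
  proof (intro allI impI)
    fix S assume "S \<subseteq> {..<n}" "card S \<le> l"
    then show "cmod (ev.nil_coord i S) \<le> C"
      using that ev.nil_coord_empty[of i] restr[OF fam(1)]
      by (cases "S = {}") (auto simp: ev.nil_coord_def)
  qed
  have od: "bounded_upto n l (?E (odd_fam j)) C"
    if "j < n" "0 \<le> C" "\<And>S. \<lbrakk>S \<subseteq> {..<n}; S \<noteq> {}; card S \<le> l\<rbrakk> \<Longrightarrow>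
      cmod (pcoeff V \<tau> \<psi> V' (family_section M n c \<tau>' V' (odd_fam j)) S p) \<le> C" for j l C
    unfolding bounded_upto_def
  proof (intro allI impI)
    fix S assume "S \<subseteq> {..<n}" "card S \<le> l"
    then show "cmod (?E (odd_fam j) S) \<le> C"
      using that ev.E_odd[OF that(1)] restr[OF fam(2)]
      by (cases "S = {}") auto
  qed
  define g where "g = restr \<O> U ?P f"
  have g: "g \<in> sects \<O> ?P" unfolding g_def by (rule restr_closed[OF U(1) P(1) U(2) f])
  define G where "G = (\<lambda>S z. \<tau>' ?P g S (inv_into V' c z))"
  have split: "\<tau>' ?P g \<in> sects (split_sheaf m n (atlas M)) ?P"
    using trivializationD(3)[OF tr P] g by (auto simp: bij_betw_def)
  have hG: "holo_fam m n (polydisc m (c x) r) G"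
    unfolding holo_fam_def
  proof (intro allI impI)
    fix S assume "S \<subseteq> {..<n}"
    then have "\<tau>' ?P g S \<in> holo_functions m (atlas M) ?P"
      using split by (auto simp: split_sheaf_def)
    from holo_function_in_chart[OF ch P this]
    show "holo m (polydisc m (c x) r) (G S)"
      unfolding chart_polydisc_image by (simp add: G_def o_def)
  qed
  have Gc: "G S (c y) = \<tau>' ?P g S y" if "y \<in> ?P" for S y
    using that P(2) holo_chart_inj[OF ch] by (auto simp: G_def)
  have gG: "g = family_section M n c \<tau>' ?P G"
    by (rule family_sectionI[OF cs P g]) (simp add: Gc)
  have GB: "cmod (G S z) \<le> B" if S: "S \<subseteq> {..<n}" and z: "z \<in> polydisc m (c x) r" for S z
  proof -
    obtain y where y: "y \<in> ?P" "z = c y" using z chart_polydisc_image by blast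
    have "local_coeff M V' \<tau>' ?P g S y = local_coeff M V' \<tau>' U f S y"
      unfolding g_def using local_coeff_restr[OF tr U(1) _ P(1) U(2) y(1) f S] y P(2) U(2) by blast
    moreover have "local_coeff M V' \<tau>' ?P g S y = \<tau>' ?P g S y"
      using P g restr_id[OF P(1) g] by (simp add: local_coeff_def inf_absorb2)
    ultimately show ?thesis using B[OF S y(1)] Gc[OF y(1)] y(2) by simp
  qed
  have "bounded_upto n (Suc k) (?E G) ((1 + ev.growth * D) ^ Suc k * (1 + D') * (1 + 2 ^ n * D) ^ n * B)"
  proof (rule ev.fam_bound[THEN conjunct2])
    show "bounded_upto n k (ev.nil_coord i) D" if "i < m" for i
      using that D by (intro nil lower) (auto simp: coordinate_sections_def)
    show "bounded_upto n (Suc k) (ev.nil_coord i) D'" if "i < m" for i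
      using that D by (intro nil upper) (auto simp: coordinate_sections_def)
    show "bounded_upto n k (?E (odd_fam j)) D" if "j < n" for j
      using that D by (intro od lower) (auto simp: coordinate_sections_def)
    show "bounded_upto n (Suc k) (?E (odd_fam j)) D'" if "j < n" for j
      using that D by (intro od upper) (auto simp: coordinate_sections_def)
    show "G S z = 0" if "S \<subseteq> {..<n}" "\<not> S \<subseteq> {n - n..<n}" for S z
      using that by (auto simp: lessThan_atLeast0)
  qed (use D hG GB in auto)
  then have "cmod (?E G S) \<le> pull_const r D k * (1 + D') * B"
    using S by (auto simp: bounded_upto_def pull_const_def ev.growth_def mult_ac)
  moreover have "?E G S = pcoeff V \<tau> \<psi> U f S p"
    unfolding gG[symmetric] g_def
    by (rule pull_coeff_restr[OF assms(1) p \<psi> U(1) pU(3) P(1) U(2) pU(1) f S(1)])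
  ultimately show ?thesis by simp
qed

end

end

section \<open>Neighbourhoods of automorphisms\<close>

text \<open>The tube lemma: finitely many of the sets \<open>U\<close> cover \<open>K\<close>, and the corresponding sets \<open>N\<close> have an open
intersection.\<close>

lemma compact_uniform:
  assumes K: "compactin X K" and a: "a \<in> topspace T"
    and loc: "\<And>p. p \<in> K \<Longrightarrow> \<exists>U N. openin X U \<and> p \<in> U \<and> openin T N \<and> a \<in> N \<and> (\<forall>\<phi>\<in>N. \<forall>x\<in>U \<inter> K. R \<phi> x)"
  obtains N where "openin T N" "a \<in> N" "\<And>\<phi> x. \<lbrakk>\<phi> \<in> N; x \<in> K\<rbrakk> \<Longrightarrow> R \<phi> x"
proof -
  have "\<forall>p\<in>K. \<exists>Z. openin X (fst Z) \<and> p \<in> fst Z \<and> openin T (snd Z) \<and> a \<in> snd Z \<and>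
      (\<forall>\<phi>\<in>snd Z. \<forall>x\<in>fst Z \<inter> K. R \<phi> x)"
    using loc by fastforce
  from bchoice[OF this] obtain f where f: "\<And>p. p \<in> K \<Longrightarrow> openin X (fst (f p))" "\<And>p. p \<in> K \<Longrightarrow> p \<in> fst (f p)"
    "\<And>p. p \<in> K \<Longrightarrow> openin T (snd (f p))" "\<And>p. p \<in> K \<Longrightarrow> a \<in> snd (f p)"
    "\<And>p \<phi> x. \<lbrakk>p \<in> K; \<phi> \<in> snd (f p); x \<in> fst (f p) \<inter> K\<rbrakk> \<Longrightarrow> R \<phi> x" by blast
  have "\<exists>\<F>. finite \<F> \<and> \<F> \<subseteq> (\<lambda>p. fst (f p)) ` K \<and> K \<subseteq> \<Union>\<F>"
    using K f(1,2) unfolding compactin_def by (elim conjE allE[of _ "(\<lambda>p. fst (f p)) ` K"]) blast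
  then obtain P where P: "finite P" "P \<subseteq> K" "K \<subseteq> (\<Union>p\<in>P. fst (f p))"
    by (metis finite_subset_image)
  define N where "N = topspace T \<inter> (\<Inter>p\<in>P. snd (f p))"
  have "openin T N"
  proof (cases "P = {}")
    case False
    then have "openin T (\<Inter>p\<in>P. snd (f p))"
      using P f(3) by (intro openin_INT2) auto
    then show ?thesis unfolding N_def by blast
  qed (simp add: N_def)
  moreover have "a \<in> N" using a f(4) P(2) by (auto simp: N_def)
  moreover have "R \<phi> x" if "\<phi> \<in> N" "x \<in> K" for \<phi> x
  proof -
    obtain p where "p \<in> P" "x \<in> fst (f p)" using P(3) \<open>x \<in> K\<close> by blast
    then show ?thesis using f(5)[of p \<phi> x] that P(2) by (auto simp: N_def)
  qed
  ultimately show ?thesis using that by blast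
qed

lemma openin_topology_generated_by_image:
  assumes "openin (topology_generated_by \<S>) W" "b \<in> W"
    and basic: "\<And>B. \<lbrakk>B \<in> \<S>; b \<in> B\<rbrakk> \<Longrightarrow> \<exists>N. openin T N \<and> a \<in> N \<and> f ` N \<subseteq> B"
  shows "\<exists>N. openin T N \<and> a \<in> N \<and> f ` N \<subseteq> W"
proof -
  have "generate_topology_on \<S> W" by (rule openin_topology_generated_by[OF assms(1)])
  then show ?thesis using assms(2)
  proof (induction W rule: generate_topology_on.induct)
    case (Int A B)
    then obtain N N' where "openin T N" "a \<in> N" "f ` N \<subseteq> A" "openin T N'" "a \<in> N'" "f ` N' \<subseteq> B"
      by blast
    then show ?case by (intro exI[of _ "N \<inter> N'"]) blast
  next
    case (UN \<K>)
    then obtain A where A: "A \<in> \<K>" "b \<in> A" by blast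
    then obtain N where "openin T N" "a \<in> N" "f ` N \<subseteq> A" using UN.IH by blast
    then show ?case using A(1) by (intro exI[of _ N]) auto
  qed (use basic in auto)
qed

lemma Aut_morphism: "\<phi> \<in> Aut M \<Longrightarrow> morphism M M \<phi>"
  by (simp add: Aut_def)

locale compact_complex_supermanifold = complex_supermanifold +
  assumes compact: "compact_space X"
begin

abbreviation "T \<equiv> Aut_topology m n M"

text \<open>Comparison with the value at a fixed point \<open>p\<close>, rather than at \<open>x\<close>, makes this a subbasic condition on
\<open>\<phi>\<close> when \<open>x\<close> runs through a compact set.\<close>

abbreviation pull_near where
  "pull_near V \<tau> \<phi>0 p \<epsilon> \<phi> x U f \<equiv> under \<phi> x \<in> U \<and>
     (\<forall>S\<in>Pow {..<n}. cmod (pcoeff V \<tau> \<phi> U f S x - pcoeff V \<tau> \<phi>0 U f S p) < \<epsilon>)"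

lemma topspace_Aut: "topspace T = Aut M"
proof -
  have "\<Union>(Aut_subbase m n M) \<subseteq> Aut M" by (auto simp: Aut_subbase_def)
  then show ?thesis unfolding Aut_topology_def by auto
qed

lemma Aut_subbasic_open:
  assumes "coordinate_system m n M V c \<tau>" "compactin X K" "K \<subseteq> V" "openin X U" "f \<in> sects \<O> U"
    "\<And>S. S \<subseteq> {..<n} \<Longrightarrow> open (W S)"
  shows "openin T {\<phi> \<in> Aut M. under \<phi> ` K \<subseteq> U \<and> (\<forall>S\<in>Pow {..<n}. pcoeff V \<tau> \<phi> U f S ` K \<subseteq> W S)}"
proof -
  have "{\<phi> \<in> Aut M. under \<phi> ` K \<subseteq> U \<and> (\<forall>S\<in>Pow {..<n}. pcoeff V \<tau> \<phi> U f S ` K \<subseteq> W S)} \<in> Aut_subbase m n M"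
    unfolding Aut_subbase_def using assms by blast
  then show ?thesis unfolding Aut_topology_def by (intro topology_generated_by_Basis) simp
qed

lemma compact_neighbourhood:
  assumes "openin X G" "p \<in> G"
  obtains U C where "openin X U" "p \<in> U" "U \<subseteq> C" "compactin X C" "C \<subseteq> G"
proof -
  have "regular_space X" by (rule compact_Hausdorff_imp_regular_space[OF compact hausdorff])
  then have "\<exists>U C. openin X U \<and> closedin X C \<and> p \<in> U \<and> U \<subseteq> C \<and> C \<subseteq> G"
    using assms unfolding neighbourhood_base_of_closedin[symmetric] neighbourhood_base_of by simp
  then obtain U C where "openin X U" "closedin X C" "p \<in> U" "U \<subseteq> C" "C \<subseteq> G"
    by (elim exE conjE)
  then show ?thesis using that[of U C] closedin_compact_space[OF compact] by simp
qed

lemma pull_coeff_open_preimage: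
  assumes cs: "coordinate_system m n M V c \<tau>" and \<phi>: "morphism M M \<phi>"
    and U: "openin X U" and f: "f \<in> sects \<O> U" and W: "\<And>S. S \<subseteq> {..<n} \<Longrightarrow> open (W S)"
  shows "openin X {x \<in> V \<inter> preim M \<phi> U. \<forall>S\<in>Pow {..<n}. pcoeff V \<tau> \<phi> U f S x \<in> W S}"
proof -
  let ?D = "V \<inter> preim M \<phi> U"
  have tr: "trivialization m n M V \<tau>" using cs by (simp add: coordinate_system_def)
  note pU = openin_preim[OF \<phi> U]
  have D: "openin X ?D" using trivializationD(1)[OF tr] pU by blast
  have DV: "?D \<subseteq> V" by blast
  have op: "openin X {x \<in> ?D. pcoeff V \<tau> \<phi> U f S x \<in> W S}" if S: "S \<subseteq> {..<n}" for S
  proof -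
    have g: "restr \<O> (preim M \<phi> U) ?D (pull \<phi> U f) \<in> sects \<O> ?D"
      by (rule restr_closed[OF pU D _ graded_homD(1)[OF morphismD(3)[OF \<phi> U] f]]) blast
    then have "\<tau> ?D (restr \<O> (preim M \<phi> U) ?D (pull \<phi> U f)) \<in> sects (split_sheaf m n (atlas M)) ?D"
      using trivializationD(3)[OF tr D DV] by (auto simp: bij_betw_def)
    then have "pcoeff V \<tau> \<phi> U f S \<in> holo_functions m (atlas M) ?D"
      using S by (auto simp: pull_coeff_def split_sheaf_def)
    from holo_function_continuous[OF chart[OF cs] D DV this]
    have "openin (subtopology X ?D) {x \<in> topspace (subtopology X ?D). pcoeff V \<tau> \<phi> U f S x \<in> W S}"
      using W[OF S] by (intro openin_continuous_map_preimage[where Y = euclidean]) auto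
    moreover have "topspace (subtopology X ?D) = ?D" using openin_subset[OF D] by auto
    ultimately have "openin (subtopology X ?D) {x \<in> ?D. pcoeff V \<tau> \<phi> U f S x \<in> W S}"
      by (simp only:)
    then show ?thesis using openin_open_subtopology[OF D] by blast
  qed
  have "openin X (\<Inter>S\<in>Pow {..<n}. {x \<in> ?D. pcoeff V \<tau> \<phi> U f S x \<in> W S})"
    using op by (intro openin_INT2) auto
  moreover have "(\<Inter>S\<in>Pow {..<n}. {x \<in> ?D. pcoeff V \<tau> \<phi> U f S x \<in> W S}) =
      {x \<in> ?D. \<forall>S\<in>Pow {..<n}. pcoeff V \<tau> \<phi> U f S x \<in> W S}" by auto
  ultimately show ?thesis by simp
qed

text \<open>Subbasic sets control coefficients on compact sets only. The point \<open>p\<close> has a compact neighbourhood on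
which the coefficients for \<open>\<phi>0\<close> stay within \<open>\<epsilon>\<close> of their values at \<open>p\<close>; discs of radius \<open>\<epsilon>\<close> around
these values define the subbasic set.\<close>

lemma pull_coeff_local:
  assumes cs: "coordinate_system m n M V c \<tau>" and p: "p \<in> V" and \<phi>0: "\<phi>0 \<in> Aut M"
    and U: "openin X U" "under \<phi>0 p \<in> U" and f: "f \<in> sects \<O> U" and \<epsilon>: "\<epsilon> > 0"
  shows "\<exists>G N. openin X G \<and> p \<in> G \<and> G \<subseteq> V \<and> openin T N \<and> \<phi>0 \<in> N \<and> (\<forall>\<phi>\<in>N. \<forall>x\<in>G. pull_near V \<tau> \<phi>0 p \<epsilon> \<phi> x U f)"
proof -
  let ?W = "\<lambda>S. ball (pcoeff V \<tau> \<phi>0 U f S p) \<epsilon>"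
  let ?H = "{x \<in> V \<inter> preim M \<phi>0 U. \<forall>S\<in>Pow {..<n}. pcoeff V \<tau> \<phi>0 U f S x \<in> ?W S}"
  have tr: "trivialization m n M V \<tau>" using cs by (simp add: coordinate_system_def)
  have "openin X ?H"
    by (rule pull_coeff_open_preimage[OF cs Aut_morphism[OF \<phi>0] U(1) f]) auto
  moreover have "p \<in> ?H"
    using point_in_preim[OF tr p Aut_morphism[OF \<phi>0] U] \<epsilon> by auto
  ultimately obtain G C where G: "openin X G" "p \<in> G" "G \<subseteq> C" "compactin X C" "C \<subseteq> ?H"
    by (rule compact_neighbourhood)
  let ?N = "{\<phi> \<in> Aut M. under \<phi> ` C \<subseteq> U \<and> (\<forall>S\<in>Pow {..<n}. pcoeff V \<tau> \<phi> U f S ` C \<subseteq> ?W S)}"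
  have "openin T ?N"
    using G by (intro Aut_subbasic_open[OF cs G(4) _ U(1) f]) auto
  moreover have "\<phi>0 \<in> ?N" using \<phi>0 G(5) by (auto simp: preim_def)
  moreover have "under \<phi> x \<in> U" if "\<phi> \<in> ?N" "x \<in> G" for \<phi> x
    using that G by blast
  moreover have "cmod (pcoeff V \<tau> \<phi> U f S x - pcoeff V \<tau> \<phi>0 U f S p) < \<epsilon>"
    if "\<phi> \<in> ?N" "x \<in> G" "S \<in> Pow {..<n}" for \<phi> x S
  proof -
    have xC: "x \<in> C" using that G by blast
    have "pcoeff V \<tau> \<phi> U f S x \<in> ?W S" using that xC by blast
    then show "cmod (pcoeff V \<tau> \<phi> U f S x - pcoeff V \<tau> \<phi>0 U f S p) < \<epsilon>"
      by (simp add: dist_norm norm_minus_commute)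
  qed
  moreover have "G \<subseteq> V" using G by blast
  ultimately show ?thesis using G(1,2)
    by (intro exI[of _ G] exI[of _ ?N] conjI ballI) simp_all
qed

lemma pull_coeff_local_finite:
  assumes cs: "coordinate_system m n M V c \<tau>" and p: "p \<in> V" and \<phi>0: "\<phi>0 \<in> Aut M"
    and I: "finite I" and Uf: "\<forall>(U, f)\<in>I. openin X U \<and> under \<phi>0 p \<in> U \<and> f \<in> sects \<O> U"
    and \<epsilon>: "\<epsilon> > 0"
  shows "\<exists>G N. openin X G \<and> p \<in> G \<and> G \<subseteq> V \<and> openin T N \<and> \<phi>0 \<in> N \<and>
    (\<forall>\<phi>\<in>N. \<forall>x\<in>G. \<forall>(U, f)\<in>I. pull_near V \<tau> \<phi>0 p \<epsilon> \<phi> x U f)"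
  using I Uf
proof (induction I rule: finite_induct)
  case empty
  have "openin X V" using holo_chartD(1)[OF chart[OF cs]] .
  then show ?case using p \<phi>0 topspace_Aut by (intro exI[of _ V] exI[of _ "Aut M"]) (metis Sup_empty empty_iff openin_topspace order_refl)
next
  case (insert Uf I)
  obtain U f where Uf: "Uf = (U, f)" by (cases Uf)
  obtain G N where G: "openin X G" "p \<in> G" "G \<subseteq> V" "openin T N" "\<phi>0 \<in> N"
    "\<forall>\<phi>\<in>N. \<forall>x\<in>G. \<forall>(U, f)\<in>I. pull_near V \<tau> \<phi>0 p \<epsilon> \<phi> x U f"
    using insert.IH insert.prems by force
  obtain G' N' where G': "openin X G'" "p \<in> G'" "G' \<subseteq> V" "openin T N'" "\<phi>0 \<in> N'"
    "\<forall>\<phi>\<in>N'. \<forall>x\<in>G'. pull_near V \<tau> \<phi>0 p \<epsilon> \<phi> x U f"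
    using pull_coeff_local[OF cs p \<phi>0 _ _ _ \<epsilon>, of U f] insert.prems Uf by auto
  show ?case
  proof (intro exI conjI)
    show "openin X (G \<inter> G')" "p \<in> G \<inter> G'" "G \<inter> G' \<subseteq> V" "openin T (N \<inter> N')" "\<phi>0 \<in> N \<inter> N'"
      using G G' by auto
    show "\<forall>\<phi>\<in>N \<inter> N'. \<forall>x\<in>G \<inter> G'. \<forall>(U, f)\<in>insert Uf I. pull_near V \<tau> \<phi>0 p \<epsilon> \<phi> x U f"
    proof (intro ballI)
      fix \<phi> x Uf' assume "\<phi> \<in> N \<inter> N'" "x \<in> G \<inter> G'" and Uf': "Uf' \<in> insert Uf I"
      then have "\<phi> \<in> N" "x \<in> G" "\<phi> \<in> N'" "x \<in> G'" by auto
      then have "\<forall>(U, f)\<in>I. pull_near V \<tau> \<phi>0 p \<epsilon> \<phi> x U f"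
        and "pull_near V \<tau> \<phi>0 p \<epsilon> \<phi> x U f"
        using G(6) G'(6) by auto
      then show "case Uf' of (U, f) \<Rightarrow> pull_near V \<tau> \<phi>0 p \<epsilon> \<phi> x U f"
        using Uf' unfolding Uf by (elim insertE) simp_all
    qed
  qed
qed

text \<open>Uniform closeness on a compact set follows from closeness to the values at a single point, applied to
\<open>\<phi>\<close> and to \<open>\<phi>0\<close> near that point.\<close>

lemma pull_coeff_uniform:
  assumes cs: "coordinate_system m n M V c \<tau>" and K: "compactin X K" "K \<subseteq> V" and \<phi>0: "\<phi>0 \<in> Aut M"
    and I: "finite I" and Uf: "\<forall>(U, f)\<in>I. openin X U \<and> under \<phi>0 ` K \<subseteq> U \<and> f \<in> sects \<O> U"
    and \<epsilon>: "\<epsilon> > 0"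
  obtains N where "openin T N" "\<phi>0 \<in> N"
    "\<And>\<phi> x U f. \<lbrakk>\<phi> \<in> N; x \<in> K; (U, f) \<in> I\<rbrakk> \<Longrightarrow> under \<phi> x \<in> U"
    "\<And>\<phi> x U f S. \<lbrakk>\<phi> \<in> N; x \<in> K; (U, f) \<in> I; S \<subseteq> {..<n}\<rbrakk> \<Longrightarrow>
        cmod (pcoeff V \<tau> \<phi> U f S x - pcoeff V \<tau> \<phi>0 U f S x) < \<epsilon>"
proof -
  define R where "R = (\<lambda>\<phi> x. \<forall>(U, f)\<in>I. pull_near V \<tau> \<phi>0 x \<epsilon> \<phi> x U f)"
  have "\<exists>G N. openin X G \<and> p \<in> G \<and> openin T N \<and> \<phi>0 \<in> N \<and> (\<forall>\<phi>\<in>N. \<forall>x\<in>G \<inter> K. R \<phi> x)" if p: "p \<in> K" for p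
  proof -
    have pV: "p \<in> V" using p K by blast
    have "\<forall>(U, f)\<in>I. openin X U \<and> under \<phi>0 p \<in> U \<and> f \<in> sects \<O> U"
      using Uf p by blast
    from pull_coeff_local_finite[OF cs pV \<phi>0 I this half_gt_zero[OF \<epsilon>]]
    obtain G N where G: "openin X G" "p \<in> G" "openin T N" "\<phi>0 \<in> N" and
      "\<forall>\<phi>\<in>N. \<forall>x\<in>G. \<forall>(U, f)\<in>I. pull_near V \<tau> \<phi>0 p (\<epsilon> / 2) \<phi> x U f"
      by (elim exE conjE) simp
    then have *: "\<forall>\<phi>\<in>N. \<forall>x\<in>G. \<forall>(U, f)\<in>I. pull_near V \<tau> \<phi>0 p (\<epsilon> / 2) \<phi> x U f"
      by (simp only:)
    have GN: "pull_near V \<tau> \<phi>0 p (\<epsilon> / 2) \<phi> x U f"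
      if "\<phi> \<in> N" "x \<in> G" "(U, f) \<in> I" for \<phi> x U f
      using bspec[OF bspec[OF bspec[OF * that(1)] that(2)] that(3)] unfolding prod.case .
    have "R \<phi> x" if "\<phi> \<in> N" "x \<in> G \<inter> K" for \<phi> x
      unfolding R_def
    proof (intro ballI, clarify)
      fix U f assume I: "(U, f) \<in> I"
      have xG: "x \<in> G" using that by blast
      have "cmod (pcoeff V \<tau> \<phi> U f S x - pcoeff V \<tau> \<phi>0 U f S x) < \<epsilon>" if S: "S \<in> Pow {..<n}" for S
      proof -
        have "cmod (pcoeff V \<tau> \<phi> U f S x - pcoeff V \<tau> \<phi>0 U f S p) < \<epsilon> / 2"
          using GN[OF \<open>\<phi> \<in> N\<close> xG I] S by simp
        moreover have "cmod (pcoeff V \<tau> \<phi>0 U f S p - pcoeff V \<tau> \<phi>0 U f S x) < \<epsilon> / 2"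
          using GN[OF G(4) xG I] S by (simp add: norm_minus_commute)
        ultimately show ?thesis
          using norm_diff_triangle_less by fastforce
      qed
      then show "pull_near V \<tau> \<phi>0 x \<epsilon> \<phi> x U f"
        using GN[OF that(1) xG I] by simp
    qed
    then show ?thesis using G by blast
  qed
  then have loc: "\<And>p. p \<in> K \<Longrightarrow> \<exists>G N. openin X G \<and> p \<in> G \<and> openin T N \<and> \<phi>0 \<in> N \<and> (\<forall>\<phi>\<in>N. \<forall>x\<in>G \<inter> K. R \<phi> x)" .
  have top: "\<phi>0 \<in> topspace T" using \<phi>0 topspace_Aut by simp
  obtain N where N: "openin T N" "\<phi>0 \<in> N" "\<And>\<phi> x. \<lbrakk>\<phi> \<in> N; x \<in> K\<rbrakk> \<Longrightarrow> R \<phi> x"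
    using compact_uniform[OF K(1) top loc] by blast
  show ?thesis
  proof (rule that[OF N(1,2)])
    fix \<phi> x U f assume "\<phi> \<in> N" "x \<in> K" "(U, f) \<in> I"
    with N(3)[OF this(1,2)] have *: "pull_near V \<tau> \<phi>0 x \<epsilon> \<phi> x U f"
      unfolding R_def by blast
    then show "under \<phi> x \<in> U" by simp
    show "cmod (pcoeff V \<tau> \<phi> U f S x - pcoeff V \<tau> \<phi>0 U f S x) < \<epsilon>" if "S \<subseteq> {..<n}" for S
      using * that by simp
  qed
qed

lemma under_uniform:
  assumes K: "compactin X K" and \<phi>0: "\<phi>0 \<in> Aut M" and U: "openin X U" "under \<phi>0 ` K \<subseteq> U"
  obtains N where "openin T N" "\<phi>0 \<in> N" "\<And>\<phi> x. \<lbrakk>\<phi> \<in> N; x \<in> K\<rbrakk> \<Longrightarrow> under \<phi> x \<in> U"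
proof (rule compact_uniform[OF K, of \<phi>0 T "\<lambda>\<phi> x. under \<phi> x \<in> U"])
  show "\<phi>0 \<in> topspace T" using \<phi>0 topspace_Aut by simp
  fix p assume p: "p \<in> K"
  then have "p \<in> topspace X" using compactin_subset_topspace[OF K] by blast
  then obtain V c \<tau> where cs: "coordinate_system m n M V c \<tau>" "p \<in> V" by (rule coordinates_exist)
  have "under \<phi>0 p \<in> U" using p U by blast
  from pull_coeff_local[OF cs \<phi>0 U(1) this graded_algebra_closed(3)[OF sections_algebra[OF U(1)]] zero_less_one]
  obtain G N where "openin X G" "p \<in> G" "openin T N" "\<phi>0 \<in> N" "\<forall>\<phi>\<in>N. \<forall>x\<in>G. under \<phi> x \<in> U"
    by (elim exE conjE) simp
  then show "\<exists>G N. openin X G \<and> p \<in> G \<and> openin T N \<and> \<phi>0 \<in> N \<and> (\<forall>\<phi>\<in>N. \<forall>x\<in>G \<inter> K. under \<phi> x \<in> U)"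
    by blast
qed (use that in blast)

text \<open>A common radius for all centres \<open>x\<close> near \<open>p\<close>: half of a radius that works at \<open>p\<close>.\<close>

lemma polydisc_neighbourhood:
  assumes cs: "coordinate_system m n M V c \<tau>" and G: "openin X G" "p \<in> G" and p: "p \<in> V"
  obtains r U C where "r > 0" "openin X U" "p \<in> U" "U \<subseteq> V" "compactin X C" "C \<subseteq> G \<inter> V"
    "\<And>x. x \<in> U \<Longrightarrow> polydisc m (c x) r \<subseteq> c ` V"
    "\<And>x. x \<in> U \<Longrightarrow> chart_polydisc V c x r \<subseteq> C"
proof -
  note ch = chart[OF cs]
  have V: "openin X V" by (rule holo_chartD(1)[OF ch])
  have "openin X (G \<inter> V)" "p \<in> G \<inter> V" using G V p by auto
  then obtain U0 C where U0: "openin X U0" "p \<in> U0" "U0 \<subseteq> C" "compactin X C" "C \<subseteq> G \<inter> V"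
    by (rule compact_neighbourhood)
  have "U0 \<subseteq> V" using U0 by blast
  from openin_contains_polydisc[OF holo_chart_openin_image[OF ch U0(1) this], of "c p"] U0(2)
  obtain R where R: "R > 0" "polydisc m (c p) R \<subseteq> c ` U0" by blast
  define r where "r = R / 2"
  define U where "U = chart_polydisc V c p r"
  have r: "r > 0" using R by (simp add: r_def)
  have opn: "openin X U" unfolding U_def chart_polydisc_def
    by (rule holo_chart_openin_preimage[OF ch polydisc_openin])
  have pU: "p \<in> U"
    using p r holo_chart_image_cspace[OF ch order_refl] by (auto simp: U_def chart_polydisc_def polydisc_def)
  have sub: "polydisc m (c x) r \<subseteq> c ` U0" if "x \<in> U" for x
  proof -
    have "polydisc m (c x) r \<subseteq> polydisc m (c p) R"
    proof
      fix z assume z: "z \<in> polydisc m (c x) r"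
      have "cmod (z i - c p i) < R" if "i < m" for i
      proof -
        have "cmod (z i - c x i) < r" "cmod (c x i - c p i) < r"
          using z \<open>x \<in> U\<close> that by (auto simp: polydisc_def U_def chart_polydisc_def)
        then have "cmod ((z i - c x i) + (c x i - c p i)) < r + r"
          by (meson add_strict_mono norm_triangle_ineq order_le_less_trans)
        then show ?thesis by (simp add: r_def)
      qed
      then show "z \<in> polydisc m (c p) R" using z by (auto simp: polydisc_def)
    qed
    then show ?thesis using R by blast
  qed
  have polyC: "chart_polydisc V c x r \<subseteq> C" if "x \<in> U" for x
  proof
    fix y assume "y \<in> chart_polydisc V c x r"
    then have "y \<in> V" "c y \<in> c ` U0" using sub[OF that] by (auto simp: chart_polydisc_def)
    then have "y \<in> U0" using holo_chart_inj[OF ch] \<open>U0 \<subseteq> V\<close> by (metis inj_on_image_mem_iff)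
    then show "y \<in> C" using U0 by blast
  qed
  have UV: "U \<subseteq> V" by (auto simp: U_def chart_polydisc_def)
  show ?thesis
  proof (rule that[OF r opn pU UV U0(4,5) _ polyC])
    show "polydisc m (c x) r \<subseteq> c ` V" if "x \<in> U" for x
      using sub[OF that] image_mono[OF \<open>U0 \<subseteq> V\<close>] by (rule order_trans)
  qed
qed

end

section \<open>Continuity in groups\<close>

lemma continuous_map_pointwise:
  assumes "\<And>x. x \<in> topspace X \<Longrightarrow> f x \<in> topspace Y"
    and "\<And>x W. \<lbrakk>x \<in> topspace X; openin Y W; f x \<in> W\<rbrakk> \<Longrightarrow> \<exists>N. openin X N \<and> x \<in> N \<and> f ` N \<subseteq> W"
  shows "continuous_map X Y f"
  unfolding continuous_map_def
proof (intro conjI allI impI)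
  show "f \<in> topspace X \<rightarrow> topspace Y" using assms(1) by blast
  fix W assume W: "openin Y W"
  show "openin X {x \<in> topspace X. f x \<in> W}"
  proof (subst openin_subopen, intro ballI)
    fix x assume "x \<in> {x \<in> topspace X. f x \<in> W}"
    then obtain N where "openin X N" "x \<in> N" "f ` N \<subseteq> W" using assms(2)[OF _ W] by blast
    then show "\<exists>N. openin X N \<and> x \<in> N \<and> N \<subseteq> {x \<in> topspace X. f x \<in> W}"
      using openin_subset by blast
  qed
qed

text \<open>Near \<open>a\<close>, inversion is the composite of the translation \<open>x \<mapsto> a\<^sup>-\<^sup>1 x\<close> to a neighbourhood of \<open>\<one>\<close>, of
inversion there, and of the translation \<open>y \<mapsto> y a\<^sup>-\<^sup>1\<close>.\<close>

lemma topological_groupI: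
  fixes G (structure)
  assumes "group G" and top: "topspace T = carrier G"
    and mult: "continuous_map (prod_topology T T) T (\<lambda>(x, y). x \<otimes> y)"
    and inv1: "\<And>W. \<lbrakk>openin T W; \<one> \<in> W\<rbrakk> \<Longrightarrow> \<exists>N. openin T N \<and> \<one> \<in> N \<and> (\<lambda>x. inv x) ` N \<subseteq> W"
  shows "topological_group G T"
proof -
  interpret group G by fact
  have right: "continuous_map T T (\<lambda>x. x \<otimes> a)" and left: "continuous_map T T (\<lambda>x. a \<otimes> x)"
    if "a \<in> carrier G" for a
  proof -
    have "continuous_map T (prod_topology T T) (\<lambda>x. (x, a))" "continuous_map T (prod_topology T T) (\<lambda>x. (a, x))"
      using that top by (auto simp: continuous_map_pairwise o_def)
    from continuous_map_compose[OF this(1) mult] continuous_map_compose[OF this(2) mult]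
    show "continuous_map T T (\<lambda>x. x \<otimes> a)" "continuous_map T T (\<lambda>x. a \<otimes> x)"
      by (simp_all add: o_def)
  qed
  have "continuous_map T T (\<lambda>x. inv x)"
  proof (rule continuous_map_pointwise)
    show "inv x \<in> topspace T" if "x \<in> topspace T" for x using that top by simp
    fix a W assume a: "a \<in> topspace T" and W: "openin T W" "inv a \<in> W"
    have a': "a \<in> carrier G" "inv a \<in> carrier G" using a top by auto
    define W' where "W' = {x \<in> topspace T. x \<otimes> inv a \<in> W}"
    have "openin T W'"
      unfolding W'_def by (rule openin_continuous_map_preimage[OF right[OF a'(2)] W(1)])
    moreover have "\<one> \<in> W'" using W a' top by (simp add: W'_def)
    ultimately obtain N where N: "openin T N" "\<one> \<in> N" "(\<lambda>x. inv x) ` N \<subseteq> W'" using inv1 by blast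
    let ?N = "{x \<in> topspace T. inv a \<otimes> x \<in> N}"
    have "openin T ?N" by (rule openin_continuous_map_preimage[OF left[OF a'(2)] N(1)])
    moreover have "a \<in> ?N" using a a' N by simp
    moreover have "inv x \<in> W" if "x \<in> ?N" for x
    proof -
      have x: "x \<in> carrier G" using that top by simp
      have "inv (inv a \<otimes> x) \<in> W'" using that N(3) by blast
      then have "inv (inv a \<otimes> x) \<otimes> inv a \<in> W" by (simp add: W'_def)
      moreover have "inv (inv a \<otimes> x) \<otimes> inv a = inv x"
        using x a' by (simp add: inv_mult_group m_assoc)
      ultimately show ?thesis by simp
    qed
    ultimately show "\<exists>N. openin T N \<and> a \<in> N \<and> (\<lambda>x. inv x) ` N \<subseteq> W" by blast
  qed
  then show ?thesis
    using top mult by unfold_locales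
qed

section \<open>Continuity of composition\<close>

lemma finite_real_bound:
  assumes "finite A"
  obtains D :: real where "D \<ge> 1" "\<And>x. x \<in> A \<Longrightarrow> x \<le> D"
proof -
  obtain b where "\<And>x. x \<in> A \<Longrightarrow> x \<le> b"
    using bdd_above_finite[OF assms] unfolding bdd_above_def by blast
  then show ?thesis using that[of "max 1 b"] by force
qed

context complex_supermanifold
begin

lemma coordinate_sections_closed:
  assumes cs: "coordinate_system m n M V c \<tau>"
  shows "coordinate_sections m n M V c \<tau> \<subseteq> sects \<O> V"
  using family_section(1)[OF cs holo_chartD(1)[OF chart[OF cs]] order_refl]
    holo_fam_even_coordinate[OF cs holo_chartD(1)[OF chart[OF cs]] order_refl]
    holo_fam_odd_coordinate[OF cs holo_chartD(1)[OF chart[OF cs]] order_refl]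
  by (auto simp: coordinate_sections_def)

lemma pull_coeff_id:
  assumes "openin X U" "f \<in> sects \<O> U"
  shows "pcoeff V \<tau> (id_morphism M) U f S = local_coeff M V \<tau> U f S"
  unfolding pull_coeff_eq_local_coeff preim_id[OF openin_subset[OF assms(1)]]
  using assms by (simp add: id_morphism_def)

lemma coordinate_coeff_le_1:
  assumes cs: "coordinate_system m n M V c \<tau>" and s: "s \<in> coordinate_sections m n M V c \<tau>"
    and x: "x \<in> V" and S: "S \<subseteq> {..<n}" "S \<noteq> {}"
  shows "cmod (local_coeff M V \<tau> V s S x) \<le> 1"
proof -
  have V: "openin X V" by (rule holo_chartD(1)[OF chart[OF cs]])
  have "s \<in> sects \<O> V" using coordinate_sections_closed[OF cs] s by blast
  then have "local_coeff M V \<tau> V s S x = \<tau> V s S x"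
    using restr_id[OF V] by (simp add: local_coeff_def)
  moreover have "cmod (\<tau> V s S x) \<le> 1"
    using s family_section(2)[OF cs V order_refl holo_fam_even_coordinate[OF cs V order_refl]]
      family_section(2)[OF cs V order_refl holo_fam_odd_coordinate[OF cs V order_refl]] S x
    by (auto simp: coordinate_sections_def even_fam_def odd_fam_def split: if_splits)
  ultimately show ?thesis by simp
qed

text \<open>The sections \<open>f\<close> and \<open>g\<close> live over different open sets, such as the preimages of \<open>U\<close> under two
automorphisms, and can be subtracted only after restriction to the intersection.\<close>

lemma pull_coeff_diff_bound:
  assumes cs: "coordinate_system m n M V' c \<tau>'" and x: "x \<in> V'"
    and r: "r > 0" and sub: "polydisc m (c x) r \<subseteq> c ` V'"
    and triv: "trivialization m n M V \<tau>" and p: "p \<in> V" and \<psi>: "morphism M M \<psi>"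
    and \<psi>p: "under \<psi> p = x"
    and D: "D \<ge> 1" "D' \<ge> 0"
    and lower: "\<And>s S. \<lbrakk>s \<in> coordinate_sections m n M V' c \<tau>'; S \<subseteq> {..<n}; S \<noteq> {}; card S \<le> k\<rbrakk> \<Longrightarrow>
      cmod (pcoeff V \<tau> \<psi> V' s S p) \<le> D"
    and upper: "\<And>s S. \<lbrakk>s \<in> coordinate_sections m n M V' c \<tau>'; S \<subseteq> {..<n}; S \<noteq> {}; card S \<le> Suc k\<rbrakk> \<Longrightarrow>
      cmod (pcoeff V \<tau> \<psi> V' s S p) \<le> D'"
    and A: "openin X A" "chart_polydisc V' c x r \<subseteq> A" "f \<in> sects \<O> A"
    and B: "openin X B" "chart_polydisc V' c x r \<subseteq> B" "g \<in> sects \<O> B"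
    and \<delta>: "\<And>S y. \<lbrakk>S \<subseteq> {..<n}; y \<in> chart_polydisc V' c x r\<rbrakk> \<Longrightarrow>
      cmod (local_coeff M V' \<tau>' A f S y - local_coeff M V' \<tau>' B g S y) \<le> \<delta>"
    and S: "S \<subseteq> {..<n}" "card S \<le> Suc k"
  shows "cmod (pcoeff V \<tau> \<psi> A f S p - pcoeff V \<tau> \<psi> B g S p) \<le> pull_const r D k * (1 + D') * \<delta>"
proof -
  let ?U = "A \<inter> B"
  have tr: "trivialization m n M V' \<tau>'" using cs by (simp add: coordinate_system_def)
  have U: "openin X ?U" using A B by blast
  have PU: "chart_polydisc V' c x r \<subseteq> ?U" using A B by blast
  have pU: "under \<psi> p \<in> A" "under \<psi> p \<in> B" "under \<psi> p \<in> ?U"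
    using chart_polydisc_center[OF cs x r sub] PU \<psi>p by auto
  define f' where "f' = restr \<O> A ?U f"
  define g' where "g' = restr \<O> B ?U g"
  have f': "f' \<in> sects \<O> ?U" unfolding f'_def by (rule restr_closed[OF A(1) U _ A(3)]) blast
  have g': "g' \<in> sects \<O> ?U" unfolding g'_def by (rule restr_closed[OF B(1) U _ B(3)]) blast
  interpret alg: graded_algebra "sections \<O> ?U" "part \<O> ?U" by (rule sections_algebra[OF U])
  define h where "h = f' \<oplus>\<^bsub>sections \<O> ?U\<^esub> \<ominus>\<^bsub>sections \<O> ?U\<^esub> g'"
  have h: "h \<in> sects \<O> ?U" using f' g' by (simp add: h_def)
  have f'_eq: "f' = h \<oplus>\<^bsub>sections \<O> ?U\<^esub> g'"
    using f' g' by (simp add: h_def alg.a_assoc alg.l_neg)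
  have pf: "pcoeff V \<tau> \<psi> A f S p - pcoeff V \<tau> \<psi> B g S p = pcoeff V \<tau> \<psi> ?U h S p"
  proof -
    have "pcoeff V \<tau> \<psi> ?U f' S p = pcoeff V \<tau> \<psi> A f S p"
      unfolding f'_def by (rule pull_coeff_restr[OF triv p \<psi> A(1) pU(1) U _ pU(3) A(3) S(1)]) blast
    moreover have "pcoeff V \<tau> \<psi> ?U g' S p = pcoeff V \<tau> \<psi> B g S p"
      unfolding g'_def by (rule pull_coeff_restr[OF triv p \<psi> B(1) pU(2) U _ pU(3) B(3) S(1)]) blast
    moreover have "pcoeff V \<tau> \<psi> ?U f' S p = pcoeff V \<tau> \<psi> ?U h S p + pcoeff V \<tau> \<psi> ?U g' S p"
      unfolding f'_eq by (rule pull_coeff_add[OF triv p \<psi> U pU(3) h g' S(1)])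
    ultimately show ?thesis by (simp add: algebra_simps)
  qed
  have "cmod (local_coeff M V' \<tau>' ?U h S y) \<le> \<delta>" if S: "S \<subseteq> {..<n}" and y: "y \<in> chart_polydisc V' c x r" for S y
  proof -
    have yV: "y \<in> V'" using y by (simp add: chart_polydisc_def)
    have yU: "y \<in> V' \<inter> ?U" "y \<in> V' \<inter> A" "y \<in> V' \<inter> B" "y \<in> ?U" using y yV PU by auto
    have "local_coeff M V' \<tau>' ?U f' S y = local_coeff M V' \<tau>' A f S y"
      unfolding f'_def by (rule local_coeff_restr[OF tr A(1) yU(2) U _ yU(4) A(3) S]) blast
    moreover have "local_coeff M V' \<tau>' ?U g' S y = local_coeff M V' \<tau>' B g S y"
      unfolding g'_def by (rule local_coeff_restr[OF tr B(1) yU(3) U _ yU(4) B(3) S]) blast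
    moreover have "local_coeff M V' \<tau>' ?U f' S y = local_coeff M V' \<tau>' ?U h S y + local_coeff M V' \<tau>' ?U g' S y"
      unfolding f'_eq by (rule local_coeff_add[OF tr U yU(1) h g' S])
    ultimately have "local_coeff M V' \<tau>' ?U h S y = local_coeff M V' \<tau>' A f S y - local_coeff M V' \<tau>' B g S y"
      by (simp add: algebra_simps)
    then show ?thesis using \<delta>[OF S y] by simp
  qed
  then have "cmod (pcoeff V \<tau> \<psi> ?U h S p) \<le> pull_const r D k * (1 + D') * \<delta>"
    by (intro pull_coeff_bound[OF cs x r sub triv p \<psi> \<psi>p D lower upper U PU h _ S])
  then show ?thesis unfolding pf .
qed

lemma pull_const_ge_1: "\<lbrakk>r > 0; D \<ge> 0\<rbrakk> \<Longrightarrow> 1 \<le> pull_const r D k"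
  unfolding pull_const_def using mult_mono[of 1 "(1 + of_nat m * 2 ^ n * 4 / r * D) ^ Suc k" 1 "(1 + 2 ^ n * D) ^ n"]
  by (simp add: one_le_power del: power_Suc)

lemma pull_const_mono: "\<lbrakk>r > 0; D \<ge> 0; k \<le> l\<rbrakk> \<Longrightarrow> pull_const r D k \<le> pull_const r D l"
  unfolding pull_const_def by (intro mult_right_mono power_increasing) auto

end

lemma Aut_comp_closed:
  assumes "sheaf_of_graded_algebras (body M) (str_sheaf M)" "\<phi> \<in> Aut M" "\<psi> \<in> Aut M"
  shows "comp_morphism M M M \<phi> \<psi> \<in> Aut M"
  using monoid.m_closed[OF group.is_monoid[OF Aut_group_group[OF assms(1)]], of \<phi> \<psi>] assms(2,3)
  by (simp add: Aut_group_def)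

context compact_complex_supermanifold
begin

lemma id_Aut: "id_morphism M \<in> Aut M"
  using morphism_id[OF sheaf_of_graded_algebras_axioms] comp_id_left[OF morphism_id[OF sheaf_of_graded_algebras_axioms]]
  by (auto simp: Aut_def)

text \<open>With \<open>y = \<psi>(x)\<close>, the difference \<open>\<psi>\<^sup>*(\<phi>\<^sup>*f - \<phi>\<^sub>0\<^sup>*f)\<close> is estimated by the values of \<open>\<phi>\<^sup>*f - \<phi>\<^sub>0\<^sup>*f\<close> on a
polydisc around \<open>y\<close>. For all \<open>y\<close> near \<open>q\<close> these polydiscs have the same radius and lie in one
compact set \<open>C\<close>, on which \<open>\<phi>\<^sup>*f\<close> and \<open>\<phi>\<^sub>0\<^sup>*f\<close> are uniformly close. The remaining term
\<open>\<psi>\<^sup>*(\<phi>\<^sub>0\<^sup>*f)\<close> is the pullback along \<open>\<psi>\<close> of a section independent of \<open>\<phi>\<close> and \<open>\<psi>\<close>.\<close>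

lemma comp_local:
  assumes cs: "coordinate_system m n M V c \<tau>" and p: "p \<in> V"
    and \<phi>0: "\<phi>0 \<in> Aut M" and \<psi>0: "\<psi>0 \<in> Aut M"
    and U: "openin X U" "under (comp_morphism M M M \<phi>0 \<psi>0) p \<in> U" and f: "f \<in> sects \<O> U" and \<eta>: "\<eta> > 0"
  shows "\<exists>G N N'. openin X G \<and> p \<in> G \<and> openin T N \<and> \<phi>0 \<in> N \<and> openin T N' \<and> \<psi>0 \<in> N' \<and>
    (\<forall>\<phi>\<in>N. \<forall>\<psi>\<in>N'. \<forall>x\<in>G. pull_near V \<tau> (comp_morphism M M M \<phi>0 \<psi>0) p \<eta> (comp_morphism M M M \<phi> \<psi>) x U f)"
proof -
  have tr: "trivialization m n M V \<tau>" using cs by (simp add: coordinate_system_def)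
  note m\<phi>0 = Aut_morphism[OF \<phi>0] and m\<psi>0 = Aut_morphism[OF \<psi>0]
  define q where "q = under \<psi>0 p"
  define U0 where "U0 = preim M \<phi>0 U"
  define f0 where "f0 = pull \<phi>0 U f"
  have Vtop: "V \<subseteq> topspace X" by (rule openin_subset[OF trivializationD(1)[OF tr]])
  have under_comp: "under (comp_morphism M M M \<phi> \<psi>) x = under \<phi> (under \<psi> x)" if "x \<in> V" for \<phi> \<psi> x
    using that Vtop by (auto simp: comp_morphism_def)
  have q: "q \<in> topspace X" unfolding q_def using under_in_topspace[OF m\<psi>0] p Vtop by blast
  have U0: "openin X U0" unfolding U0_def by (rule openin_preim[OF m\<phi>0 U(1)])
  have qU0: "q \<in> U0" using q U by (simp add: U0_def preim_def q_def under_comp[OF p])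
  have f0: "f0 \<in> sects \<O> U0" unfolding f0_def U0_def by (rule graded_homD(1)[OF morphismD(3)[OF m\<phi>0 U(1)] f])
  obtain V' c' \<tau>' where cs': "coordinate_system m n M V' c' \<tau>'" and qV': "q \<in> V'"
    using coordinates_exist[OF q] by blast
  have V': "openin X V'" by (rule holo_chartD(1)[OF chart[OF cs']])
  obtain r P C where r: "r > 0" and P: "openin X P" "q \<in> P" "P \<subseteq> V'" and C: "compactin X C" "C \<subseteq> U0 \<inter> V'"
    and disc: "\<And>x. x \<in> P \<Longrightarrow> polydisc m (c' x) r \<subseteq> c' ` V'"
    and discC: "\<And>x. x \<in> P \<Longrightarrow> chart_polydisc V' c' x r \<subseteq> C"
    using polydisc_neighbourhood[OF cs' U0 qU0 qV'] by blast
  let ?Z = "coordinate_sections m n M V' c' \<tau>'"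
  have finZ: "finite ?Z" by (rule finite_coordinate_sections)
  have Z: "?Z \<subseteq> sects \<O> V'" by (rule coordinate_sections_closed[OF cs'])
  \<comment> \<open>The summand 1 leaves room for the coefficients of a nearby \<open>\<psi>\<close>.\<close>
  have "finite ((\<lambda>(s, S). cmod (pcoeff V \<tau> \<psi>0 V' s S p) + 1) ` (?Z \<times> Pow {..<n}))"
    using finZ by simp
  then obtain D where D: "D \<ge> 1"
    and DB: "\<And>y. y \<in> (\<lambda>(s, S). cmod (pcoeff V \<tau> \<psi>0 V' s S p) + 1) ` (?Z \<times> Pow {..<n}) \<Longrightarrow> y \<le> D"
    by (rule finite_real_bound) (rule that)
  have Dle: "cmod (pcoeff V \<tau> \<psi>0 V' s S p) + 1 \<le> D" if "s \<in> ?Z" "S \<subseteq> {..<n}" for s S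
    by (rule DB, rule image_eqI[of _ _ "(s, S)"]) (use that in auto)
  define K where "K = pull_const r D n * (1 + D)"
  have K: "K > 0" using pull_const_ge_1[OF r, of D n] D by (simp add: K_def)
  define \<delta> where "\<delta> = \<eta> / (2 * K)"
  have \<delta>: "\<delta> > 0" "K * \<delta> = \<eta> / 2" using K \<eta> by (auto simp: \<delta>_def)
  have "under \<phi>0 ` C \<subseteq> U" using C by (auto simp: U0_def preim_def)
  then have I: "\<forall>(U, f)\<in>{(U, f)}. openin X U \<and> under \<phi>0 ` C \<subseteq> U \<and> f \<in> sects \<O> U" using U f by simp
  have CV': "C \<subseteq> V'" using C by blast
  obtain N where N: "openin T N" "\<phi>0 \<in> N"
    and NU: "\<And>\<phi> y U' f'. \<lbrakk>\<phi> \<in> N; y \<in> C; (U', f') \<in> {(U, f)}\<rbrakk> \<Longrightarrow> under \<phi> y \<in> U'"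
    and Nc: "\<And>\<phi> y U' f' S. \<lbrakk>\<phi> \<in> N; y \<in> C; (U', f') \<in> {(U, f)}; S \<subseteq> {..<n}\<rbrakk> \<Longrightarrow>
        cmod (pcoeff V' \<tau>' \<phi> U' f' S y - pcoeff V' \<tau>' \<phi>0 U' f' S y) < \<delta>"
    by (rule pull_coeff_uniform[OF cs' C(1) CV' \<phi>0 _ I \<delta>(1)]) (simp, rule that)
  \<comment> \<open>The pair with the unit section over \<open>P\<close> only expresses that \<open>\<psi>\<close> maps points near \<open>p\<close> into \<open>P\<close>.\<close>
  let ?I = "(\<lambda>s. (V', s)) ` ?Z \<union> {(U0, f0), (P, \<one>\<^bsub>sections \<O> P\<^esub>)}"
  have "\<forall>(U, f)\<in>?I. openin X U \<and> under \<psi>0 p \<in> U \<and> f \<in> sects \<O> U"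
    using V' qV' Z U0 qU0 f0 P graded_algebra_closed(3)[OF sections_algebra[OF P(1)]]
    by (auto simp: q_def[symmetric])
  moreover have "finite ?I" using finZ by simp
  moreover have "0 < min 1 (\<eta> / 2)" using \<eta> by simp
  ultimately have "\<exists>G N. openin X G \<and> p \<in> G \<and> G \<subseteq> V \<and> openin T N \<and> \<psi>0 \<in> N \<and>
    (\<forall>\<phi>\<in>N. \<forall>x\<in>G. \<forall>(U, f)\<in>?I. pull_near V \<tau> \<psi>0 p (min 1 (\<eta> / 2)) \<phi> x U f)"
    by (intro pull_coeff_local_finite[OF cs p \<psi>0])
  then obtain G N' where G: "openin X G" "p \<in> G" "G \<subseteq> V" and N': "openin T N'" "\<psi>0 \<in> N'"
    and all: "\<forall>\<phi>\<in>N'. \<forall>x\<in>G. \<forall>(U, f)\<in>?I. pull_near V \<tau> \<psi>0 p (min 1 (\<eta> / 2)) \<phi> x U f"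
    by (elim exE conjE)
  have N'U: "under \<psi> x \<in> U'" and N'c: "S \<subseteq> {..<n} \<Longrightarrow>
      cmod (pcoeff V \<tau> \<psi> U' f' S x - pcoeff V \<tau> \<psi>0 U' f' S p) < min 1 (\<eta> / 2)"
    if "\<psi> \<in> N'" "x \<in> G" "(U', f') \<in> ?I" for \<psi> x U' f' S
    using bspec[OF bspec[OF bspec[OF all that(1)] that(2)] that(3)] unfolding prod.case by blast+
  have "pull_near V \<tau> (comp_morphism M M M \<phi>0 \<psi>0) p \<eta> (comp_morphism M M M \<phi> \<psi>) x U f"
    if \<phi>: "\<phi> \<in> N" and \<psi>: "\<psi> \<in> N'" and x: "x \<in> G" for \<phi> \<psi> x
  proof -
    have "\<phi> \<in> Aut M" "\<psi> \<in> Aut M" using \<phi> \<psi> openin_subset[OF N(1)] openin_subset[OF N'(1)] topspace_Aut by auto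
    then have m\<phi>: "morphism M M \<phi>" and m\<psi>: "morphism M M \<psi>" by (simp_all add: Aut_morphism)
    define y where "y = under \<psi> x"
    have y: "y \<in> P" using N'U[OF \<psi> x] by (auto simp: y_def)
    have yV': "y \<in> V'" using y P by blast
    have xV: "x \<in> V" using x G by blast
    note disc_y = disc[OF y]
    have preimC: "C \<subseteq> preim M \<phi> U" using NU[OF \<phi>] compactin_subset_topspace[OF C(1)] by (auto simp: preim_def)
    have yC: "y \<in> C" using chart_polydisc_center[OF cs' yV' r disc_y] discC[OF y] by blast
    have "cmod (pcoeff V \<tau> (comp_morphism M M M \<phi> \<psi>) U f S x -
            pcoeff V \<tau> (comp_morphism M M M \<phi>0 \<psi>0) U f S p) < \<eta>" if S: "S \<subseteq> {..<n}" for S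
    proof -
      have "cmod (pcoeff V \<tau> \<psi> (preim M \<phi> U) (pull \<phi> U f) S x - pcoeff V \<tau> \<psi> U0 f0 S x)
          \<le> pull_const r D n * (1 + D) * \<delta>"
      proof (rule pull_coeff_diff_bound[OF cs' yV' r disc_y tr xV m\<psi> y_def[symmetric] D])
        show "0 \<le> D" using D by simp
        have le: "cmod (pcoeff V \<tau> \<psi> V' s S x) \<le> D" if s: "s \<in> ?Z" "S \<subseteq> {..<n}" for s S
        proof -
          have "(V', s) \<in> ?I" using s by blast
          from N'c[OF \<psi> x this s(2)]
          have "cmod (pcoeff V \<tau> \<psi> V' s S x - pcoeff V \<tau> \<psi>0 V' s S p) < 1" by simp
          then show ?thesis
            using Dle[OF s] norm_triangle_ineq2[of "pcoeff V \<tau> \<psi> V' s S x" "pcoeff V \<tau> \<psi>0 V' s S p"] by linarith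
        qed
        show "cmod (pcoeff V \<tau> \<psi> V' s S x) \<le> D" if "s \<in> ?Z" "S \<subseteq> {..<n}" for s S
          by (rule le[OF that])
        show "cmod (pcoeff V \<tau> \<psi> V' s S x) \<le> D" if "s \<in> ?Z" "S \<subseteq> {..<n}" for s S
          by (rule le[OF that])
        show "openin X (preim M \<phi> U)" by (rule openin_preim[OF m\<phi> U(1)])
        show "chart_polydisc V' c' y r \<subseteq> preim M \<phi> U" using discC[OF y] preimC by blast
        show "pull \<phi> U f \<in> sects \<O> (preim M \<phi> U)" by (rule graded_homD(1)[OF morphismD(3)[OF m\<phi> U(1)] f])
        show "openin X U0" "f0 \<in> sects \<O> U0" by (rule U0 f0)+
        show "chart_polydisc V' c' y r \<subseteq> U0" using discC[OF y] C by blast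
        show "cmod (local_coeff M V' \<tau>' (preim M \<phi> U) (pull \<phi> U f) S z - local_coeff M V' \<tau>' U0 f0 S z) \<le> \<delta>"
          if "S \<subseteq> {..<n}" "z \<in> chart_polydisc V' c' y r" for S z
          using Nc[OF \<phi> _ _ that(1), of z U f] discC[OF y] that(2)
          unfolding pull_coeff_eq_local_coeff U0_def f0_def by fastforce
        show "S \<subseteq> {..<n}" by (rule S)
        show "card S \<le> Suc n" using card_mono[OF _ S] by simp
      qed
      also have "\<dots> = \<eta> / 2" using \<delta>(2) by (simp add: K_def)
      finally have 1: "cmod (pcoeff V \<tau> \<psi> (preim M \<phi> U) (pull \<phi> U f) S x - pcoeff V \<tau> \<psi> U0 f0 S x) \<le> \<eta> / 2" .
      have 2: "cmod (pcoeff V \<tau> \<psi> U0 f0 S x - pcoeff V \<tau> \<psi>0 U0 f0 S p) < \<eta> / 2"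
        using N'c[OF \<psi> x _ S, of U0 f0] by simp
      have "cmod (pcoeff V \<tau> \<psi> (preim M \<phi> U) (pull \<phi> U f) S x - pcoeff V \<tau> \<psi>0 U0 f0 S p) < \<eta>"
        using norm_triangle_ineq[of "pcoeff V \<tau> \<psi> (preim M \<phi> U) (pull \<phi> U f) S x - pcoeff V \<tau> \<psi> U0 f0 S x"
            "pcoeff V \<tau> \<psi> U0 f0 S x - pcoeff V \<tau> \<psi>0 U0 f0 S p"] 1 2 by simp
      then show ?thesis
        unfolding pull_coeff_comp[OF m\<psi> U(1) f] pull_coeff_comp[OF m\<psi>0 U(1) f] U0_def f0_def .
    qed
    then show ?thesis using NU[OF \<phi> yC] by (simp add: y_def under_comp[OF xV])
  qed
  then have "\<forall>\<phi>\<in>N. \<forall>\<psi>\<in>N'. \<forall>x\<in>G. pull_near V \<tau> (comp_morphism M M M \<phi>0 \<psi>0) p \<eta> (comp_morphism M M M \<phi> \<psi>) x U f"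
    by (intro ballI)
  then show ?thesis using G(1,2) N N' by (intro exI conjI)
qed

end

context compact_complex_supermanifold
begin

lemma Aut_subbaseE:
  assumes "B \<in> Aut_subbase m n M"
  obtains V c \<tau> K U f W where "coordinate_system m n M V c \<tau>" "compactin X K" "K \<subseteq> V" "openin X U" "f \<in> sects \<O> U"
    "\<And>S. S \<subseteq> {..<n} \<Longrightarrow> open (W S)"
    "B = {\<phi> \<in> Aut M. under \<phi> ` K \<subseteq> U \<and> (\<forall>S\<in>Pow {..<n}. pcoeff V \<tau> \<phi> U f S ` K \<subseteq> W S)}"
  using assms unfolding Aut_subbase_def by blast

lemma finite_open_radius:
  assumes "\<And>S. S \<subseteq> {..<n} \<Longrightarrow> open (W S)" "\<And>S. S \<subseteq> {..<n} \<Longrightarrow> v S \<in> W S"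
  obtains \<eta> :: real where "\<eta> > 0" "\<And>S w. \<lbrakk>S \<subseteq> {..<n}; cmod (w - v S) < \<eta>\<rbrakk> \<Longrightarrow> w \<in> (W S :: complex set)"
proof -
  have "\<forall>S\<in>Pow {..<n}. \<exists>e>0. ball (v S) e \<subseteq> W S"
    using assms by (meson PowD open_contains_ball)
  from bchoice[OF this] obtain e where e: "\<forall>S\<in>Pow {..<n}. e S > 0 \<and> ball (v S) (e S) \<subseteq> W S" by blast
  let ?\<eta> = "Min (e ` Pow {..<n})"
  have "?\<eta> > 0" using e by (subst Min_gr_iff) auto
  moreover have "w \<in> W S" if "S \<subseteq> {..<n}" "cmod (w - v S) < ?\<eta>" for S w
  proof -
    have "?\<eta> \<le> e S" using that by (intro Min_le) auto
    with that(2) have "cmod (w - v S) < e S" by (rule less_le_trans)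
    then have "w \<in> ball (v S) (e S)" by (simp add: dist_norm norm_minus_commute)
    then show ?thesis using e that by blast
  qed
  ultimately show ?thesis using that by blast
qed

text \<open>Continuity at \<open>a\<close> of a map into the automorphisms is tested on subbasic sets, and there near the
points of the compact set one at a time.\<close>

lemma continuous_at_AutI:
  assumes a: "a \<in> topspace Y" and F: "\<And>z. z \<in> topspace Y \<Longrightarrow> F z \<in> Aut M"
    and local: "\<And>V c \<tau> p U f \<eta>. \<lbrakk>coordinate_system m n M V c \<tau>; p \<in> V; openin X U; under (F a) p \<in> U;
        f \<in> sects \<O> U; \<eta> > 0\<rbrakk> \<Longrightarrow>
      \<exists>G N. openin X G \<and> p \<in> G \<and> openin Y N \<and> a \<in> N \<and> (\<forall>z\<in>N. \<forall>x\<in>G. pull_near V \<tau> (F a) p \<eta> (F z) x U f)"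
    and W0: "openin T W0" "F a \<in> W0"
  shows "\<exists>N. openin Y N \<and> a \<in> N \<and> F ` N \<subseteq> W0"
proof (rule openin_topology_generated_by_image[OF W0[unfolded Aut_topology_def]])
  fix B assume "B \<in> insert (Aut M) (Aut_subbase m n M)" and B0: "F a \<in> B"
  then consider "B = Aut M" | "B \<in> Aut_subbase m n M" by blast
  then show "\<exists>N. openin Y N \<and> a \<in> N \<and> F ` N \<subseteq> B"
  proof cases
    case 1
    then show ?thesis using a F by (intro exI[of _ "topspace Y"]) auto
  next
    case 2
    then obtain V c \<tau> K U f W where cs: "coordinate_system m n M V c \<tau>" and K: "compactin X K" "K \<subseteq> V"
      and U: "openin X U" and f: "f \<in> sects \<O> U" and W: "\<And>S. S \<subseteq> {..<n} \<Longrightarrow> open (W S)"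
      and B: "B = {\<phi> \<in> Aut M. under \<phi> ` K \<subseteq> U \<and> (\<forall>S\<in>Pow {..<n}. pcoeff V \<tau> \<phi> U f S ` K \<subseteq> W S)}"
      by (rule Aut_subbaseE) (rule that)
    define R where "R = (\<lambda>z x. under (F z) x \<in> U \<and> (\<forall>S\<in>Pow {..<n}. pcoeff V \<tau> (F z) U f S x \<in> W S))"
    have loc: "\<exists>G N. openin X G \<and> p \<in> G \<and> openin Y N \<and> a \<in> N \<and> (\<forall>z\<in>N. \<forall>x\<in>G \<inter> K. R z x)"
      if p: "p \<in> K" for p
    proof -
      let ?v = "\<lambda>S. pcoeff V \<tau> (F a) U f S p"
      have vW: "?v S \<in> W S" if "S \<subseteq> {..<n}" for S
      proof -
        have "\<forall>S\<in>Pow {..<n}. pcoeff V \<tau> (F a) U f S ` K \<subseteq> W S"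
          using B0 unfolding B by simp
        then show ?thesis using that p by blast
      qed
      obtain \<eta> where \<eta>: "\<eta> > 0" "\<And>S w. \<lbrakk>S \<subseteq> {..<n}; cmod (w - ?v S) < \<eta>\<rbrakk> \<Longrightarrow> w \<in> W S"
        by (rule finite_open_radius[of W ?v, OF W vW]) (assumption | rule that)+
      have pU: "under (F a) p \<in> U" using B0 p unfolding B by auto
      have "p \<in> V" using p K by blast
      from local[OF cs this U pU f \<eta>(1)] obtain G N
        where G: "openin X G" "p \<in> G" and N: "openin Y N" "a \<in> N"
          and near: "\<forall>z\<in>N. \<forall>x\<in>G. pull_near V \<tau> (F a) p \<eta> (F z) x U f"
        by (elim exE conjE)
      have "R z x" if "z \<in> N" "x \<in> G \<inter> K" for z x
        using near that \<eta>(2) unfolding R_def by blast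
      then show ?thesis using G N by blast
    qed
    obtain N where N: "openin Y N" "a \<in> N" and R: "\<And>z x. \<lbrakk>z \<in> N; x \<in> K\<rbrakk> \<Longrightarrow> R z x"
      by (rule compact_uniform[OF K(1) a loc]) (assumption | rule that)+
    have "F z \<in> B" if "z \<in> N" for z
      unfolding B using R[OF that] F[of z] openin_subset[OF N(1)] that by (auto simp: R_def)
    then show ?thesis using N by (intro exI[of _ N]) auto
  qed
qed

lemma comp_continuous:
  "continuous_map (prod_topology T T) T (\<lambda>(\<phi>, \<psi>). comp_morphism M M M \<phi> \<psi>)"
proof (rule continuous_map_pointwise)
  let ?F = "\<lambda>(\<phi>, \<psi>). comp_morphism M M M \<phi> \<psi>"
  have closed: "?F \<Phi> \<in> Aut M" if "\<Phi> \<in> topspace (prod_topology T T)" for \<Phi>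
    using that Aut_comp_closed[OF sheaf_of_graded_algebras_axioms] topspace_Aut by auto
  then show "?F \<Phi> \<in> topspace T" if "\<Phi> \<in> topspace (prod_topology T T)" for \<Phi>
    using that topspace_Aut by simp
  fix \<Phi>0 W0 assume \<Phi>0: "\<Phi>0 \<in> topspace (prod_topology T T)" and W0: "openin T W0" "?F \<Phi>0 \<in> W0"
  obtain \<phi>0 \<psi>0 where \<Phi>0_eq: "\<Phi>0 = (\<phi>0, \<psi>0)" by (cases \<Phi>0)
  have \<phi>0: "\<phi>0 \<in> Aut M" and \<psi>0: "\<psi>0 \<in> Aut M" using \<Phi>0 topspace_Aut by (auto simp: \<Phi>0_eq)
  show "\<exists>N. openin (prod_topology T T) N \<and> \<Phi>0 \<in> N \<and> ?F ` N \<subseteq> W0"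
  proof (rule continuous_at_AutI[where F = ?F, OF \<Phi>0 closed _ W0])
    fix V c \<tau> p U f and \<eta> :: real
    assume "coordinate_system m n M V c \<tau>" "p \<in> V" "openin X U" "under (?F \<Phi>0) p \<in> U" "f \<in> sects \<O> U" "\<eta> > 0"
    then have "\<exists>G N N'. openin X G \<and> p \<in> G \<and> openin T N \<and> \<phi>0 \<in> N \<and> openin T N' \<and> \<psi>0 \<in> N' \<and>
        (\<forall>\<phi>\<in>N. \<forall>\<psi>\<in>N'. \<forall>x\<in>G. pull_near V \<tau> (?F \<Phi>0) p \<eta> (comp_morphism M M M \<phi> \<psi>) x U f)"
      unfolding \<Phi>0_eq prod.case by (intro comp_local[OF _ _ \<phi>0 \<psi>0])
    then obtain G N N' where G: "openin X G" "p \<in> G" and N: "openin T N" "\<phi>0 \<in> N" "openin T N'" "\<psi>0 \<in> N'"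
      and near: "\<forall>\<phi>\<in>N. \<forall>\<psi>\<in>N'. \<forall>x\<in>G. pull_near V \<tau> (?F \<Phi>0) p \<eta> (comp_morphism M M M \<phi> \<psi>) x U f"
      by (elim exE conjE)
    have "openin (prod_topology T T) (N \<times> N')" "\<Phi>0 \<in> N \<times> N'"
      using N by (auto simp: openin_prod_Times_iff \<Phi>0_eq)
    moreover have "\<forall>\<Phi>\<in>N \<times> N'. \<forall>x\<in>G. pull_near V \<tau> (?F \<Phi>0) p \<eta> (?F \<Phi>) x U f"
      using near by (simp only: ball_simps split_paired_Ball_Sigma prod.case)
    ultimately show "\<exists>G N. openin X G \<and> p \<in> G \<and> openin (prod_topology T T) N \<and> \<Phi>0 \<in> N \<and>
        (\<forall>\<Phi>\<in>N. \<forall>x\<in>G. pull_near V \<tau> (?F \<Phi>0) p \<eta> (?F \<Phi>) x U f)"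
      using G by (intro exI conjI)
  qed
qed

section \<open>Continuity of inversion\<close>

text \<open>Only \<open>\<phi>\<close> is assumed to be close to the identity. With \<open>y = \<psi>(x)\<close>, the estimate for \<open>\<psi>\<^sup>*(\<phi>\<^sup>*s - s)\<close> reads
\<open>(1 + D') K \<delta>\<close>, where \<open>D'\<close> bounds the coordinates pulled back along \<open>\<psi>\<close> in degree at most \<open>k + 1\<close>, provided
that \<open>2\<close> bounds them in degree at most \<open>k\<close>. For a coordinate \<open>s\<close>, whose own coefficients of positive
degree are at most \<open>1\<close>, this gives \<open>D' \<le> 1 + (1 + D') / 3\<close>, that is \<open>D' \<le> 2\<close>, and the induction goes on.
The value \<open>2\<close> is the fixed point of this recursion.\<close>

lemma inverse_local:
  assumes cs: "coordinate_system m n M V c \<tau>" and p: "p \<in> V"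
    and U: "openin X U" "p \<in> U" and f: "f \<in> sects \<O> U" and \<eta>: "\<eta> > 0"
  shows "\<exists>G N. openin X G \<and> p \<in> G \<and> openin T N \<and> id_morphism M \<in> N \<and>
    (\<forall>\<phi>\<in>N. \<forall>x\<in>G. \<forall>\<psi>. morphism M M \<psi> \<and> comp_morphism M M M \<phi> \<psi> = id_morphism M \<longrightarrow>
      pull_near V \<tau> (id_morphism M) p \<eta> \<psi> x U f)"
proof -
  let ?id = "id_morphism M"
  have tr: "trivialization m n M V \<tau>" using cs by (simp add: coordinate_system_def)
  have V: "openin X V" by (rule holo_chartD(1)[OF chart[OF cs]])
  have Vtop: "V \<subseteq> topspace X" by (rule openin_subset[OF V])
  have under_id: "under ?id x = x" if "x \<in> topspace X" for x using that by (simp add: id_morphism_def)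
  obtain r P C where r: "r > 0" and P: "openin X P" "p \<in> P" "P \<subseteq> V" and C: "compactin X C" "C \<subseteq> U \<inter> V"
    and disc: "\<And>x. x \<in> P \<Longrightarrow> polydisc m (c x) r \<subseteq> c ` V"
    and discC: "\<And>x. x \<in> P \<Longrightarrow> chart_polydisc V c x r \<subseteq> C"
    using polydisc_neighbourhood[OF cs U p] by blast
  let ?Z = "coordinate_sections m n M V c \<tau>"
  have finZ: "finite ?Z" by (rule finite_coordinate_sections)
  have Z: "?Z \<subseteq> sects \<O> V" by (rule coordinate_sections_closed[OF cs])
  define K where "K = pull_const r 2 n"
  have K: "K \<ge> 1" unfolding K_def using r by (intro pull_const_ge_1) auto
  \<comment> \<open>The bound \<open>1 / (3 K)\<close> serves the recursion for the coordinates, the other one serves the section \<open>f\<close>, where \<open>D' = 2\<close>.\<close>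
  define \<delta> where "\<delta> = min (1 / (3 * K)) (\<eta> / (6 * K))"
  have \<delta>: "\<delta> > 0" using K \<eta> by (simp add: \<delta>_def)
  have "K * \<delta> \<le> K * (1 / (3 * K))" "K * \<delta> \<le> K * (\<eta> / (6 * K))"
    using K by (intro mult_left_mono; simp add: \<delta>_def)+
  then have K\<delta>: "K * \<delta> \<le> 1 / 3" "K * \<delta> \<le> \<eta> / 6" using K by simp_all
  have Ctop: "C \<subseteq> topspace X" by (rule compactin_subset_topspace[OF C(1)])
  have idC: "under ?id ` C \<subseteq> C" using under_id Ctop by force
  let ?I = "(\<lambda>s. (V, s)) ` ?Z \<union> {(U, f)}"
  have CV: "C \<subseteq> V" using C by blast
  have I: "\<forall>(U, f)\<in>?I. openin X U \<and> under ?id ` C \<subseteq> U \<and> f \<in> sects \<O> U"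
    using V Z U f idC C by auto
  have finI: "finite ?I" using finZ by simp
  obtain N1 where N1: "openin T N1" "?id \<in> N1"
    and N1U: "\<And>\<phi> y U' f'. \<lbrakk>\<phi> \<in> N1; y \<in> C; (U', f') \<in> ?I\<rbrakk> \<Longrightarrow> under \<phi> y \<in> U'"
    and N1c: "\<And>\<phi> y U' f' S. \<lbrakk>\<phi> \<in> N1; y \<in> C; (U', f') \<in> ?I; S \<subseteq> {..<n}\<rbrakk> \<Longrightarrow>
        cmod (pcoeff V \<tau> \<phi> U' f' S y - pcoeff V \<tau> ?id U' f' S y) < \<delta>"
    by (rule pull_coeff_uniform[OF cs C(1) CV id_Aut finI I \<delta>]) (rule that)
  have pid: "under ?id p \<in> U" using under_id[of p] p Vtop U by auto
  have "\<exists>G N. openin X G \<and> p \<in> G \<and> G \<subseteq> V \<and> openin T N \<and> ?id \<in> N \<and> (\<forall>\<phi>\<in>N. \<forall>x\<in>G. pull_near V \<tau> ?id p (\<eta> / 2) \<phi> x U f)"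
    by (rule pull_coeff_local[OF cs p id_Aut U(1) pid f half_gt_zero[OF \<eta>]])
  then obtain G1 where G1: "openin X G1" "p \<in> G1"
    and G1c: "\<And>x S. \<lbrakk>x \<in> G1; S \<subseteq> {..<n}\<rbrakk> \<Longrightarrow> cmod (pcoeff V \<tau> ?id U f S x - pcoeff V \<tau> ?id U f S p) < \<eta> / 2"
    by (elim exE conjE) (meson PowI)
  have "openin X (G1 \<inter> P)" "p \<in> G1 \<inter> P" using G1 P by auto
  then obtain G C' where G: "openin X G" "p \<in> G" "G \<subseteq> C'" and C': "compactin X C'" "C' \<subseteq> G1 \<inter> P"
    by (rule compact_neighbourhood)
  \<comment> \<open>If \<open>\<psi>(x)\<close> were outside \<open>P\<close>, then \<open>x = \<phi>(\<psi>(x))\<close> would be outside \<open>C'\<close>.\<close>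
  have "compactin X (topspace X - P)"
    using P(1) by (intro closedin_compact_space[OF compact]) blast
  moreover have "openin X (topspace X - C')"
    using compactin_imp_closedin[OF hausdorff C'(1)] by blast
  moreover have "under ?id ` (topspace X - P) \<subseteq> topspace X - C'"
    using under_id C' by auto
  ultimately obtain N2 where N2: "openin T N2" "?id \<in> N2"
    and N2U: "\<And>\<phi> x. \<lbrakk>\<phi> \<in> N2; x \<in> topspace X - P\<rbrakk> \<Longrightarrow> under \<phi> x \<in> topspace X - C'"
    using under_uniform[OF _ id_Aut] by metis
  have "pull_near V \<tau> ?id p \<eta> \<psi> x U f"
    if \<phi>: "\<phi> \<in> N1 \<inter> N2" and m\<psi>: "morphism M M \<psi>" and \<phi>\<psi>: "comp_morphism M M M \<phi> \<psi> = ?id" and x: "x \<in> G"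
    for \<phi> \<psi> x
  proof -
    have \<phi>1: "\<phi> \<in> N1" and \<phi>2: "\<phi> \<in> N2" using \<phi> by auto
    then have "\<phi> \<in> Aut M" using openin_subset[OF N1(1)] topspace_Aut by auto
    then have m\<phi>: "morphism M M \<phi>" by (rule Aut_morphism)
    have xC': "x \<in> C'" and xG1: "x \<in> G1" and xV: "x \<in> V" using x G C' P by auto
    have xtop: "x \<in> topspace X" using xV Vtop by blast
    define y where "y = under \<psi> x"
    have ytop: "y \<in> topspace X" unfolding y_def by (rule under_in_topspace[OF m\<psi> xtop])
    have "under \<phi> y = under (comp_morphism M M M \<phi> \<psi>) x" using xtop by (simp add: comp_morphism_def y_def)
    then have \<phi>y: "under \<phi> y = x" using \<phi>\<psi> under_id[OF xtop] by simp
    have y: "y \<in> P" using N2U[OF \<phi>2, of y] \<phi>y ytop xC' by auto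
    have yV: "y \<in> V" using y P by blast
    note disc_y = disc[OF y]
    have yC: "y \<in> C" using chart_polydisc_center[OF cs yV r disc_y] discC[OF y] by blast
    have pull_pull: "pcoeff V \<tau> \<psi> (preim M \<phi> U') (pull \<phi> U' s) S x = pcoeff V \<tau> ?id U' s S x"
      if "openin X U'" "s \<in> sects \<O> U'" for U' s S
      using pull_coeff_comp[OF m\<psi> that, of V \<tau> \<phi> S] \<phi>\<psi> by simp
    have diff: "cmod (pcoeff V \<tau> ?id U' s S x - pcoeff V \<tau> \<psi> U' s S x) \<le> (1 + D') * (K * \<delta>)"
      if Us: "(U', s) \<in> ?I" and S: "S \<subseteq> {..<n}" "card S \<le> Suc k" and k: "k \<le> n" and D': "D' \<ge> 0"
        and lower: "\<And>s S. \<lbrakk>s \<in> ?Z; S \<subseteq> {..<n}; S \<noteq> {}; card S \<le> k\<rbrakk> \<Longrightarrow> cmod (pcoeff V \<tau> \<psi> V s S x) \<le> 2"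
        and upper: "\<And>s S. \<lbrakk>s \<in> ?Z; S \<subseteq> {..<n}; S \<noteq> {}; card S \<le> Suc k\<rbrakk> \<Longrightarrow> cmod (pcoeff V \<tau> \<psi> V s S x) \<le> D'"
      for U' s S k D'
    proof -
      have U': "openin X U'" "s \<in> sects \<O> U'" "C \<subseteq> U'"
        using bspec[OF I Us] idC CV C Us by auto
      have "cmod (pcoeff V \<tau> \<psi> (preim M \<phi> U') (pull \<phi> U' s) S x - pcoeff V \<tau> \<psi> U' s S x)
          \<le> pull_const r 2 k * (1 + D') * \<delta>"
      proof (rule pull_coeff_diff_bound[OF cs yV r disc_y tr xV m\<psi> y_def[symmetric] _ D' lower upper])
        show "openin X (preim M \<phi> U')" by (rule openin_preim[OF m\<phi> U'(1)])
        show "chart_polydisc V c y r \<subseteq> preim M \<phi> U'"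
          using discC[OF y] N1U[OF \<phi>1 _ Us] Ctop by (auto simp: preim_def)
        show "pull \<phi> U' s \<in> sects \<O> (preim M \<phi> U')" by (rule graded_homD(1)[OF morphismD(3)[OF m\<phi> U'(1)] U'(2)])
        show "openin X U'" "s \<in> sects \<O> U'" by (rule U')+
        show "chart_polydisc V c y r \<subseteq> U'" using discC[OF y] U' by blast
        show "cmod (local_coeff M V \<tau> (preim M \<phi> U') (pull \<phi> U' s) S z - local_coeff M V \<tau> U' s S z) \<le> \<delta>"
          if "S \<subseteq> {..<n}" "z \<in> chart_polydisc V c y r" for S z
        proof -
          have "z \<in> C" using that discC[OF y] by blast
          from N1c[OF \<phi>1 this Us that(1)] show ?thesis
            by (simp add: pull_coeff_id[OF U'(1,2)] pull_coeff_eq_local_coeff[of M V \<tau> \<phi>])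
        qed
      qed (use S in auto)
      also have "\<dots> \<le> K * (1 + D') * \<delta>"
        unfolding K_def using pull_const_mono[OF r, of 2 k n] k D' \<delta> by (intro mult_right_mono) auto
      finally show ?thesis unfolding pull_pull[OF U'(1,2)] by (simp add: mult_ac)
    qed
    have coord: "\<forall>s\<in>?Z. \<forall>S. S \<subseteq> {..<n} \<and> S \<noteq> {} \<and> card S \<le> k \<longrightarrow> cmod (pcoeff V \<tau> \<psi> V s S x) \<le> 2"
      if "k \<le> Suc n" for k
      using that
    proof (induction k)
      case 0
      have "\<not> card S \<le> 0" if "S \<subseteq> {..<n}" "S \<noteq> {}" for S
        using that finite_subset[OF that(1)] by simp
      then show ?case by blast
    next
      case (Suc k)
      let ?A = "{(s, S). s \<in> ?Z \<and> S \<subseteq> {..<n} \<and> S \<noteq> {} \<and> card S \<le> Suc k}"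
      let ?g = "\<lambda>(s, S). cmod (pcoeff V \<tau> \<psi> V s S x)"
      \<comment> \<open>The element 0 makes the set nonempty when there are no coefficients to bound.\<close>
      define D' where "D' = Max (insert 0 (?g ` ?A))"
      have "?A \<subseteq> ?Z \<times> Pow {..<n}" by auto
      then have fin: "finite (insert 0 (?g ` ?A))" using finZ finite_subset by blast
      have D'0: "D' \<ge> 0" unfolding D'_def using fin by (intro Max_ge) auto
      have upper: "cmod (pcoeff V \<tau> \<psi> V s S x) \<le> D'"
        if "s \<in> ?Z" "S \<subseteq> {..<n}" "S \<noteq> {}" "card S \<le> Suc k" for s S
        unfolding D'_def by (rule Max_ge[OF fin], rule insertI2, rule image_eqI[of _ _ "(s, S)"]) (use that in auto)
      have step: "cmod (pcoeff V \<tau> \<psi> V s S x) \<le> 1 + (1 + D') / 3"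
        if s: "s \<in> ?Z" and S: "S \<subseteq> {..<n}" "S \<noteq> {}" "card S \<le> Suc k" for s S
      proof -
        have "(V, s) \<in> ?I" using s by blast
        moreover have "k \<le> n" "k \<le> Suc n" using Suc.prems by auto
        moreover have "cmod (pcoeff V \<tau> \<psi> V s S x) \<le> 2"
          if "s \<in> ?Z" "S \<subseteq> {..<n}" "S \<noteq> {}" "card S \<le> k" for s S
          using Suc.IH \<open>k \<le> Suc n\<close> that by blast
        ultimately have "cmod (pcoeff V \<tau> ?id V s S x - pcoeff V \<tau> \<psi> V s S x) \<le> (1 + D') * (K * \<delta>)"
          using diff[of V s S k D'] S D'0 upper by blast
        also have "\<dots> \<le> (1 + D') * (1 / 3)" using K\<delta>(1) D'0 by (intro mult_left_mono) auto
        finally have "cmod (pcoeff V \<tau> ?id V s S x - pcoeff V \<tau> \<psi> V s S x) \<le> (1 + D') / 3" by simp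
        moreover have "cmod (pcoeff V \<tau> ?id V s S x) \<le> 1"
          using coordinate_coeff_le_1[OF cs s xV S(1,2)] pull_coeff_id[OF V] s Z by auto
        moreover have "cmod (pcoeff V \<tau> \<psi> V s S x) \<le> cmod (pcoeff V \<tau> ?id V s S x) +
            cmod (pcoeff V \<tau> ?id V s S x - pcoeff V \<tau> \<psi> V s S x)"
          using norm_triangle_sub norm_minus_commute by metis
        ultimately show ?thesis by linarith
      qed
      have "D' \<le> 1 + (1 + D') / 3"
      proof -
        have "D' \<in> insert 0 (?g ` ?A)" unfolding D'_def using fin by (intro Max_in) auto
        then have "D' = 0 \<or> (\<exists>z\<in>?A. D' = ?g z)" by (simp only: insert_iff image_iff)
        then show ?thesis
        proof (elim disjE bexE)
          fix z assume z: "z \<in> ?A" "D' = ?g z"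
          obtain s S where "z = (s, S)" by (cases z)
          then show ?thesis using z step[of s S] by simp
        qed simp
      qed
      then have "D' \<le> 2" by (simp add: field_simps)
      then show ?case using upper by (meson order_trans)
    qed
    have "cmod (pcoeff V \<tau> \<psi> U f S x - pcoeff V \<tau> ?id U f S p) < \<eta>" if S: "S \<subseteq> {..<n}" for S
    proof -
      have cS: "card S \<le> Suc n" using card_mono[OF _ S] by simp
      have b: "cmod (pcoeff V \<tau> \<psi> V s S x) \<le> 2"
        if "s \<in> ?Z" "S \<subseteq> {..<n}" "S \<noteq> {}" "card S \<le> Suc n" for s S
        using coord[OF order_refl] that by blast
      have b': "cmod (pcoeff V \<tau> \<psi> V s S x) \<le> 2"
        if "s \<in> ?Z" "S \<subseteq> {..<n}" "S \<noteq> {}" "card S \<le> n" for s S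
        using b[OF that(1-3)] that(4) by simp
      have "cmod (pcoeff V \<tau> ?id U f S x - pcoeff V \<tau> \<psi> U f S x) \<le> (1 + 2) * (K * \<delta>)"
        by (rule diff[OF _ S cS order_refl _ b' b]) auto
      also have "\<dots> \<le> \<eta> / 2" using K\<delta>(2) by simp
      finally have "cmod (pcoeff V \<tau> \<psi> U f S x - pcoeff V \<tau> ?id U f S x) \<le> \<eta> / 2"
        by (simp add: norm_minus_commute)
      then show ?thesis
        using G1c[OF xG1 S] norm_triangle_ineq[of "pcoeff V \<tau> \<psi> U f S x - pcoeff V \<tau> ?id U f S x"
            "pcoeff V \<tau> ?id U f S x - pcoeff V \<tau> ?id U f S p"] by simp
    qed
    then show ?thesis using yC C by (auto simp: y_def)
  qed
  moreover have "openin T (N1 \<inter> N2)" "?id \<in> N1 \<inter> N2" using N1 N2 by auto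
  ultimately show ?thesis
    using G(1,2) by (intro exI[of _ G] exI[of _ "N1 \<inter> N2"] conjI ballI allI impI) (elim conjE, assumption | simp)+
qed

lemma inverse_continuous_at_id:
  assumes W0: "openin T W0" "id_morphism M \<in> W0"
  shows "\<exists>N. openin T N \<and> id_morphism M \<in> N \<and> (\<lambda>\<phi>. inv\<^bsub>Aut_group M\<^esub> \<phi>) ` N \<subseteq> W0"
proof -
  let ?id = "id_morphism M"
  interpret G: group "Aut_group M" by (rule Aut_group_group[OF sheaf_of_graded_algebras_axioms])
  have carr: "carrier (Aut_group M) = Aut M" and one: "\<one>\<^bsub>Aut_group M\<^esub> = ?id"
    and mult: "\<phi> \<otimes>\<^bsub>Aut_group M\<^esub> \<psi> = comp_morphism M M M \<phi> \<psi>" for \<phi> \<psi>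
    by (simp_all add: Aut_group_def)
  have inv: "inv\<^bsub>Aut_group M\<^esub> \<phi> \<in> Aut M" "comp_morphism M M M \<phi> (inv\<^bsub>Aut_group M\<^esub> \<phi>) = ?id" if "\<phi> \<in> Aut M" for \<phi>
    using G.inv_closed[of \<phi>] G.r_inv[of \<phi>] that by (simp_all add: carr one mult)
  have inv_id: "inv\<^bsub>Aut_group M\<^esub> ?id = ?id" using G.inv_one by (simp only: one)
  show ?thesis
  proof (rule continuous_at_AutI[where F = "\<lambda>\<phi>. inv\<^bsub>Aut_group M\<^esub> \<phi>" and a = ?id and Y = T])
    show "?id \<in> topspace T" using id_Aut topspace_Aut by simp
    show "inv\<^bsub>Aut_group M\<^esub> \<phi> \<in> Aut M" if "\<phi> \<in> topspace T" for \<phi>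
      using that inv(1) topspace_Aut by simp
    show "openin T W0" "inv\<^bsub>Aut_group M\<^esub> ?id \<in> W0" using W0 inv_id by simp_all
    fix V c \<tau> p U f and \<eta> :: real
    assume cs: "coordinate_system m n M V c \<tau>" and p: "p \<in> V" and U: "openin X U"
      "under (inv\<^bsub>Aut_group M\<^esub> ?id) p \<in> U" and f: "f \<in> sects \<O> U" "\<eta> > 0"
    have "p \<in> topspace X" using p openin_subset[OF holo_chartD(1)[OF chart[OF cs]]] by blast
    then have pU: "p \<in> U" using U(2) unfolding inv_id by (simp add: id_morphism_def)
    from inverse_local[OF cs p U(1) pU f] obtain G N
      where G: "openin X G" "p \<in> G" and N: "openin T N" "?id \<in> N"
        and near: "\<forall>\<phi>\<in>N. \<forall>x\<in>G. \<forall>\<psi>. morphism M M \<psi> \<and> comp_morphism M M M \<phi> \<psi> = ?id \<longrightarrow>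
          pull_near V \<tau> ?id p \<eta> \<psi> x U f"
      by (elim exE conjE)
    have "pull_near V \<tau> ?id p \<eta> (inv\<^bsub>Aut_group M\<^esub> \<phi>) x U f" if "\<phi> \<in> N" "x \<in> G" for \<phi> x
    proof -
      have "\<phi> \<in> Aut M" using openin_subset[OF N(1)] that topspace_Aut by auto
      then show ?thesis using near that inv Aut_morphism by blast
    qed
    then show "\<exists>G N. openin X G \<and> p \<in> G \<and> openin T N \<and> ?id \<in> N \<and> (\<forall>\<phi>\<in>N. \<forall>x\<in>G.
        pull_near V \<tau> (inv\<^bsub>Aut_group M\<^esub> ?id) p \<eta> (inv\<^bsub>Aut_group M\<^esub> \<phi>) x U f)"
      unfolding inv_id using G N by (intro exI[of _ G] exI[of _ N]) simp
  qed
qed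

end

theorem proposition3p6:
  fixes M :: "('p, 's) supermanifold" and m n :: nat
  assumes "complex_supermanifold m n M"
    and "compact_space (body M)"
  shows "topological_group (Aut_group M) (Aut_topology m n M)"
proof -
  interpret complex_supermanifold m n M by fact
  interpret compact_complex_supermanifold m n M by unfold_locales fact
  show ?thesis
  proof (rule topological_groupI)
    show "group (Aut_group M)" by (rule Aut_group_group[OF sheaf_of_graded_algebras_axioms])
    show "topspace (Aut_topology m n M) = carrier (Aut_group M)"
      using topspace_Aut by (simp add: Aut_group_def)
    show "continuous_map (prod_topology (Aut_topology m n M) (Aut_topology m n M)) (Aut_topology m n M)
       (\<lambda>(x, y). x \<otimes>\<^bsub>Aut_group M\<^esub> y)"
      using comp_continuous by (simp add: Aut_group_def)
    fix W assume "openin (Aut_topology m n M) W" "\<one>\<^bsub>Aut_group M\<^esub> \<in> W"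
    then show "\<exists>N. openin (Aut_topology m n M) N \<and> \<one>\<^bsub>Aut_group M\<^esub> \<in> N \<and> (\<lambda>x. inv\<^bsub>Aut_group M\<^esub> x) ` N \<subseteq> W"
      using inverse_continuous_at_id[of W] by (simp add: Aut_group_def)
  qed
qed

end
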